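(* Let $N\in\mathbb{Z}_{\ge1}$, $r_n\in\mathbb{Z}$ for $n\mid N$, $\mathbf r=(r_n)_{n\mid N}$, $k'=\frac12\sum_{n\mid N}r_n$, $x_N=\sum_{n\mid N}nr_n$, $\varpi=\prod_{n\mid N}(N/n)^{|r_n|}$, and let $\chi_{\mathbf r}$ be the character of $\prod_{n\mid N}\eta(n\tau)^{r_n}$ on $\widetilde{\Gamma_0(N)}$. Let $f$ be a meromorphic modular form on $\Gamma_0(N)$ of weight $k\in k'+2\mathbb{Z}$ with character $\chi_{\mathbf r}$, and let $l\in L_{\mathbf r}$. Then: (a) there are $Y_0\ge0$ and uniquely determined $c_f(n),c_{T_lf}(n)\in\mathbb{C}$ such that on $\operatorname{Im}\tau>Y_0$ $$f(\tau)=\sum_{n\in\frac{x_N}{24}+\mathbb{Z}}c_f(n)q^n,\qquad T_lf(\tau)=\sum_{n\in\frac{x_N}{24}+\mathbb{Z}}c_{T_lf}(n)q^n,$$ where $T_l=T_{l;\chi_{\mathbf r},\chi_{\mathbf r}}$; (b) for $n\in\frac{x_N}{24}+\mathbb{Z}$, $$c_{T_lf}(n)=l^{-\frac k2}\sum_{\substack{a\mid l,\ d=l/a\\(a,N)=1}}\Big(\frac a\varpi\Big)a^k\,c_f\Big(\frac{ln}{a^2}\Big)\sum_{\substack{0\le b<d\\(a,b,d)=1}}\Big(\frac{-Nb}{(a,d)}\Big)^{2k}e\Big(bd\Big(\frac nl-\frac{x_N}{24}\Big)\Big)\psi_{l,\mathbf r}(a,b),$$ with the convention $c_f(\frac{ln}{a^2})=0$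 if $\frac{ln}{a^2}\notin\frac{x_N}{24}+\mathbb{Z}$, where $\psi_{l,\mathbf r}(a,b)=e\big(-\frac{k+\delta}4(d-1)+\frac{(k+\delta)(l-1)(N-1)}4\big)$ if $2\nmid l$; $=e\big(-\frac{k+\delta}4(a-1)-\frac{N(k+\delta)(1+\delta_1)}4b\big)$ if $2\mid l$, $2\mid N$; $=1$ if $2\mid l$, $2\nmid N$; here $\delta=0$ (resp. $1$) if $\varpi=2^\alpha(4m+1)$ (resp. $2^\alpha(4m+3)$) with $\alpha,m\in\mathbb{Z}_{\ge0}$, and $\delta_1=1$ if $2\mid l$, $4\mid N$, $k\in\frac12+\mathbb{Z}$ and $v_2(\varpi)$ is odd, $\delta_1=0$ otherwise.
   Context: $e(x)=\exp(2\pi ix)$, $q=e(\tau)$, $\eta(\tau)=q^{1/24}\prod(1-q^n)$. $\widetilde{\Gamma_0(N)}$: pairs $(\gamma,\varepsilon(c\tau+d)^{1/2})$, $\gamma=\begin{pmatrix}a&b\\c&d\end{pmatrix}\in\Gamma_0(N)$, $\varepsilon=\pm1$ (principal square root), product $(\gamma_1,\phi_1)(\gamma_2,\phi_2)=(\gamma_1\gamma_2,\phi_1(\gamma_2\tau)\phi_2(\tau))$; $\widetilde\gamma=(\gamma,(c\tau+d)^{1/2})$; $(g|_k(\gamma,\phi))(\tau)=\phi(\tau)^{-2k}g(\gamma\tau)$. $\chi_{\mathbf r}(\gamma,\varepsilon(c\tau+d)^{1/2})=\varepsilon^{-2k'}e\big(\frac1{24}\sum_{n\mid N}r_n\Psi\begin{pmatrix}a&bn\\c/n&d\end{pmatrix}\big)$,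 $\Psi\begin{pmatrix}a&b\\c&d\end{pmatrix}=\frac{a+d}c+12s(-d,c)-3$ ($c>0$), $\frac{a+d}c+12s(d,-c)+3$ ($c<0$), $b$ ($c=0,a>0$), $-b-6$ ($c=0,a<0$), $s(h,c)=\sum_{r\bmod c}((r/c))((hr/c))$, $((x))=x-\lfloor x\rfloor-\frac12$ ($x\notin\mathbb{Z}$), else $0$. Meromorphic modular form of weight $k$ with character $\chi$: meromorphic $g$ on $\mathbb{H}$ with $g|_k\gamma=\chi(\gamma)g$ for $\gamma\in\widetilde{\Gamma_0(N)}$ and, for all $\gamma\in\mathrm{SL}_2(\mathbb{Z})$, $g|_k\widetilde\gamma=\sum_{n\in\frac1h\mathbb{Z}}c_nq^n$ for $\operatorname{Im}\tau$ large with finitely many $n<0$ having $c_n\ne0$. $m_{\mathbf r}=24/\gcd(24,\sum_n(N/n)r_n,\sum_n nr_n)$; $L_{\mathbf r}=\{l\ge1:l\equiv1\bmod m_{\mathbf r}\}$ if $k'\in\mathbb{Z}$, and additionally $l$ a perfect square if $k'\in\frac12+\mathbb{Z}$. $T_{l;\chi,\chi}g(\tau)=l^{-k/2}\sum_{a\mid l,(N,a)=1}a^k\sum_{0\le b<d,(a,b,d)=1}\chi(\widetilde{\begin{pmatrix}-Nb+ax&z\\-Nd&y\end{pmatrix}})^{-1}\chi(\widetilde{\begin{pmatrix}ay&by-dz\\N&x\end{pmatrix}})^{-1}g(\frac{a\tau+b}d)$, $d=l/a$, with integers $x,y,z$ satisfying $(-Nb+ax)y+Ndz=1$ (independent of the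 choice for such $l$). $(\frac mn)$ is the Kronecker–Jacobi symbol, with $(\frac m0)=0$ for $m\ne\pm1$ and $(\frac{\pm1}0)=1$; $(a,d)=\gcd(a,d)$; $v_2$ is the 2-adic valuation. *)

theory Defs
  imports "HOL-Complex_Analysis.Complex_Analysis" "HOL-Number_Theory.Number_Theory"
begin

definition upper_half :: "complex set" where
  "upper_half = {z. Im z > 0}"

definition e :: "complex \<Rightarrow> complex" where
  "e x = exp (2 * of_real pi * \<i> * x)"

text \<open>2x2 integer matrices (a, b, c, d) = [[a,b],[c,d]]\<close>
type_synonym mat2 = "int \<times> int \<times> int \<times> int"

definition mobius :: "mat2 \<Rightarrow> complex \<Rightarrow> complex" where
  "mobius M \<tau> = (case M of (a, b, c, d) \<Rightarrow>
      (of_int a * \<tau> + of_int b) / (of_int c * \<tau> + of_int d))"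

definition in_SL2Z :: "mat2 \<Rightarrow> bool" where
  "in_SL2Z M \<longleftrightarrow> (case M of (a, b, c, d) \<Rightarrow> a * d - b * c = 1)"

definition in_Gamma0 :: "nat \<Rightarrow> mat2 \<Rightarrow> bool" where
  "in_Gamma0 N M \<longleftrightarrow> in_SL2Z M \<and> (case M of (a, b, c, d) \<Rightarrow> int N dvd c)"

text \<open>Slash action of the metaplectic element (gamma, eps * (c tau + d)^(1/2))
  (principal square root, eps = +1 or -1):
  (g |_k (gamma, phi))(tau) = phi(tau)^(-2k) g(gamma tau).  The element
  with eps = 1 is the canonical lift (tilde gamma).\<close>
definition slash :: "real \<Rightarrow> (complex \<Rightarrow> complex) \<Rightarrow> mat2 \<Rightarrow> int \<Rightarrow> complex \<Rightarrow> complex" where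
  "slash k g M \<epsilon> \<tau> = (case M of (a, b, c, d) \<Rightarrow>
      (of_int \<epsilon> * csqrt (of_int c * \<tau> + of_int d)) powr (of_real (- 2 * k)) * g (mobius M \<tau>))"

definition sawtooth :: "real \<Rightarrow> real" where
  "sawtooth x = (if x \<in> \<int> then 0 else x - of_int \<lfloor>x\<rfloor> - 1/2)"

definition dedekind_sum :: "int \<Rightarrow> int \<Rightarrow> real" where
  "dedekind_sum h c = (\<Sum>r\<in>{0..<c}. sawtooth (of_int r / of_int c) * sawtooth (of_int (h * r) / of_int c))"

definition Psi :: "mat2 \<Rightarrow> real" where
  "Psi M = (case M of (a, b, c, d) \<Rightarrow>
     if c > 0 then of_int (a + d) / of_int c + 12 * dedekind_sum (- d) c - 3
     else if c < 0 then of_int (a + d) / of_int c + 12 * dedekind_sum d (- c) + 3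
     else if a > 0 then of_int b
     else of_int (- b - 6))"

definition divs :: "nat \<Rightarrow> nat set" where
  "divs N = {n. n dvd N}"

definition kprime :: "nat \<Rightarrow> (nat \<Rightarrow> int) \<Rightarrow> real" where
  "kprime N r = (\<Sum>n\<in>divs N. of_int (r n)) / 2"

text \<open>chi_r(gamma, eps (c tau + d)^(1/2))\<close>
definition chi_r :: "nat \<Rightarrow> (nat \<Rightarrow> int) \<Rightarrow> mat2 \<Rightarrow> int \<Rightarrow> complex" where
  "chi_r N r M \<epsilon> = (case M of (a, b, c, d) \<Rightarrow>
      (of_int \<epsilon>) powr (of_real (- 2 * kprime N r)) *
      e (of_real ((1/24) * (\<Sum>n\<in>divs N. of_int (r n) * Psi (a, b * int n, c div int n, d)))))"

text \<open>Meromorphic functions are normalised (nicely meromorphic: value 0 at poles,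
  removable singularities filled in).\<close>
definition meromorphic_modular_form ::
  "nat \<Rightarrow> real \<Rightarrow> (mat2 \<Rightarrow> int \<Rightarrow> complex) \<Rightarrow> (complex \<Rightarrow> complex) \<Rightarrow> bool" where
  "meromorphic_modular_form N k chi g \<longleftrightarrow>
     g nicely_meromorphic_on upper_half \<and>
     (\<forall>M \<epsilon> \<tau>. in_Gamma0 N M \<and> \<epsilon> \<in> {1, -1} \<and> \<tau> \<in> upper_half \<longrightarrow>
         slash k g M \<epsilon> \<tau> = chi M \<epsilon> * g \<tau>) \<and>
     (\<forall>M. in_SL2Z M \<longrightarrow>
        (\<exists>h::nat. h > 0 \<and> (\<exists>Y::real. \<exists>c::int \<Rightarrow> complex.
           finite {m. m < 0 \<and> c m \<noteq> 0} \<and>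
           (\<forall>\<tau>. Im \<tau> > Y \<longrightarrow>
              ((\<lambda>m. c m * e (of_int m / of_nat h * \<tau>)) has_sum slash k g M 1 \<tau>) UNIV))))"

definition m_r :: "nat \<Rightarrow> (nat \<Rightarrow> int) \<Rightarrow> int" where
  "m_r N r = 24 div gcd (gcd 24 (\<Sum>n\<in>divs N. int (N div n) * r n)) (\<Sum>n\<in>divs N. int n * r n)"

definition L_r :: "nat \<Rightarrow> (nat \<Rightarrow> int) \<Rightarrow> nat set" where
  "L_r N r = {l. l \<ge> 1 \<and> [int l = 1] (mod m_r N r) \<and>
     (kprime N r \<in> {x + 1/2 | x. x \<in> \<int>} \<longrightarrow> (\<exists>t::nat. l = t ^ 2))}"

definition hecke :: "nat \<Rightarrow> real \<Rightarrow> (mat2 \<Rightarrow> int \<Rightarrow> complex) \<Rightarrow> nat \<Rightarrow>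
    (complex \<Rightarrow> complex) \<Rightarrow> complex \<Rightarrow> complex" where
  "hecke N k chi l g \<tau> =
     of_real (real l powr (- k / 2)) *
     (\<Sum>a\<in>{a. a dvd l \<and> coprime N a}.
        let d = l div a in
        of_real (real a powr k) *
        (\<Sum>b\<in>{b. b < d \<and> gcd (gcd a b) d = 1}.
           let (x, y, z) = (SOME (x, y, z). (- int N * int b + int a * x) * y + int N * int d * z = (1::int))
           in inverse (chi (- int N * int b + int a * x, z, - int N * int d, y) 1) *
              inverse (chi (int a * y, int b * y - int d * z, int N, x) 1) *
              g ((of_nat a * \<tau> + of_nat b) / of_nat d)))"

definition kron_prime :: "int \<Rightarrow> nat \<Rightarrow> int" where
  "kron_prime m p = (if p = 2 then (if even m then 0 else if m mod 8 \<in> {1, 7} then 1 else -1)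
                     else Legendre m (int p))"

definition kronecker :: "int \<Rightarrow> int \<Rightarrow> int" where
  "kronecker m n =
    (if n = 0 then (if m = 1 \<or> m = -1 then 1 else 0)
     else (if n < 0 \<and> m < 0 then -1 else 1) *
          (\<Prod>p\<in>prime_factors (nat \<bar>n\<bar>). kron_prime m p ^ multiplicity p (nat \<bar>n\<bar>)))"

definition x_N :: "nat \<Rightarrow> (nat \<Rightarrow> int) \<Rightarrow> int" where
  "x_N N r = (\<Sum>n\<in>divs N. int n * r n)"

definition varpi :: "nat \<Rightarrow> (nat \<Rightarrow> int) \<Rightarrow> nat" where
  "varpi N r = (\<Prod>n\<in>divs N. (N div n) ^ nat \<bar>r n\<bar>)"

definition exps :: "nat \<Rightarrow> (nat \<Rightarrow> int) \<Rightarrow> rat set" where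
  "exps N r = {of_int (x_N N r) / 24 + of_int m | m. m \<in> (UNIV :: int set)}"

definition delta0 :: "nat \<Rightarrow> (nat \<Rightarrow> int) \<Rightarrow> real" where
  "delta0 N r = (if \<exists>\<alpha> m::nat. varpi N r = 2 ^ \<alpha> * (4 * m + 1) then 0 else 1)"

definition delta1 :: "nat \<Rightarrow> (nat \<Rightarrow> int) \<Rightarrow> real \<Rightarrow> nat \<Rightarrow> real" where
  "delta1 N r k l = (if even l \<and> 4 dvd N \<and> k \<in> {x + 1/2 | x. x \<in> \<int>}
                        \<and> odd (multiplicity (2::nat) (varpi N r)) then 1 else 0)"

definition psi_lr :: "nat \<Rightarrow> (nat \<Rightarrow> int) \<Rightarrow> real \<Rightarrow> nat \<Rightarrow> nat \<Rightarrow> nat \<Rightarrow> complex" where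
  "psi_lr N r k l a b =
     (let d = l div a; \<delta> = delta0 N r; \<delta>\<^sub>1 = delta1 N r k l in
      if odd l then
        e (of_real (- (k + \<delta>) / 4 * (real d - 1) + (k + \<delta>) * (real l - 1) * (real N - 1) / 4))
      else if even N then
        e (of_real (- (k + \<delta>) / 4 * (real a - 1) - real N * (k + \<delta>) * (1 + \<delta>\<^sub>1) / 4 * real b))
      else 1)"

end

theory Submission
  imports Defs "HOL-Computational_Algebra.Nth_Powers"
begin

text \<open>
  Inserting the expansion of \<open>f\<close> into \<open>T\<^sub>l f\<close> reduces everything to the product of the two character
  values, which is \<open>e (T / 24)\<close> for a sum \<open>T\<close> of differences of two values of \<open>\<Psi>\<close> over \<open>n | N\<close>.
  Dedekind reciprocity gives \<open>\<Psi> \<gamma> = \<Psi> (\<gamma> S) + 3\<close>, and the Euclidean algorithm then determines \<open>\<Psi>\<close>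
  modulo 3 as a polynomial in the entries of the matrix and modulo 8 as a polynomial plus a Jacobi
  symbol. After summation over \<open>n\<close> most of these terms cancel, because \<open>l \<in> L\<^sub>r\<close> says that 24
  divides \<open>(l - 1) \<Sum> n r\<^sub>n\<close> and \<open>(l - 1) \<Sum> (N / n) r\<^sub>n\<close> and that \<open>l\<close> is a square if \<open>\<Sum> r\<^sub>n\<close> is odd.
  With \<open>O = \<Sum> m\<^sub>n r\<^sub>n\<close>, where \<open>m\<^sub>n\<close> is the odd part of \<open>N / n\<close>, what remains is a sign times
  \<open>e (- b d x\<^sub>N / 24) e (- O (a - 1) / 8)\<close>. The last factor is \<open>\<psi>\<close> in each of its three cases; in
  particular \<open>\<psi>\<close> does not depend on \<open>b\<close>.

  For an exponent outside \<open>x\<^sub>N / 24 + \<int>\<close> the sum over \<open>b\<close> runs over a function of period \<open>d\<close> which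
  the shift \<open>b \<mapsto> b + a\<close> multiplies by a root of unity other than 1, so it vanishes.
\<close>

subsection \<open>Signs as residues modulo 8\<close>

lemma cong_add_multI: "x = y + m * t \<Longrightarrow> [x = y] (mod m)" for x y m t :: int
  by (simp add: cong_iff_dvd_diff)

lemma cong_intE:
  fixes x y m :: int
  assumes "[x = y] (mod m)"
  obtains t where "x = y + m * t"
  using assms by (metis cong_iff_lin cong_sym)

lemma odd_square_cong_1: "odd x \<Longrightarrow> [x^2 = 1] (mod 8)" for x :: int
  using square_mod_8_eq_1_iff[of "nat \<bar>x\<bar>"] cong_int_iff[of "(nat \<bar>x\<bar>)^2" 1 8]
  by (simp add: even_nat_iff)

lemma odd_mod_8_cases:
  fixes x :: int
  assumes "odd x"
  obtains "x mod 8 = 1" | "x mod 8 = 3" | "x mod 8 = 5" | "x mod 8 = 7"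
proof -
  have "x mod 8 = 1 \<or> x mod 8 = 3 \<or> x mod 8 = 5 \<or> x mod 8 = 7" using assms by presburger
  then show thesis using that by blast
qed

lemma four_dvd_mult_even: "even x \<Longrightarrow> even y \<Longrightarrow> 4 dvd x * y" for x y :: int
  using mult_dvd_mono[of 2 x 2 y] by simp

lemma eight_dvd_mult_even: "even x \<Longrightarrow> even y \<Longrightarrow> even z \<Longrightarrow> 8 dvd x * y * z" for x y z :: int
  using mult_dvd_mono[OF four_dvd_mult_even, of x y 2 z] by simp

lemma eight_dvd_even_mult_four: "even x \<Longrightarrow> 4 dvd y \<Longrightarrow> 8 dvd x * y" for x y :: int
  using mult_dvd_mono[of 2 x 4 y] by simp

lemma eight_dvd_cancel_odd: "odd t \<Longrightarrow> 8 dvd t * q \<Longrightarrow> 8 dvd q" for t q :: int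
proof -
  assume "odd t" "8 dvd t * q"
  then have "coprime (2 ^ 3) t" by (simp only: coprime_power_left_iff) simp
  with \<open>8 dvd t * q\<close> show "8 dvd q" by (simp add: coprime_dvd_mult_right_iff)
qed

lemma odd_mult_pred_cong:
  fixes x y t :: int
  assumes "odd x" "odd y" "even t"
  shows "[(x * y - 1) * t = (x - 1) * t + (y - 1) * t] (mod 8)"
proof -
  have "8 dvd (x - 1) * (y - 1) * t" using assms by (intro eight_dvd_mult_even) auto
  then show ?thesis by (simp add: cong_iff_dvd_diff algebra_simps)
qed

text \<open>\<open>e (sign_log s / 8) = s\<close> for a sign \<open>s\<close>, so that products of signs become sums modulo 8.\<close>

definition sign_log :: "int \<Rightarrow> int" where
  "sign_log s = 2 - 2 * s"

lemma sign_log_1 [simp]: "sign_log 1 = 0"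
  by (simp add: sign_log_def)

lemma sign_log_mult:
  assumes "\<bar>s\<bar> = 1" "\<bar>t\<bar> = 1"
  shows "[sign_log (s * t) = sign_log s + sign_log t] (mod 8)"
proof -
  have "s = 1 \<or> s = -1" "t = 1 \<or> t = -1" using assms by linarith+
  then show ?thesis by (auto simp: sign_log_def cong_def)
qed

lemma sign_log_parity:
  assumes "\<bar>s\<bar> = 1" "[i = j] (mod 2)"
  shows "[i * sign_log s = j * sign_log s] (mod 8)"
proof -
  have "s = 1 \<or> s = -1" using assms(1) by linarith
  moreover obtain k where "i = j + 2 * k" using assms(2) by (rule cong_intE)
  ultimately show ?thesis by (auto simp: sign_log_def cong_iff_dvd_diff algebra_simps)
qed

lemma sign_log_power:
  assumes "\<bar>s\<bar> = 1"
  shows "[sign_log (s ^ n) = int n * sign_log s] (mod 8)"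
proof (induction n)
  case (Suc n)
  have "[sign_log (s * s ^ n) = sign_log s + sign_log (s ^ n)] (mod 8)"
    by (rule sign_log_mult) (simp_all add: assms power_abs)
  also have "[sign_log s + sign_log (s ^ n) = sign_log s + int n * sign_log s] (mod 8)"
    by (intro cong_add cong_refl Suc.IH)
  finally show ?case by (simp add: algebra_simps)
qed simp

lemma sign_log_minus_one_power: "[sign_log ((-1) ^ n) = 4 * int n] (mod 8)"
  using sign_log_power[of "-1" n] by (simp add: sign_log_def mult.commute)

definition chi8_log :: "int \<Rightarrow> int" where
  "chi8_log t = (t^2 - 1) div 2"

lemma two_chi8_log: "odd t \<Longrightarrow> 2 * chi8_log t = t^2 - 1"
  by (simp add: chi8_log_def)

lemma chi8_log_1 [simp]: "chi8_log 1 = 0"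
  by (simp add: chi8_log_def)

lemma chi8_log_mult:
  assumes "odd s" "odd t"
  shows "[chi8_log (s * t) = chi8_log s + chi8_log t] (mod 8)"
proof -
  obtain i j where ij: "s^2 = 1 + 8 * i" "t^2 = 1 + 8 * j"
    using assms[THEN odd_square_cong_1] by (elim cong_intE)
  have "2 * (chi8_log (s * t) - (chi8_log s + chi8_log t)) = (s^2 - 1) * (t^2 - 1)"
    using two_chi8_log[of s] two_chi8_log[of t] two_chi8_log[of "s * t"] assms
    by (simp add: algebra_simps)
  then have "chi8_log (s * t) = chi8_log s + chi8_log t + 8 * (4 * i * j)"
    unfolding ij by simp
  then show ?thesis by (rule cong_add_multI)
qed

lemma chi8_log_cong:
  assumes "odd s" "[s = t] (mod 8)"
  shows "[chi8_log s = chi8_log t] (mod 8)"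
proof -
  obtain k where k: "s = t + 8 * k" using assms(2) by (rule cong_intE)
  then have "odd t" using assms(1) by simp
  then have "2 * chi8_log s = 2 * (chi8_log t + 8 * (k * t + 4 * k^2))"
    unfolding two_chi8_log[OF assms(1)] two_chi8_log[OF \<open>odd t\<close>] distrib_left
    by (simp add: k power2_eq_square algebra_simps)
  then show ?thesis by (intro cong_add_multI[of _ _ _ "k * t + 4 * k^2"]) simp
qed

lemma four_dvd_chi8_log: "odd t \<Longrightarrow> 4 dvd chi8_log t"
  using odd_square_cong_1[of t] by (auto simp: chi8_log_def elim: cong_intE)

lemma chi8_log_add_2_cong:
  assumes "odd t"
  shows "[2 * (t + 1) + (t - 1) * (t + 1) + chi8_log t = chi8_log (t + 2)] (mod 8)"
proof -
  have "2 * (2 * (t + 1) + (t - 1) * (t + 1) - chi8_log t) = 2 * chi8_log (t + 2)"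
    using two_chi8_log[OF assms] two_chi8_log[of "t + 2"] assms
    by (simp add: algebra_simps power2_eq_square)
  moreover obtain i where "chi8_log t = 4 * i"
    using four_dvd_chi8_log[OF assms] by auto
  ultimately show ?thesis by (intro cong_add_multI[of _ _ _ i]) simp
qed

lemma chi8_log_eq_sign_log_kron_prime:
  assumes "odd t"
  shows "[chi8_log t = sign_log (kron_prime t 2)] (mod 8)"
proof -
  have "[chi8_log t = chi8_log (t mod 8)] (mod 8)"
    by (rule chi8_log_cong[OF assms]) (simp add: cong_def)
  then show ?thesis
    using assms by (cases rule: odd_mod_8_cases[OF assms])
      (simp_all add: kron_prime_def sign_log_def chi8_log_def cong_def)
qed

subsection \<open>The Kronecker symbol\<close>

lemma pos_prime_divisors_induct [consumes 1, case_names one factor]: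
  fixes n :: nat
  assumes "n > 0" "P 1" "\<And>p m. prime p \<Longrightarrow> m > 0 \<Longrightarrow> P m \<Longrightarrow> P (p * m)"
  shows "P n"
  using assms(1) by (induction n rule: prime_divisors_induct) (use assms(2,3) in auto)

lemma odd_prime_divisors_induct [consumes 1, case_names one factor]:
  fixes n :: nat
  assumes "odd n" "P 1"
    and "\<And>p m. prime p \<Longrightarrow> 2 < p \<Longrightarrow> odd p \<Longrightarrow> odd m \<Longrightarrow> P m \<Longrightarrow> P (p * m)"
  shows "P n"
  using assms(1)
proof (induction n rule: prime_divisors_induct)
  case (factor p m)
  then have "2 < p" using prime_ge_2_nat[of p] by (cases "p = 2") auto
  with factor show ?case by (auto intro: assms(3))
qed (use assms(2) in auto)

lemma eq_if_cong_abs_le_1: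
  fixes a b m :: int
  assumes "[a = b] (mod m)" "\<bar>a\<bar> \<le> 1" "\<bar>b\<bar> \<le> 1" "2 < m"
  shows "a = b"
  using assms zdvd_not_zless[of "\<bar>a - b\<bar>" m] by (fastforce simp: cong_iff_dvd_diff)

lemma abs_Legendre_le_1: "\<bar>Legendre a p\<bar> \<le> 1"
  by (simp add: Legendre_def)

lemma Legendre_mult:
  assumes "prime p" "2 < p"
  shows "Legendre (a * b) (int p) = Legendre a (int p) * Legendre b (int p)"
proof (rule eq_if_cong_abs_le_1)
  have euler: "[Legendre c (int p) = c ^ ((p - 1) div 2)] (mod int p)" for c
    by (rule euler_criterion[OF assms])
  have "[Legendre a (int p) * Legendre b (int p) = (a * b) ^ ((p - 1) div 2)] (mod int p)"
    unfolding power_mult_distrib by (intro cong_mult euler)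
  then show "[Legendre (a * b) (int p) = Legendre a (int p) * Legendre b (int p)] (mod int p)"
    using euler[of "a * b"] cong_sym cong_trans by blast
  show "\<bar>Legendre a (int p) * Legendre b (int p)\<bar> \<le> 1"
    unfolding abs_mult by (intro mult_le_one abs_Legendre_le_1) simp
qed (use assms abs_Legendre_le_1 in auto)

lemma Legendre_cong:
  assumes "[a = b] (mod p)"
  shows "Legendre a p = Legendre b p"
proof -
  have "[c = a] (mod p) \<longleftrightarrow> [c = b] (mod p)" "[a = c] (mod p) \<longleftrightarrow> [b = c] (mod p)" for c
    using assms cong_sym cong_trans by blast+
  then show ?thesis by (simp add: Legendre_def QuadRes_def)
qed

lemma Legendre_minus_one:
  assumes "prime p" "2 < p"
  shows "Legendre (-1) (int p) = (-1) ^ ((p - 1) div 2)"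
  by (rule eq_if_cong_abs_le_1[OF euler_criterion[OF assms]])
    (use assms in \<open>simp_all add: abs_Legendre_le_1 power_abs\<close>)

lemma kron_prime_mult:
  assumes "prime p"
  shows "kron_prime (a * b) p = kron_prime a p * kron_prime b p"
proof (cases "p = 2")
  case True
  show ?thesis
  proof (cases "even a \<or> even b")
    case False
    then have "odd a" "odd b" by auto
    moreover have "(a * b) mod 8 = ((a mod 8) * (b mod 8)) mod 8" by (simp add: mod_mult_eq)
    ultimately show ?thesis unfolding True kron_prime_def
      by (cases rule: odd_mod_8_cases[OF \<open>odd a\<close>]; cases rule: odd_mod_8_cases[OF \<open>odd b\<close>]) simp_all
  qed (use True in \<open>auto simp: kron_prime_def\<close>)
next
  case False
  then have "2 < p" using assms prime_ge_2_nat[of p] by linarith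
  then show ?thesis using Legendre_mult[OF assms] False by (simp add: kron_prime_def)
qed

lemma abs_kron_prime:
  assumes "prime p" "coprime a (int p)"
  shows "\<bar>kron_prime a p\<bar> = 1"
proof -
  have "\<not> int p dvd a" using assms coprime_common_divisor[of a "int p" "int p"] by auto
  then show ?thesis by (auto simp: kron_prime_def Legendre_def cong_0_iff)
qed

lemma kronecker_eq_prod_mset:
  assumes "n > 0"
  shows "kronecker a (int n) = (\<Prod>p\<in>#prime_factorization n. kron_prime a p)"
proof -
  have "(\<Prod>p\<in>#prime_factorization n. kron_prime a p)
      = (\<Prod>p\<in>prime_factors n. kron_prime a p ^ count (prime_factorization n) p)"
    by (rule image_prod_mset_multiplicity)
  also have "\<dots> = (\<Prod>p\<in>prime_factors n. kron_prime a p ^ multiplicity p n)"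
    by (intro prod.cong refl) (simp add: count_prime_factorization_prime in_prime_factors_iff)
  finally show ?thesis using assms by (simp add: kronecker_def)
qed

lemma kronecker_1_right [simp]: "kronecker a 1 = 1"
  using kronecker_eq_prod_mset[of 1 a] by simp

lemma kronecker_prime_right: "prime p \<Longrightarrow> kronecker a (int p) = kron_prime a p"
  by (simp add: kronecker_eq_prod_mset prime_gt_0_nat prime_factorization_prime)

lemma kronecker_mult_right:
  assumes "m > 0" "n > 0"
  shows "kronecker a (int (m * n)) = kronecker a (int m) * kronecker a (int n)"
  using assms by (simp only: kronecker_eq_prod_mset nat_0_less_mult_iff)
    (simp add: prime_factorization_mult)

lemma kronecker_power_right:
  assumes "n > 0"
  shows "kronecker a (int (n ^ k)) = kronecker a (int n) ^ k"
proof (induction k)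
  case (Suc k)
  then show ?case using kronecker_mult_right[of n "n ^ k" a] assms by simp
qed simp

lemma kronecker_mult_left:
  assumes "n > 0"
  shows "kronecker (a * b) (int n) = kronecker a (int n) * kronecker b (int n)"
proof -
  have "image_mset (kron_prime (a * b)) (prime_factorization n)
      = image_mset (\<lambda>p. kron_prime a p * kron_prime b p) (prime_factorization n)"
    by (intro image_mset_cong kron_prime_mult) (rule in_prime_factors_imp_prime)
  then show ?thesis by (simp add: kronecker_eq_prod_mset[OF assms] prod_mset.distrib)
qed

lemma abs_kronecker:
  assumes "n > 0" "coprime a (int n)"
  shows "\<bar>kronecker a (int n)\<bar> = 1"
  using assms
proof (induction n rule: pos_prime_divisors_induct)
  case (factor p n)
  have "\<bar>kron_prime a p\<bar> = 1" "\<bar>kronecker a (int n)\<bar> = 1"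
    using factor by (auto intro: abs_kron_prime)
  then show ?case
    using factor.hyps
    by (simp only: kronecker_mult_right prime_gt_0_nat kronecker_prime_right abs_mult)
qed simp

lemma kronecker_cong:
  assumes "odd n" "[a = b] (mod int n)"
  shows "kronecker a (int n) = kronecker b (int n)"
  using assms
proof (induction n rule: odd_prime_divisors_induct)
  case (factor p n)
  then have cong: "[a = b] (mod int p)" "[a = b] (mod int n)"
    by (auto intro: cong_dvd_modulus)
  have "n > 0" using factor.hyps by (auto intro: Nat.gr0I)
  then show ?case
    using factor.IH[OF cong(2)] Legendre_cong[OF cong(1)] factor.hyps
    by (simp only: kronecker_mult_right prime_gt_0_nat kronecker_prime_right)
      (simp add: kron_prime_def)
qed simp

lemma kronecker_1_left [simp]:
  assumes "n > 0"
  shows "kronecker 1 (int n) = 1"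
proof -
  have "kronecker 1 (int n) * kronecker 1 (int n) = kronecker 1 (int n)"
    using kronecker_mult_left[OF assms, of 1 1] by simp
  moreover have "kronecker 1 (int n) \<noteq> 0" using abs_kronecker[OF assms, of 1] by auto
  ultimately show ?thesis by simp
qed

subsection \<open>Quadratic reciprocity in additive form\<close>

definition kron_log :: "int \<Rightarrow> nat \<Rightarrow> int" where
  "kron_log a n = sign_log (kronecker a (int n))"

lemma kron_log_1_left [simp]: "n > 0 \<Longrightarrow> kron_log 1 n = 0"
  by (simp add: kron_log_def)

lemma kron_log_1_right [simp]: "kron_log a (Suc 0) = 0"
  using kronecker_1_right[of a] by (simp add: kron_log_def)

lemma kron_log_mult_right:
  assumes "m > 0" "n > 0" "coprime a (int (m * n))"
  shows "[kron_log a (m * n) = kron_log a m + kron_log a n] (mod 8)"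
  unfolding kron_log_def kronecker_mult_right[OF assms(1,2)]
  by (intro sign_log_mult abs_kronecker) (use assms in auto)

lemma kron_log_mult_left:
  assumes "n > 0" "coprime a (int n)" "coprime b (int n)"
  shows "[kron_log (a * b) n = kron_log a n + kron_log b n] (mod 8)"
  unfolding kron_log_def kronecker_mult_left[OF assms(1)]
  by (intro sign_log_mult abs_kronecker assms)

lemma kron_log_power_left:
  assumes "n > 0" "coprime a (int n)"
  shows "[kron_log (a ^ i) n = int i * kron_log a n] (mod 8)"
proof -
  have "kronecker (a ^ i) (int n) = kronecker a (int n) ^ i"
    by (induction i) (use assms(1) in \<open>simp_all add: kronecker_mult_left\<close>)
  then show ?thesis
    unfolding kron_log_def by (simp add: sign_log_power abs_kronecker assms)
qed

lemma kron_log_cong: "odd n \<Longrightarrow> [a = b] (mod int n) \<Longrightarrow> kron_log a n = kron_log b n"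
  by (simp add: kron_log_def kronecker_cong)

lemma kron_log_parity:
  assumes "n > 0" "coprime a (int n)" "[i = j] (mod 2)"
  shows "[i * kron_log a n = j * kron_log a n] (mod 8)"
  unfolding kron_log_def by (intro sign_log_parity abs_kronecker assms)

lemma kron_log_minus_one:
  assumes "odd n"
  shows "[kron_log (-1) n = 2 * (int n - 1)] (mod 8)"
  using assms
proof (induction n rule: odd_prime_divisors_induct)
  case (factor p n)
  have pos: "p > 0" "n > 0" using factor.hyps by (auto intro: odd_pos)
  have "kron_log (-1) p = sign_log ((-1) ^ ((p - 1) div 2))"
    using factor.hyps Legendre_minus_one[of p]
    by (simp add: kron_log_def kronecker_prime_right kron_prime_def)
  also have "[\<dots> = 4 * int ((p - 1) div 2)] (mod 8)"
    by (rule sign_log_minus_one_power)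
  also have "4 * int ((p - 1) div 2) = 2 * (int p - 1)"
    using factor.hyps by (auto elim!: oddE)
  finally have prime: "[kron_log (-1) p = 2 * (int p - 1)] (mod 8)" .
  have "[kron_log (-1) (p * n) = kron_log (-1) p + kron_log (-1) n] (mod 8)"
    by (rule kron_log_mult_right) (use pos in auto)
  also have "[kron_log (-1) p + kron_log (-1) n = 2 * (int p - 1) + 2 * (int n - 1)] (mod 8)"
    by (intro cong_add prime factor.IH)
  also have "[2 * (int p - 1) + 2 * (int n - 1) = 2 * (int (p * n) - 1)] (mod 8)"
    using cong_sym[OF odd_mult_pred_cong[of "int p" "int n" 2]] factor.hyps
    by (simp add: mult.commute)
  finally show ?case .
qed simp

lemma kron_log_reciprocity_mult:
  assumes "odd m" "odd m'" "odd n" "coprime (m * m') n"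
    and "[kron_log (int m) n + kron_log (int n) m = (int m - 1) * (int n - 1)] (mod 8)"
    and "[kron_log (int m') n + kron_log (int n) m' = (int m' - 1) * (int n - 1)] (mod 8)"
  shows "[kron_log (int (m * m')) n + kron_log (int n) (m * m')
      = (int (m * m') - 1) * (int n - 1)] (mod 8)"
proof -
  have pos: "m > 0" "m' > 0" "n > 0" using assms(1-3) by (auto intro: odd_pos)
  have "[kron_log (int (m * m')) n + kron_log (int n) (m * m')
      = (kron_log (int m) n + kron_log (int m') n)
          + (kron_log (int n) m + kron_log (int n) m')] (mod 8)"
    unfolding of_nat_mult[of m m'] using assms(4) pos
    by (intro cong_add kron_log_mult_left kron_log_mult_right) (auto simp: coprime_commute)
  also have "(kron_log (int m) n + kron_log (int m') n) + (kron_log (int n) m + kron_log (int n) m')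
      = (kron_log (int m) n + kron_log (int n) m) + (kron_log (int m') n + kron_log (int n) m')"
    by simp
  also have "[\<dots> = (int m - 1) * (int n - 1) + (int m' - 1) * (int n - 1)] (mod 8)"
    by (intro cong_add assms)
  also have "[(int m - 1) * (int n - 1) + (int m' - 1) * (int n - 1)
      = (int (m * m') - 1) * (int n - 1)] (mod 8)"
    unfolding of_nat_mult by (rule cong_sym, rule odd_mult_pred_cong) (use assms(1-3) in auto)
  finally show ?thesis .
qed

lemma kron_log_reciprocity_prime_prime:
  assumes "prime p" "2 < p" "prime q" "2 < q" "p \<noteq> q"
  shows "[kron_log (int p) q + kron_log (int q) p = (int p - 1) * (int q - 1)] (mod 8)"
proof -
  have "odd p" "odd q" using assms prime_odd_nat by auto
  have kronecker: "kronecker (int p) (int q) = Legendre p q"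
    "kronecker (int q) (int p) = Legendre q p"
    using assms by (simp_all add: kronecker_prime_right kron_prime_def)
  have "coprime p q" using assms by (simp add: primes_coprime)
  have "[kron_log (int p) q + kron_log (int q) p = sign_log (Legendre p q * Legendre q p)] (mod 8)"
    unfolding kron_log_def kronecker[symmetric] using assms \<open>coprime p q\<close>
    by (intro cong_sym[OF sign_log_mult] abs_kronecker) (auto simp: coprime_commute)
  also have "Legendre p q * Legendre q p = (-1) ^ ((p - 1) div 2 * ((q - 1) div 2))"
    by (rule Quadratic_Reciprocity[OF assms])
  also have "[sign_log \<dots> = 4 * int ((p - 1) div 2 * ((q - 1) div 2))] (mod 8)"
    by (rule sign_log_minus_one_power)
  also have "4 * int ((p - 1) div 2 * ((q - 1) div 2)) = (int p - 1) * (int q - 1)"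
    using \<open>odd p\<close> \<open>odd q\<close> by (auto elim!: oddE)
  finally show ?thesis .
qed

lemma kron_log_reciprocity_prime:
  assumes "odd n" "prime p" "2 < p" "coprime p n"
  shows "[kron_log (int p) n + kron_log (int n) p = (int p - 1) * (int n - 1)] (mod 8)"
  using assms(1,4)
proof (induction n rule: odd_prime_divisors_induct)
  case one
  then show ?case using assms(2) by (simp add: prime_gt_0_nat)
next
  case (factor q n)
  have "odd p" using assms(2,3) prime_odd_nat by auto
  moreover have "[kron_log (int q) p + kron_log (int p) q = (int q - 1) * (int p - 1)] (mod 8)"
    using factor assms by (intro kron_log_reciprocity_prime_prime) auto
  moreover have "[kron_log (int n) p + kron_log (int p) n = (int n - 1) * (int p - 1)] (mod 8)"
    using factor by (simp add: add.commute mult.commute)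
  ultimately have "[kron_log (int (q * n)) p + kron_log (int p) (q * n)
      = (int (q * n) - 1) * (int p - 1)] (mod 8)"
    using factor by (intro kron_log_reciprocity_mult) (auto simp: coprime_commute)
  then show ?case by (simp only: add.commute mult.commute)
qed

lemma kron_log_reciprocity:
  assumes "odd m" "odd n" "coprime m n"
  shows "[kron_log (int m) n = (int m - 1) * (int n - 1) + kron_log (int n) m] (mod 8)"
proof -
  have symmetric: "[kron_log (int m) n + kron_log (int n) m = (int m - 1) * (int n - 1)] (mod 8)"
    using assms(1,3)
  proof (induction m rule: odd_prime_divisors_induct)
    case one
    have "n > 0" using assms(2) by (rule odd_pos)
    then show ?case by simp
  next
    case (factor p m)
    then show ?case using assms(2)
      by (intro kron_log_reciprocity_mult[OF _ _ _ _ kron_log_reciprocity_prime]) auto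
  qed
  have "m > 0" using assms(1) by (auto intro: odd_pos)
  then have "[(-1) * kron_log (int n) m = 1 * kron_log (int n) m] (mod 8)"
    using assms(3) by (intro kron_log_parity) (auto simp: coprime_commute cong_def)
  with symmetric have "[kron_log (int m) n + kron_log (int n) m + (-1) * kron_log (int n) m
      = (int m - 1) * (int n - 1) + 1 * kron_log (int n) m] (mod 8)"
    by (rule cong_add)
  then show ?thesis by simp
qed

lemma kron_log_two:
  assumes "odd n"
  shows "[kron_log 2 n = chi8_log (int n)] (mod 8)"
  using assms
proof (induction n rule: less_induct)
  case (less n)
  show ?case
  proof (cases "n = 1")
    case False
    then obtain k where k: "n = k + 2" "odd k"
      using less.prems by (auto elim!: oddE intro!: that[of "n - 2"])
    have "coprime k (k + 2)"
      using k(2) by (metis coprime_iff_gcd_eq_1 gcd_add2 coprime_right_2_iff_odd)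
    then have coprime: "coprime k n" by (simp only: k(1))
    have "kron_log 2 n = kron_log (-1 * int k) n"
      by (rule kron_log_cong[OF less.prems]) (simp add: k(1) cong_iff_dvd_diff)
    also have "[\<dots> = kron_log (-1) n + kron_log (int k) n] (mod 8)"
      by (rule kron_log_mult_left) (use odd_pos[OF less.prems] coprime in simp_all)
    also have "[kron_log (-1) n + kron_log (int k) n
        = 2 * (int n - 1) + ((int k - 1) * (int n - 1) + kron_log (int n) k)] (mod 8)"
      by (intro cong_add kron_log_minus_one kron_log_reciprocity less.prems k(2) coprime)
    also have "kron_log (int n) k = kron_log 2 k"
      by (rule kron_log_cong[OF k(2)]) (simp add: k(1) cong_iff_dvd_diff)
    also have "[2 * (int n - 1) + ((int k - 1) * (int n - 1) + kron_log 2 k)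
        = 2 * (int n - 1) + ((int k - 1) * (int n - 1) + chi8_log (int k))] (mod 8)"
      by (intro cong_add cong_refl less.IH) (simp_all add: k)
    also have "[2 * (int n - 1) + ((int k - 1) * (int n - 1) + chi8_log (int k))
        = chi8_log (int n)] (mod 8)"
      using chi8_log_add_2_cong[of "int k"] k by (simp add: algebra_simps)
    finally show ?thesis .
  qed simp
qed

subsection \<open>Odd parts\<close>

definition odd_part :: "nat \<Rightarrow> nat" where
  "odd_part m = m div 2 ^ multiplicity 2 m"

lemma odd_part_decompose: "2 ^ multiplicity 2 m * odd_part m = m"
  by (simp add: odd_part_def multiplicity_dvd)

lemma int_odd_part_decompose: "2 ^ multiplicity 2 m * int (odd_part m) = int m"
  using arg_cong[OF odd_part_decompose, of int m] by simp

lemma odd_part_dvd: "odd_part m dvd m"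
  using odd_part_decompose[of m] by (metis dvd_triv_right)

lemma odd_odd_part: "m > 0 \<Longrightarrow> odd (odd_part m)"
  unfolding odd_part_def using multiplicity_decompose[of m 2] by simp

lemma odd_part_pos: "m > 0 \<Longrightarrow> odd_part m > 0"
  using odd_odd_part[of m] by (auto intro: odd_pos)

lemma multiplicity_2_mult:
  "m > 0 \<Longrightarrow> n > 0 \<Longrightarrow> multiplicity 2 (m * n :: nat) = multiplicity 2 m + multiplicity 2 n"
  by (rule prime_elem_multiplicity_mult_distrib) auto

lemma multiplicity_2_power: "m > 0 \<Longrightarrow> multiplicity 2 (m ^ k :: nat) = k * multiplicity 2 m"
  by (rule prime_elem_multiplicity_power_distrib) auto

lemma multiplicity_2_odd: "odd m \<Longrightarrow> multiplicity 2 (m :: nat) = 0"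
  by (rule not_dvd_imp_multiplicity_0)

lemma odd_part_odd: "odd m \<Longrightarrow> odd_part m = m"
  by (simp add: odd_part_def multiplicity_2_odd)

lemma odd_part_mult:
  assumes "m > 0" "n > 0"
  shows "odd_part (m * n) = odd_part m * odd_part n"
proof -
  have "2 ^ multiplicity 2 (m * n) * odd_part (m * n)
      = (2 ^ multiplicity 2 m * odd_part m) * (2 ^ multiplicity 2 n * odd_part n)"
    by (simp only: odd_part_decompose)
  also have "\<dots> = 2 ^ multiplicity 2 (m * n) * (odd_part m * odd_part n)"
    by (simp add: multiplicity_2_mult[OF assms] power_add)
  finally show ?thesis by simp
qed

lemma odd_part_power: "m > 0 \<Longrightarrow> odd_part (m ^ k) = odd_part m ^ k"
  by (induction k) (simp_all add: odd_part_mult odd_part_odd)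

lemma odd_part_mod_4_iff: "odd_part n mod 4 = 1 \<longleftrightarrow> (\<exists>\<alpha> m. n = 2 ^ \<alpha> * (4 * m + 1))"
proof
  assume "odd_part n mod 4 = 1"
  then have "odd_part n = 4 * (odd_part n div 4) + 1" by presburger
  then show "\<exists>\<alpha> m. n = 2 ^ \<alpha> * (4 * m + 1)" using odd_part_decompose[of n] by metis
next
  assume "\<exists>\<alpha> m. n = 2 ^ \<alpha> * (4 * m + 1)"
  then obtain \<alpha> m where n: "n = 2 ^ \<alpha> * (4 * m + 1)" by blast
  have "odd_part n = odd_part (2 ^ \<alpha>) * odd_part (4 * m + 1)"
    unfolding n by (rule odd_part_mult) simp_all
  also have "odd_part (2 ^ \<alpha>) = 1" by (simp add: odd_part_power) (simp add: odd_part_def)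
  also have "odd_part (4 * m + 1) = 4 * m + 1" by (rule odd_part_odd) simp
  finally show "odd_part n mod 4 = 1" by simp
qed

lemma kron_log_odd_part:
  assumes "m > 0" "coprime a (int m)"
  shows "[kron_log a m = int (multiplicity 2 m) * chi8_log a + kron_log a (odd_part m)] (mod 8)"
proof (cases "even m")
  case True
  then have "odd a" using coprime_common_divisor[OF assms(2), of 2] by auto
  have "[kron_log a (2 ^ multiplicity 2 m * odd_part m)
      = kron_log a (2 ^ multiplicity 2 m) + kron_log a (odd_part m)] (mod 8)"
    by (rule kron_log_mult_right) (use assms odd_part_pos in \<open>simp_all add: int_odd_part_decompose\<close>)
  also have "kron_log a (2 ^ multiplicity 2 m) = sign_log (kron_prime a 2 ^ multiplicity 2 m)"
    using kronecker_power_right[of 2 a] kronecker_prime_right[of 2 a] by (simp add: kron_log_def)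
  also have "[\<dots> + kron_log a (odd_part m)
      = int (multiplicity 2 m) * chi8_log a + kron_log a (odd_part m)] (mod 8)"
  proof (intro cong_add cong_refl)
    have "\<bar>kron_prime a 2\<bar> = 1" using \<open>odd a\<close> by (intro abs_kron_prime) auto
    then have "[sign_log (kron_prime a 2 ^ multiplicity 2 m)
        = int (multiplicity 2 m) * sign_log (kron_prime a 2)] (mod 8)"
      by (rule sign_log_power)
    then show "[sign_log (kron_prime a 2 ^ multiplicity 2 m)
        = int (multiplicity 2 m) * chi8_log a] (mod 8)"
      using chi8_log_eq_sign_log_kron_prime[OF \<open>odd a\<close>]
      by (meson cong_mult cong_refl cong_sym cong_trans)
  qed
  finally show ?thesis by (simp add: odd_part_decompose)
qed (simp add: multiplicity_2_odd odd_part_odd)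

subsection \<open>Dedekind sums\<close>

lemma div_less_iff_less_mult_int:
  fixes a b c :: int
  assumes "0 < b"
  shows "a div b < c \<longleftrightarrow> a < c * b"
proof -
  have "a div b < c \<longleftrightarrow> \<lfloor>of_int a / of_int b :: real\<rfloor> < c"
    by (simp add: floor_divide_of_int_eq)
  also have "\<dots> \<longleftrightarrow> of_int a < (of_int (c * b) :: real)"
    using assms by (simp add: floor_less_iff pos_divide_less_eq)
  finally show ?thesis by (simp only: of_int_less_iff)
qed

lemma sum_int_lessThan: "0 \<le> k \<Longrightarrow> 2 * (\<Sum>r\<in>{0..<k}. r) = k * (k - 1)" for k :: int
proof (induction k rule: int_ge_induct)
  case (step k)
  have "{0..<k + 1} = insert k {0..<k}" using step.hyps by auto
  then show ?case using step.IH by (simp add: algebra_simps)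
qed simp

lemma sum_squares_int_lessThan:
  "0 \<le> k \<Longrightarrow> 6 * (\<Sum>r\<in>{0..<k}. r^2) = (k - 1) * k * (2 * k - 1)" for k :: int
proof (induction k rule: int_ge_induct)
  case (step k)
  have "{0..<k + 1} = insert k {0..<k}" using step.hyps by auto
  then show ?case using step.IH by (simp add: algebra_simps power2_eq_square)
qed simp

lemma sum_mult_mod_coprime:
  fixes h k :: int
  assumes "0 < k" "coprime h k"
  shows "(\<Sum>r\<in>{0..<k}. g (h * r mod k)) = (\<Sum>r\<in>{0..<k}. g r)"
proof -
  have "{0..<k} = insert 0 {1..<k}" using assms(1) by auto
  then show ?thesis
    using sum.reindex_bij_betw[OF bij_betw_int_remainders_mult[OF assms(2)], of g] by simp
qed

definition floor_sum :: "int \<Rightarrow> int \<Rightarrow> int" where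
  "floor_sum h k = (\<Sum>r\<in>{0..<k}. r * (h * r div k))"

lemma mod_eq_minus_mult_div: "a mod b = a - b * (a div b)" for a b :: int
  by (rule minus_mult_div_eq_mod[symmetric])

lemma sum_mult_mod_eq_floor_sum:
  "(\<Sum>r\<in>{0..<k}. r * (h * r mod k)) = h * (\<Sum>r\<in>{0..<k}. r^2) - k * floor_sum h k"
proof -
  have "r * (h * r mod k) = h * r^2 - k * (r * (h * r div k))" for r
    unfolding mod_eq_minus_mult_div by (simp add: algebra_simps power2_eq_square)
  then show ?thesis by (simp add: floor_sum_def sum_subtractf sum_distrib_left)
qed

lemma sum_floor_multiples:
  fixes h k :: int
  assumes "0 < k" "coprime h k"
  shows "2 * (\<Sum>r\<in>{0..<k}. h * r div k) = (h - 1) * (k - 1)"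
proof -
  have "(\<Sum>r\<in>{0..<k}. r) = (\<Sum>r\<in>{0..<k}. h * r mod k)"
    by (rule sum_mult_mod_coprime[OF assms, of "\<lambda>r. r", symmetric])
  also have "\<dots> = h * (\<Sum>r\<in>{0..<k}. r) - k * (\<Sum>r\<in>{0..<k}. h * r div k)"
    unfolding mod_eq_minus_mult_div by (simp add: sum_distrib_left sum_subtractf)
  finally have "k * (2 * (\<Sum>r\<in>{0..<k}. h * r div k)) = (h - 1) * (2 * (\<Sum>r\<in>{0..<k}. r))"
    by (simp add: algebra_simps)
  also have "\<dots> = k * ((h - 1) * (k - 1))"
    using sum_int_lessThan[of k] assms(1) by simp
  finally show ?thesis using assms(1) by simp
qed

lemma sum_floor_multiples_squared:
  fixes h k :: int
  assumes "0 < k" "coprime h k"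
  shows "k^2 * (\<Sum>r\<in>{0..<k}. (h * r div k)^2)
    = 2 * h * k * floor_sum h k - (h^2 - 1) * (\<Sum>r\<in>{0..<k}. r^2)"
proof -
  have mod_sq: "(h * r mod k)^2
      = h^2 * r^2 - 2 * h * k * (r * (h * r div k)) + k^2 * (h * r div k)^2" for r
    unfolding mod_eq_minus_mult_div by (simp add: power2_eq_square algebra_simps)
  have "(\<Sum>r\<in>{0..<k}. r^2) = (\<Sum>r\<in>{0..<k}. (h * r mod k)^2)"
    by (rule sum_mult_mod_coprime[OF assms, of "\<lambda>r. r^2", symmetric])
  also have "\<dots> = h^2 * (\<Sum>r\<in>{0..<k}. r^2) - 2 * h * k * floor_sum h k
      + k^2 * (\<Sum>r\<in>{0..<k}. (h * r div k)^2)"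
    unfolding mod_sq floor_sum_def by (simp add: sum.distrib sum_subtractf sum_distrib_left)
  finally show ?thesis by (simp add: algebra_simps)
qed

lemma sum_multiples_above_floor:
  fixes h k v :: int
  assumes "0 < h" "0 < k" "coprime h k" "v \<in> {1..<h}"
  shows "(\<Sum>r\<in>{r\<in>{0..<k}. v \<le> h * r div k}. 2 * v) = 2 * v * (k - 1 - k * v div h)"
proof -
  have "k * v \<noteq> h * r" for r
  proof
    assume "k * v = h * r"
    then have "h dvd v" using assms(3) by (metis coprime_dvd_mult_right_iff dvd_triv_left)
    then show False using assms(4) zdvd_not_zless by auto
  qed
  then have above: "v \<le> h * r div k \<longleftrightarrow> k * v div h < r" for r
    using div_less_iff_less_mult_int[OF assms(2), of "h * r" v]
      div_less_iff_less_mult_int[OF assms(1), of "k * v" r]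
    by (metis linorder_not_less mult.commute order_le_less)
  have "0 \<le> k * v div h" "k * v div h < k"
    using assms by (simp_all add: pos_imp_zdiv_nonneg_iff div_less_iff_less_mult_int)
  then have "{r\<in>{0..<k}. v \<le> h * r div k} = {k * v div h + 1..<k}"
    unfolding above by auto
  then show ?thesis using \<open>k * v div h < k\<close> by simp
qed

text \<open>Both sides sum \<open>2 v\<close> over the lattice points \<open>(r, v)\<close>, \<open>0 < v\<close>, below the line of slope
  \<open>h / k\<close>.\<close>

lemma sum_floor_swap:
  fixes h k :: int
  assumes "0 < h" "0 < k" "coprime h k"
  shows "(\<Sum>r\<in>{0..<k}. (h * r div k) * (h * r div k + 1))
       = 2 * (\<Sum>v\<in>{0..<h}. v * (k - 1 - k * v div h))"
proof -
  have "(h * r div k) * (h * r div k + 1) = (\<Sum>v\<in>{v\<in>{1..<h}. v \<le> h * r div k}. 2 * v)"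
    if "r \<in> {0..<k}" for r
  proof -
    have "0 \<le> h * r div k" "h * r div k < h"
      using assms(1,2) that by (simp_all add: pos_imp_zdiv_nonneg_iff div_less_iff_less_mult_int)
    then have below: "{v\<in>{1..<h}. v \<le> h * r div k} = {0..<h * r div k + 1} - {0}" by auto
    show ?thesis
      using sum_int_lessThan[of "h * r div k + 1"] \<open>0 \<le> h * r div k\<close>
      unfolding below by (simp add: sum_diff1 sum_distrib_left mult.commute)
  qed
  then have "(\<Sum>r\<in>{0..<k}. (h * r div k) * (h * r div k + 1))
      = (\<Sum>r\<in>{0..<k}. \<Sum>v\<in>{v\<in>{1..<h}. v \<le> h * r div k}. 2 * v)"
    by (intro sum.cong refl)
  also have "\<dots> = (\<Sum>v\<in>{1..<h}. \<Sum>r\<in>{r\<in>{0..<k}. v \<le> h * r div k}. 2 * v)"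
    by (rule sum.swap_restrict) simp_all
  also have "\<dots> = (\<Sum>v\<in>{1..<h}. 2 * v * (k - 1 - k * v div h))"
    by (intro sum.cong refl sum_multiples_above_floor[OF assms])
  also have "\<dots> = (\<Sum>v\<in>{0..<h}. 2 * v * (k - 1 - k * v div h))"
    by (rule sum.mono_neutral_left) auto
  finally show ?thesis by (simp add: sum_distrib_left mult.assoc)
qed

lemma floor_sum_reciprocity:
  fixes h k :: int
  assumes "0 < h" "0 < k" "coprime h k"
  shows "12 * (h * floor_sum h k + k * floor_sum k h) = (h - 1) * (k - 1) * (8 * h * k - h - k - 1)"
proof -
  define q_sum where "q_sum = (\<Sum>r\<in>{0..<k}. h * r div k)"
  define q_sq_sum where "q_sq_sum = (\<Sum>r\<in>{0..<k}. (h * r div k)^2)"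
  define r_sq_sum where "r_sq_sum = (\<Sum>r\<in>{0..<k}. r^2)"
  define v_sum where "v_sum = (\<Sum>v\<in>{0..<h}. v)"
  have q_sum: "2 * q_sum = (h - 1) * (k - 1)"
    unfolding q_sum_def by (rule sum_floor_multiples[OF assms(2,3)])
  have q_sq_sum: "k^2 * q_sq_sum = 2 * h * k * floor_sum h k - (h^2 - 1) * r_sq_sum"
    unfolding q_sq_sum_def r_sq_sum_def by (rule sum_floor_multiples_squared[OF assms(2,3)])
  have v_sum: "2 * v_sum = h * (h - 1)" and r_sq_sum: "6 * r_sq_sum = (k - 1) * k * (2 * k - 1)"
    unfolding v_sum_def r_sq_sum_def
    using assms by (simp_all add: sum_int_lessThan sum_squares_int_lessThan)
  have "q_sq_sum + q_sum = (\<Sum>r\<in>{0..<k}. (h * r div k) * (h * r div k + 1))"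
    by (simp add: q_sq_sum_def q_sum_def sum.distrib[symmetric] power2_eq_square algebra_simps)
  also have "\<dots> = 2 * ((k - 1) * v_sum - floor_sum k h)"
    unfolding sum_floor_swap[OF assms] v_sum_def floor_sum_def
    by (simp add: sum_distrib_left sum_subtractf[symmetric] algebra_simps)
  finally have swap: "q_sq_sum = (k - 1) * (2 * v_sum) - 2 * floor_sum k h - q_sum"
    by (simp add: algebra_simps)
  have "k * (12 * (h * floor_sum h k + k * floor_sum k h))
      = 6 * (2 * h * k * floor_sum h k) + 12 * k^2 * floor_sum k h"
    by (simp add: algebra_simps power2_eq_square)
  also have "\<dots> = (h^2 - 1) * (6 * r_sq_sum) + 6 * k^2 * ((k - 1) * (2 * v_sum))
      - 3 * k^2 * (2 * q_sum)"
    using q_sq_sum unfolding swap by (simp add: algebra_simps)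
  also have "\<dots> = k * ((h - 1) * (k - 1) * (8 * h * k - h - k - 1))"
    unfolding r_sq_sum v_sum q_sum by (simp add: algebra_simps power2_eq_square)
  finally show ?thesis using assms(2) by simp
qed

lemma sawtooth_of_int_div:
  fixes m k :: int
  assumes "0 < k" "\<not> k dvd m"
  shows "sawtooth (of_int m / of_int k) = of_int (2 * (m mod k) - k) / (2 * of_int k)"
proof -
  have "of_int m / of_int k \<notin> (\<int> :: real set)"
    using assms by (metis of_int_div_of_int_in_Ints_iff less_irrefl)
  moreover have "\<lfloor>of_int m / of_int k :: real\<rfloor> = m div k" by (rule floor_divide_of_int_eq)
  moreover have "real_of_int m = of_int k * of_int (m div k) + of_int (m mod k)"
    by (metis mult_div_mod_eq of_int_add of_int_mult)
  ultimately show ?thesis using assms(1) by (simp add: sawtooth_def field_simps)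
qed

lemma sawtooth_mult_of_int_div:
  fixes h k r :: int
  assumes "0 < k" "coprime h k" "r \<in> {1..<k}"
  shows "4 * of_int (k^2) * (sawtooth (of_int r / of_int k) * sawtooth (of_int (h * r) / of_int k))
    = of_int ((2 * r - k) * (2 * (h * r mod k) - k))"
proof -
  have "\<not> k dvd r" using assms(3) zdvd_not_zless by auto
  moreover from this have "\<not> k dvd h * r"
    using assms(2) by (simp add: coprime_commute coprime_dvd_mult_right_iff)
  ultimately have "sawtooth (of_int r / of_int k) * sawtooth (of_int (h * r) / of_int k)
      = of_int (2 * r - k) / (2 * of_int k) * (of_int (2 * (h * r mod k) - k) / (2 * of_int k))"
    using assms(3) sawtooth_of_int_div[OF assms(1), of r]
      sawtooth_of_int_div[OF assms(1), of "h * r"]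
    by simp
  then show ?thesis
    using assms(1) by (simp only: of_int_mult of_int_power) (simp add: power2_eq_square)
qed

lemma dedekind_sum_eq_sum_mod:
  fixes h k :: int
  assumes "0 < k" "coprime h k"
  shows "4 * of_int (k^2) * dedekind_sum h k
    = of_int (4 * (\<Sum>r\<in>{0..<k}. r * (h * r mod k)) - k^2 * (k - 1))"
proof -
  let ?term = "\<lambda>r. (2 * r - k) * (2 * (h * r mod k) - k)"
  have range: "{0..<k} = insert 0 {1..<k}" using assms(1) by auto
  have "4 * of_int (k^2) * dedekind_sum h k = (\<Sum>r\<in>{1..<k}. 4 * of_int (k^2) *
      (sawtooth (of_int r / of_int k) * sawtooth (of_int (h * r) / of_int k)))"
    unfolding dedekind_sum_def range by (simp add: sawtooth_def sum_distrib_left)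
  also have "\<dots> = (\<Sum>r\<in>{1..<k}. of_int (?term r))"
    by (intro sum.cong refl sawtooth_mult_of_int_div assms)
  also have "\<dots> = of_int ((\<Sum>r\<in>{0..<k}. ?term r) - k^2)"
    unfolding range by (simp add: power2_eq_square)
  also have "(\<Sum>r\<in>{0..<k}. ?term r)
      = (\<Sum>r\<in>{0..<k}. 4 * (r * (h * r mod k)) - 2 * k * r - 2 * k * (h * r mod k) + k^2)"
    by (intro sum.cong refl) (simp add: algebra_simps power2_eq_square)
  also have "\<dots> = 4 * (\<Sum>r\<in>{0..<k}. r * (h * r mod k)) - 2 * k * (\<Sum>r\<in>{0..<k}. r)
      - 2 * k * (\<Sum>r\<in>{0..<k}. h * r mod k) + k * k^2"
    using assms(1) by (simp add: sum.distrib sum_subtractf sum_distrib_left)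
  also have "\<dots> - k^2
      = 4 * (\<Sum>r\<in>{0..<k}. r * (h * r mod k)) - 2 * k * (2 * (\<Sum>r\<in>{0..<k}. r))
        + k^2 * (k - 1)"
    unfolding sum_mult_mod_coprime[OF assms, of "\<lambda>r. r"] by (simp add: algebra_simps)
  also have "\<dots> = 4 * (\<Sum>r\<in>{0..<k}. r * (h * r mod k)) - k^2 * (k - 1)"
    unfolding sum_int_lessThan[OF less_imp_le[OF assms(1)]]
    by (simp add: algebra_simps power2_eq_square)
  finally show ?thesis .
qed

lemma dedekind_sum_eq_floor_sum:
  fixes h k :: int
  assumes "0 < k" "coprime h k"
  shows "12 * of_int k * dedekind_sum h k
    = of_int (2 * h * (k - 1) * (2 * k - 1) - 12 * floor_sum h k - 3 * k * (k - 1))"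
proof -
  have "of_int k * (12 * of_int k * dedekind_sum h k) = 3 * (4 * of_int (k^2) * dedekind_sum h k)"
    by (simp add: power2_eq_square)
  also have "\<dots> = of_int (2 * h * (6 * (\<Sum>r\<in>{0..<k}. r^2)) - 12 * k * floor_sum h k
      - 3 * k^2 * (k - 1))"
    unfolding dedekind_sum_eq_sum_mod[OF assms] sum_mult_mod_eq_floor_sum
    by (simp add: algebra_simps)
  also have "\<dots> = of_int k
      * of_int (2 * h * (k - 1) * (2 * k - 1) - 12 * floor_sum h k - 3 * k * (k - 1))"
    unfolding sum_squares_int_lessThan[OF less_imp_le[OF assms(1)]] of_int_mult[symmetric]
    by (simp only: of_int_eq_iff) (simp add: algebra_simps power2_eq_square)
  finally show ?thesis using assms(1) by simp
qed

theorem dedekind_reciprocity: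
  fixes h k :: int
  assumes "0 < h" "0 < k" "coprime h k"
  shows "12 * of_int (h * k) * (dedekind_sum h k + dedekind_sum k h)
      = of_int (h^2 + k^2 + 1 - 3 * h * k)"
proof -
  have "coprime k h" using assms(3) by (simp add: coprime_commute)
  have "12 * of_int (h * k) * (dedekind_sum h k + dedekind_sum k h)
      = of_int h * (12 * of_int k * dedekind_sum h k)
          + of_int k * (12 * of_int h * dedekind_sum k h)"
    by (simp add: algebra_simps)
  also have "\<dots> = of_int (h * (2 * h * (k - 1) * (2 * k - 1) - 3 * k * (k - 1))
      + k * (2 * k * (h - 1) * (2 * h - 1) - 3 * h * (h - 1))
      - 12 * (h * floor_sum h k + k * floor_sum k h))"
    unfolding dedekind_sum_eq_floor_sum[OF assms(2,3)]
      dedekind_sum_eq_floor_sum[OF assms(1) \<open>coprime k h\<close>]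
    by (simp add: algebra_simps)
  also have "\<dots> = of_int (h^2 + k^2 + 1 - 3 * h * k)"
    unfolding floor_sum_reciprocity[OF assms] of_int_eq_iff
    by (simp add: algebra_simps power2_eq_square)
  finally show ?thesis .
qed

lemma sawtooth_minus: "sawtooth (- x) = - sawtooth x"
proof (cases "x \<in> \<int>")
  case False
  then have "\<lceil>x\<rceil> = \<lfloor>x\<rfloor> + 1" by (metis Ints_of_int ceiling_altdef)
  then have "\<lfloor>- x\<rfloor> = - \<lfloor>x\<rfloor> - 1" by (simp add: floor_minus)
  with False show ?thesis by (simp add: sawtooth_def)
qed (simp add: sawtooth_def)

lemma sawtooth_add_of_int: "sawtooth (x + of_int i) = sawtooth x"
  by (simp add: sawtooth_def)

lemma dedekind_sum_minus: "dedekind_sum (- h) c = - dedekind_sum h c"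
  by (simp add: dedekind_sum_def sawtooth_minus sum_negf)

lemma dedekind_sum_shift: "dedekind_sum (h + j * c) c = dedekind_sum h c"
  unfolding dedekind_sum_def
proof (intro sum.cong refl arg_cong2[of _ _ _ _ "(*)"])
  fix r assume "r \<in> {0..<c}"
  then have "of_int ((h + j * c) * r) / of_int c
      = (of_int (h * r) / of_int c + of_int (j * r) :: real)"
    by (simp add: field_simps)
  then show "sawtooth (of_int ((h + j * c) * r) / of_int c) = sawtooth (of_int (h * r) / of_int c)"
    by (simp only: sawtooth_add_of_int)
qed

subsection \<open>The function \<open>\<Psi>\<close>\<close>

lemma Psi_minus_c: "0 < c \<Longrightarrow> Psi (a, b, - c, d) = - Psi (a, b', c, d)"
  by (simp add: Psi_def dedekind_sum_minus)

lemma Psi_shift: "0 < c \<Longrightarrow> Psi (a, b', c, d + j * c) = Psi (a, b, c, d) + of_int j"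
  using dedekind_sum_shift[of "- d" "- j" c] by (simp add: Psi_def field_simps)

lemma Psi_reflect: "0 < c \<Longrightarrow> Psi (- a, b', c, - d) = - Psi (a, b, c, d) - 6"
  by (simp add: Psi_def dedekind_sum_minus field_simps)

lemma coprime_if_det_1:
  fixes a b c d :: int
  assumes "a * d - b * c = 1"
  shows "coprime d c"
  by (rule coprimeI) (use assms in \<open>metis dvd_diff dvd_mult\<close>)

lemma Psi_invert:
  assumes "0 < c" "0 < d" "a * d - b * c = 1"
  shows "Psi (a, b, c, d) = Psi (b, - a, d, - c) + 3"
proof -
  define A B C D where "A = real_of_int a" and "B = real_of_int b"
    and "C = real_of_int c" and "D = real_of_int d"
  have pos: "C > 0" "D > 0" using assms by (auto simp: C_def D_def)
  have "A * D - B * C = 1"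
    using arg_cong[OF assms(3), of real_of_int] by (simp add: A_def B_def C_def D_def)
  then have "(A + D) / C - (B - C) / D = (D^2 + C^2 + 1) / (D * C)"
    using pos by (simp add: field_simps power2_eq_square)
  moreover have "12 * (D * C) * (dedekind_sum d c + dedekind_sum c d) = D^2 + C^2 + 1 - 3 * D * C"
    using dedekind_reciprocity[OF assms(2,1) coprime_if_det_1[OF assms(3)]]
    by (simp add: C_def D_def)
  then have "12 * (dedekind_sum d c + dedekind_sum c d) = (D^2 + C^2 + 1) / (D * C) - 3"
    using pos by (simp add: field_simps)
  ultimately show ?thesis
    using assms(1,2) by (simp add: Psi_def dedekind_sum_minus A_def B_def C_def D_def)
qed

lemma odd_representative:
  fixes c d :: int
  assumes "1 < c" "coprime d c"
  shows "\<exists>j d'. d = d' + j * c \<and> odd d' \<and> \<bar>d'\<bar> < c"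
proof (cases "odd (d mod c)")
  case True
  have "d = d mod c + (d div c) * c" by simp
  with True assms(1) show ?thesis
    by (intro exI[of _ "d div c"] exI[of _ "d mod c"]) auto
next
  case False
  have "d mod c \<noteq> 0"
    using assms coprime_common_divisor[OF assms(2), of c] by (auto simp: mod_eq_0_iff_dvd)
  then have "\<bar>d mod c - c\<bar> < c"
    using assms(1) pos_mod_sign[of c d] pos_mod_bound[of c d] by linarith
  moreover have "odd c"
  proof
    assume "even c"
    then have "even d" using False by (metis dvd_mod_iff)
    then show False using coprime_common_divisor[OF assms(2), of 2] \<open>even c\<close> by simp
  qed
  then have "odd (d mod c - c)" using False by simp
  moreover have "d = (d mod c - c) + (d div c + 1) * c" by (simp add: distrib_right)
  ultimately show ?thesis by blast
qed

text \<open>The Euclidean algorithm with odd remainders, which only meets Jacobi symbols with odd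
  denominators.\<close>

lemma SL2Z_induct [consumes 2, case_names unit shift reflect invert]:
  fixes a b c d :: int
  assumes "0 < c" "a * d - b * c = 1"
    and unit: "\<And>a b d. a * d - b = 1 \<Longrightarrow> P a b 1 d"
    and shift: "\<And>a b c d j. 0 < c \<Longrightarrow> a * d - b * c = 1 \<Longrightarrow> P a b c d \<Longrightarrow> P a (b + j * a) c (d + j * c)"
    and reflect: "\<And>a b c d. 0 < c \<Longrightarrow> a * d - b * c = 1 \<Longrightarrow> P a b c d \<Longrightarrow> P (- a) b c (- d)"
    and invert: "\<And>a b c d. 0 < c \<Longrightarrow> 0 < d \<Longrightarrow> odd d \<Longrightarrow> a * d - b * c = 1 \<Longrightarrow>
      P b (- a) d (- c) \<Longrightarrow> P a b c d"
  shows "P a b c d"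
  using assms(1,2)
proof (induction "nat c" arbitrary: a b c d rule: less_induct)
  case less
  show ?case
  proof (cases "c = 1")
    case False
    then have "1 < c" using less.prems by simp
    then obtain j d' where d': "d = d' + j * c" "odd d'" "\<bar>d'\<bar> < c"
      using odd_representative coprime_if_det_1[OF less.prems(2)] by blast
    define b' where "b' = b - j * a"
    have det: "a * d' - b' * c = 1"
      using less.prems(2) by (simp add: d'(1) b'_def algebra_simps)
    have pos: "P x b' c y" if "0 < y" "odd y" "y < c" "x * y - b' * c = 1" for x y
      by (rule invert[OF \<open>0 < c\<close> that(1,2,4)], rule less.hyps) (use that in auto)
    have "P a b' c d'"
    proof (cases "0 < d'")
      case True
      then show ?thesis using d' det by (intro pos) auto
    next
      case False
      then have "d' < 0" using d'(2) by (cases "d' = 0") auto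
      then have "P (- a) b' c (- d')" using d' det by (intro pos) auto
      then have "P (- (- a)) b' c (- (- d'))"
        by (rule reflect[rotated 2]) (use less.prems det in auto)
      then show ?thesis by simp
    qed
    then have "P a (b' + j * a) c (d' + j * c)"
      by (rule shift[rotated 2]) (use less.prems det in auto)
    then show ?thesis by (simp add: b'_def d'(1))
  qed (use less.prems unit in auto)
qed

lemma Psi_in_Ints:
  assumes "0 < c" "a * d - b * c = 1"
  shows "Psi (a, b, c, d) \<in> \<int>"
  using assms
proof (induction a b c d rule: SL2Z_induct)
  case (unit a b d)
  have "{0..<1::int} = {0}" by auto
  then show ?case by (simp add: Psi_def dedekind_sum_def sawtooth_def)
next
  case (shift a b c d j)
  then show ?case by (simp add: Psi_shift[of c a _ d j b])
next
  case (reflect a b c d)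
  then show ?case by (simp add: Psi_reflect[of c a b d b])
qed (simp add: Psi_invert)

definition Psi_int :: "int \<Rightarrow> int \<Rightarrow> int \<Rightarrow> int \<Rightarrow> int" where
  "Psi_int a b c d = \<lfloor>Psi (a, b, c, d)\<rfloor>"

lemma of_int_Psi_int:
  "0 < c \<Longrightarrow> a * d - b * c = 1 \<Longrightarrow> of_int (Psi_int a b c d) = Psi (a, b, c, d)"
  using Psi_in_Ints[of c a d b] by (simp add: Psi_int_def)

lemma Psi_int_unit: "Psi_int a b 1 d = a + d - 3"
proof -
  have "{0..<1::int} = {0}" by auto
  then show ?thesis by (simp add: Psi_int_def Psi_def dedekind_sum_def sawtooth_def)
qed

lemma Psi_int_shift: "0 < c \<Longrightarrow> Psi_int a b' c (d + j * c) = Psi_int a b c d + j"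
  by (simp add: Psi_int_def Psi_shift[of c a b' d j b])

lemma Psi_int_reflect:
  assumes "0 < c" "a * d - b * c = 1"
  shows "Psi_int (- a) b c (- d) = - Psi_int a b c d - 6"
proof -
  have "Psi (- a, b, c, - d) = of_int (- Psi_int a b c d - 6)"
    using assms by (simp add: Psi_reflect[of c a b d b] of_int_Psi_int)
  then show ?thesis by (simp add: Psi_int_def)
qed

lemma Psi_int_invert:
  "0 < c \<Longrightarrow> 0 < d \<Longrightarrow> a * d - b * c = 1 \<Longrightarrow> Psi_int a b c d = Psi_int b (- a) d (- c) + 3"
  by (simp add: Psi_int_def Psi_invert)

subsection \<open>\<open>\<Psi>\<close> modulo 3 and modulo 8\<close>

lemma three_dvd_cube_minus_self: "3 dvd x * (x^2 - 1)" for x :: int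
proof -
  have "3 dvd x \<or> 3 dvd x - 1 \<or> 3 dvd x + 1" by presburger
  then have "3 dvd x * ((x - 1) * (x + 1))" by (auto intro: dvd_mult dvd_mult2)
  then show ?thesis by (simp add: algebra_simps power2_eq_square)
qed

lemma Psi_int_cong_3:
  assumes "0 < c" "a * d - b * c = 1"
  shows "[Psi_int a b c d = (a + d) * c - b * d * (c^2 - 1)] (mod 3)"
  using assms
proof (induction a b c d rule: SL2Z_induct)
  case (unit a b d)
  then show ?case by (simp add: Psi_int_unit cong_iff_dvd_diff)
next
  case (shift a b c d j)
  have ad: "a * d = 1 + b * c" using shift.hyps(2) by simp
  have "(a + d) * c - b * d * (c^2 - 1) + j
      - ((a + (d + j * c)) * c - (b + j * a) * (d + j * c) * (c^2 - 1))
      = (c^2 - 1) * j * (a * d + b * c + j * a * c - 1)"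
    by (simp add: algebra_simps power2_eq_square)
  also have "\<dots> = (c * (c^2 - 1)) * (j * (2 * b + j * a))"
    unfolding ad by (simp add: algebra_simps)
  finally have "[(a + d) * c - b * d * (c^2 - 1) + j
      = (a + (d + j * c)) * c - (b + j * a) * (d + j * c) * (c^2 - 1)] (mod 3)"
    using three_dvd_cube_minus_self[of c] by (simp add: cong_iff_dvd_diff)
  with cong_add[OF shift.IH cong_refl[of j]] show ?case
    unfolding Psi_int_shift[OF shift.hyps(1), of a "b + j * a" d j b] by (rule cong_trans)
next
  case (reflect a b c d)
  obtain t where "Psi_int a b c d = (a + d) * c - b * d * (c^2 - 1) + 3 * t"
    using reflect.IH by (rule cong_intE)
  then show ?case
    by (intro cong_add_multI[of _ _ _ "- t - 2"])
      (simp add: Psi_int_reflect[OF reflect.hyps] algebra_simps)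
next
  case (invert a b c d)
  obtain t where t: "Psi_int b (- a) d (- c) = (b + - c) * d - (- a) * (- c) * (d^2 - 1) + 3 * t"
    using invert.IH by (rule cong_intE)
  have "Psi_int a b c d
      = (a + d) * c - b * d * (c^2 - 1) + (3 * t + 3 - 2 * c * d - c * d * (a * d - b * c))"
    unfolding Psi_int_invert[OF invert.hyps(1,2,4)] t by (simp add: algebra_simps power2_eq_square)
  also have "\<dots> = (a + d) * c - b * d * (c^2 - 1) + 3 * (t + 1 - c * d)"
    unfolding invert.hyps(4) by simp
  finally show ?case by (rule cong_add_multI)
qed

lemma kron_log_minus_reciprocity:
  assumes "0 < n" "odd m" "coprime m n"
  shows "[kron_log (- int n) m = 2 * (int m - 1) + int (multiplicity 2 n) * chi8_log (int m)
    + (int (odd_part n) - 1) * (int m - 1) + kron_log (int m) (odd_part n)] (mod 8)"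
proof -
  have "m > 0" using assms(2) by (rule odd_pos)
  have coprime: "coprime (odd_part n) m"
    using assms(3) odd_part_dvd coprime_divisors[of "odd_part n" n m m]
    by (simp add: coprime_commute)
  have "kron_log (- int n) m = kron_log (-1 * (2 ^ multiplicity 2 n * int (odd_part n))) m"
    by (simp add: int_odd_part_decompose)
  also have "[\<dots> = kron_log (-1) m + kron_log (2 ^ multiplicity 2 n * int (odd_part n)) m] (mod 8)"
    using \<open>m > 0\<close> assms coprime by (intro kron_log_mult_left) auto
  also have "[kron_log (-1) m + kron_log (2 ^ multiplicity 2 n * int (odd_part n)) m
      = kron_log (-1) m + (kron_log (2 ^ multiplicity 2 n) m
          + kron_log (int (odd_part n)) m)] (mod 8)"
    using \<open>m > 0\<close> assms coprime by (intro cong_add cong_refl kron_log_mult_left) auto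
  also have "[kron_log (-1) m + (kron_log (2 ^ multiplicity 2 n) m + kron_log (int (odd_part n)) m)
      = 2 * (int m - 1) + (int (multiplicity 2 n) * kron_log 2 m
        + ((int (odd_part n) - 1) * (int m - 1) + kron_log (int m) (odd_part n)))] (mod 8)"
    using \<open>m > 0\<close> assms coprime odd_odd_part
    by (intro cong_add kron_log_minus_one kron_log_power_left kron_log_reciprocity) auto
  also have "[2 * (int m - 1) + (int (multiplicity 2 n) * kron_log 2 m
        + ((int (odd_part n) - 1) * (int m - 1) + kron_log (int m) (odd_part n)))
      = 2 * (int m - 1) + (int (multiplicity 2 n) * chi8_log (int m)
        + ((int (odd_part n) - 1) * (int m - 1) + kron_log (int m) (odd_part n)))] (mod 8)"
    by (intro cong_add cong_mult cong_refl kron_log_two assms(2))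
  finally show ?thesis by (simp add: add.assoc)
qed

definition Psi_residue_8 :: "int \<Rightarrow> int \<Rightarrow> int \<Rightarrow> int" where
  "Psi_residue_8 a c d = (a + d - 3) * c + kron_log d (nat c)"

lemma Psi_residue_8_shift:
  assumes "0 < c" "odd c"
  shows "[Psi_residue_8 a c (d + j * c) = Psi_residue_8 a c d + j] (mod 8)"
proof -
  have "kron_log (d + j * c) (nat c) = kron_log d (nat c)"
    using assms by (intro kron_log_cong) (auto simp: even_nat_iff cong_iff_dvd_diff)
  moreover obtain i where "c^2 = 1 + 8 * i"
    using odd_square_cong_1[OF assms(2)] by (rule cong_intE)
  then have "j * c * c = j * (1 + 8 * i)" by (simp add: power2_eq_square)
  ultimately show ?thesis
    by (intro cong_add_multI[of _ _ _ "j * i"]) (simp add: Psi_residue_8_def algebra_simps)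
qed

lemma Psi_residue_8_reflect:
  assumes "0 < c" "odd c" "coprime d c"
  shows "[Psi_residue_8 (- a) c (- d) = - Psi_residue_8 a c d - 6] (mod 8)"
proof -
  have n: "odd (nat c)" "0 < nat c" "coprime d (int (nat c))"
    using assms by (auto simp: even_nat_iff)
  have "[kron_log (-1 * d) (nat c) = kron_log (-1) (nat c) + kron_log d (nat c)] (mod 8)"
    using n by (intro kron_log_mult_left) auto
  also have "[kron_log (-1) (nat c) + kron_log d (nat c)
      = 2 * (int (nat c) - 1) + (-1) * kron_log d (nat c)] (mod 8)"
    using n kron_log_parity[of "nat c" d 1 "-1"]
    by (intro cong_add kron_log_minus_one) (auto simp: cong_def)
  finally obtain s where "kron_log (- d) (nat c) = 2 * (c - 1) - kron_log d (nat c) + 8 * s"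
    using assms(1) by (auto elim: cong_intE)
  moreover obtain i where "c = 2 * i + 1" using assms(2) by (elim oddE)
  ultimately show ?thesis
    by (intro cong_add_multI[of _ _ _ "s - i"]) (simp add: Psi_residue_8_def algebra_simps)
qed

lemma Psi_residue_8_invert:
  assumes "0 < c" "0 < d" "odd c" "odd d" "a * d - b * c = 1"
  shows "[Psi_residue_8 a c d = Psi_residue_8 b d (- c) + 3] (mod 8)"
proof -
  have "coprime (nat d) (nat c)"
    using coprime_if_det_1[OF assms(5)] assms(1,2) by (simp add: coprime_int_iff[symmetric])
  then obtain s where s: "kron_log (- c) (nat d)
      = 2 * (d - 1) + (c - 1) * (d - 1) + kron_log d (nat c) + 8 * s"
    using kron_log_minus_reciprocity[of "nat c" "nat d"] assms(1-4)
    by (auto simp: even_nat_iff multiplicity_2_odd odd_part_odd elim: cong_intE)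
  obtain i j where ij: "c^2 = 1 + 8 * i" "d^2 = 1 + 8 * j"
    using odd_square_cong_1[OF assms(3)] odd_square_cong_1[OF assms(4)] by (elim cong_intE)
  have "a * c - c * d - b * d = a * c * (1 - d^2) + b * d * (c^2 - 1) + c * d * (a * d - b * c - 1)"
    by (simp add: algebra_simps power2_eq_square)
  also have "\<dots> = 8 * (b * d * i - a * c * j)"
    unfolding assms(5) ij by (simp add: algebra_simps)
  finally obtain z where z: "a * c - c * d - b * d = 8 * z" by blast
  obtain p where p: "(c + 1) * (d - 1) = 4 * p"
    using four_dvd_mult_even[of "c + 1" "d - 1"] assms(3,4) by auto
  have "Psi_residue_8 a c d - (Psi_residue_8 b d (- c) + 3)
      = (a * c - c * d - b * d) + 2 * ((c + 1) * (d - 1)) - 8 * s"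
    unfolding Psi_residue_8_def s by (simp add: algebra_simps)
  also have "\<dots> = 8 * (z + p - s)"
    unfolding z p by simp
  finally show ?thesis by (simp add: cong_iff_dvd_diff)
qed

lemma Psi_int_cong_residue_8:
  assumes "0 < c" "a * d - b * c = 1"
  shows "odd c \<longrightarrow> [Psi_int a b c d = Psi_residue_8 a c d] (mod 8)"
  using assms
proof (induction a b c d rule: SL2Z_induct)
  case (unit a b d)
  then show ?case by (simp add: Psi_int_unit Psi_residue_8_def)
next
  case (shift a b c d j)
  have "[Psi_int a b c d + j = Psi_residue_8 a c (d + j * c)] (mod 8)" if "odd c"
    using shift.IH that cong_sym[OF Psi_residue_8_shift[OF shift.hyps(1) that]]
    by (blast intro: cong_trans cong_add cong_refl)
  then show ?case
    unfolding Psi_int_shift[OF shift.hyps(1), of a "b + j * a" d j b] by blast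
next
  case (reflect a b c d)
  have "[- Psi_int a b c d - 6 = Psi_residue_8 (- a) c (- d)] (mod 8)" if "odd c"
    using reflect.IH that cong_sym[OF Psi_residue_8_reflect[OF reflect.hyps(1) that
        coprime_if_det_1[OF reflect.hyps(2)]]]
    by (blast intro: cong_trans cong_diff cong_minus_minus_iff[THEN iffD2] cong_refl)
  then show ?case unfolding Psi_int_reflect[OF reflect.hyps] by blast
next
  case (invert a b c d)
  have "[Psi_int b (- a) d (- c) + 3 = Psi_residue_8 a c d] (mod 8)" if "odd c"
    using invert.IH invert.hyps(3)
      cong_sym[OF Psi_residue_8_invert[OF invert.hyps(1,2) that invert.hyps(3,4)]]
    by (blast intro: cong_trans cong_add cong_refl)
  then show ?case unfolding Psi_int_invert[OF invert.hyps(1,2,4)] by blast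
qed

lemma Psi_int_cong_8_odd:
  assumes "odd n" "a * d - b * int n = 1"
  shows "[Psi_int a b (int n) d = (a + d - 3) * int n + kron_log d n] (mod 8)"
  using Psi_int_cong_residue_8[of "int n" a d b] assms odd_pos[of n]
  by (simp add: Psi_residue_8_def)

lemma Psi_int_cong_8_even_pos:
  assumes "0 < n" "even n" "0 < d" "a * d - b * int n = 1"
  shows "[Psi_int a b (int n) d = (b - int n) * d + (int (odd_part n) - 2) * (d - 1)
    + int (multiplicity 2 n) * chi8_log d + kron_log d (odd_part n)] (mod 8)"
proof -
  have "odd d" using assms(2,4) by (metis dvd_diff dvd_mult even_of_nat_iff odd_one)
  define m where "m = nat d"
  have d: "d = int m" "odd m" using \<open>0 < d\<close> \<open>odd d\<close> by (auto simp: m_def even_nat_iff)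
  have "coprime m n" using coprime_if_det_1[OF assms(4)] by (simp add: d)
  then obtain s where s: "kron_log (- int n) m = 2 * (d - 1) + int (multiplicity 2 n) * chi8_log d
      + (int (odd_part n) - 1) * (d - 1) + kron_log d (odd_part n) + 8 * s"
    using kron_log_minus_reciprocity[OF assms(1) d(2)] unfolding d(1) by (auto elim: cong_intE)
  obtain t where t: "Psi_int b (- a) d (- int n)
      = (b - int n - 3) * d + kron_log (- int n) m + 8 * t"
    using Psi_int_cong_8_odd[OF d(2), of b "- int n" "- a"] assms(4) unfolding d(1)
    by (auto simp: algebra_simps elim: cong_intE)
  show ?thesis
    unfolding Psi_int_invert[of "int n" d, OF _ assms(3,4), unfolded of_nat_0_less_iff, OF assms(1)]
      t s
    by (rule cong_add_multI[of _ _ _ "s + t"]) (simp add: algebra_simps)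
qed

lemma Psi_int_cong_8_even:
  assumes "0 < n" "even n" "a * d - b * int n = 1"
  shows "[Psi_int a b (int n) d = (b - int n) * d + (int (odd_part n) - 2) * (d - 1)
    + int (multiplicity 2 n) * chi8_log d + kron_log d (odd_part n)] (mod 8)"
proof -
  have "odd d" using assms(2,3) by (metis dvd_diff dvd_mult even_of_nat_iff odd_one)
  define d' b' where "d' = d + 8 * \<bar>d\<bar> * int n" and "b' = b + 8 * \<bar>d\<bar> * a"
  have "\<bar>d\<bar> * 1 \<le> \<bar>d\<bar> * int n" using assms(1) by (intro mult_left_mono) auto
  moreover have "d \<noteq> 0" using \<open>odd d\<close> by auto
  ultimately have "0 < d'" unfolding d'_def by linarith
  have d': "[d = d'] (mod 8)" and b': "[b = b'] (mod 8)"
    by (simp_all add: d'_def b'_def cong_iff_dvd_diff)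
  have kron: "kron_log d (odd_part n) = kron_log d' (odd_part n)"
    using assms(1) odd_odd_part odd_part_dvd[of n]
    by (intro kron_log_cong) (auto simp: d'_def cong_iff_dvd_diff intro: dvd_mult)
  have "Psi_int a b' (int n) d' = Psi_int a b (int n) d + 8 * \<bar>d\<bar>"
    unfolding d'_def using assms(1) by (intro Psi_int_shift) simp
  then have "[Psi_int a b (int n) d = Psi_int a b' (int n) d'] (mod 8)"
    by (simp add: cong_iff_dvd_diff)
  also have "[Psi_int a b' (int n) d' = (b' - int n) * d' + (int (odd_part n) - 2) * (d' - 1)
      + int (multiplicity 2 n) * chi8_log d' + kron_log d' (odd_part n)] (mod 8)"
    using assms
    by (intro Psi_int_cong_8_even_pos \<open>0 < d'\<close>) (simp_all add: d'_def b'_def algebra_simps)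
  also have "[(b' - int n) * d' + (int (odd_part n) - 2) * (d' - 1)
      + int (multiplicity 2 n) * chi8_log d' + kron_log d' (odd_part n)
      = (b - int n) * d + (int (odd_part n) - 2) * (d - 1)
      + int (multiplicity 2 n) * chi8_log d + kron_log d (odd_part n)] (mod 8)"
    unfolding kron by (rule cong_sym)
      (intro cong_add cong_mult cong_diff cong_refl chi8_log_cong d' b' \<open>odd d\<close>)
  finally show ?thesis .
qed

subsection \<open>The two matrices attached to a divisor of the level\<close>

lemma square_cong_1_mod_3: "\<not> 3 dvd x \<Longrightarrow> [x^2 = 1] (mod 3)" for x :: int
  using three_dvd_cube_minus_self[of x] prime_dvd_mult_iff[of "3::int" x "x^2 - 1"]
  by (simp add: cong_iff_dvd_diff)

lemma kron_log_diff_eq: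
  assumes "odd m" "[a * x * y = 1] (mod int m)"
  shows "[kron_log y m - kron_log x m = kron_log a m] (mod 8)"
proof -
  have "coprime (a * x * y) (int m)"
    using assms(2) by (metis cong_imp_coprime cong_sym coprime_1_left)
  then have coprime: "coprime a (int m)" "coprime x (int m)" "coprime y (int m)" by simp_all
  have "m > 0" using assms(1) by (rule odd_pos)
  have "[kron_log (a * x * y) m = kron_log (a * x) m + kron_log y m] (mod 8)"
    using \<open>m > 0\<close> coprime by (intro kron_log_mult_left) simp_all
  also have "[kron_log (a * x) m + kron_log y m
      = kron_log a m + kron_log x m + kron_log y m] (mod 8)"
    using \<open>m > 0\<close> coprime by (intro cong_add cong_refl kron_log_mult_left)
  finally have "[kron_log a m + kron_log x m + kron_log y m = 0] (mod 8)"
    unfolding kron_log_cong[OF assms] using \<open>m > 0\<close> by (simp add: cong_sym_eq)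
  moreover have "[2 * kron_log x m = 0 * kron_log x m] (mod 8)"
    "[2 * kron_log a m = 0 * kron_log a m] (mod 8)"
    using \<open>m > 0\<close> coprime by (intro kron_log_parity; simp add: cong_def)+
  ultimately have "[kron_log a m + kron_log x m + kron_log y m
      - 2 * kron_log x m - 2 * kron_log a m = 0 - 0 * kron_log x m - 0 * kron_log a m] (mod 8)"
    by (intro cong_diff)
  then show ?thesis by (simp add: cong_iff_dvd_diff algebra_simps)
qed

lemma exact_even_cofactor_obstruction:
  fixes m' q x :: int
  assumes "odd m'" "odd x"
  shows "4 dvd m' * q * (x * (q - m' - 2) + (m' * q + 1))"
proof (cases "even q")
  case True
  then have "even (m' * q)" "even (x * (q - m' - 2) + (m' * q + 1))" using assms by simp_all
  then show ?thesis by (rule four_dvd_mult_even)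
next
  case False
  then have "4 dvd (x - 1) * (q - m' - 2)" "4 dvd (q - 1) * (m' + 1)"
    using assms by (intro four_dvd_mult_even; simp)+
  moreover have "x * (q - m' - 2) + (m' * q + 1) = (x - 1) * (q - m' - 2) + (q - 1) * (m' + 1)"
    by (simp add: algebra_simps)
  ultimately show ?thesis by simp
qed

text \<open>The obstruction to the congruence modulo 8 in the case of an even cofactor \<open>m = 2 ^ \<alpha> m'\<close>,
  with \<open>q\<close> and \<open>t\<close> standing for \<open>n w\<close> and \<open>N w / 2\<close>.\<close>

lemma even_cofactor_obstruction:
  fixes m' t q x :: int
  assumes "0 < \<alpha>" "odd m'" "odd x" and t: "t = 2 ^ (\<alpha> - 1) * m' * q"
  shows "4 dvd t * (x * (q - 2 ^ \<alpha> * m' + m' - 2) + int \<alpha> * (t + 1))"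
proof -
  have "\<alpha> = 1 \<or> \<alpha> = 2 \<or> (\<exists>k. \<alpha> = k + 3)" using assms(1) by presburger
  then consider (one) "\<alpha> = 1" | (two) "\<alpha> = 2" | (three) k where "\<alpha> = k + 3" by blast
  then show ?thesis
  proof cases
    case one
    then show ?thesis
      using exact_even_cofactor_obstruction[OF assms(2,3), of q] by (simp add: t)
  next
    case two
    show ?thesis
    proof (cases "even q")
      case True
      then obtain k where "q = 2 * k" by (elim evenE)
      then have "t = 4 * (m' * k)" by (simp add: t two)
      then show ?thesis by simp
    next
      case False
      then show ?thesis using assms(2) by (intro four_dvd_mult_even) (simp_all add: t two)
    qed
  next
    case three
    then have "t = 4 * (2 ^ k * m' * q)" unfolding t by (simp add: eval_nat_numeral)
    then show ?thesis by simp
  qed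
qed

locale hecke_matrices =
  fixes N a d :: nat and b x y z :: int
  assumes N_pos: "0 < N" and d_pos: "0 < d"
    and det: "(- int N * b + int a * x) * y + int N * int d * z = 1"
begin

definition u where "u = - int N * b + int a * x"
definition w where "w = b * y - int d * z"

definition Psi_diff :: "nat \<Rightarrow> nat \<Rightarrow> int" where
  "Psi_diff m n = Psi_int u (- (z * int n)) (int (m * d)) y
      - Psi_int (int a * y) (w * int n) (int m) x"

lemma uy: "u * y + int N * int d * z = 1"
  using det by (simp add: u_def)

lemma axy: "int a * x * y = 1 + int N * w"
  using det by (simp add: w_def algebra_simps)

lemma coprime_y: "coprime y (int (N * d))"
proof (rule coprimeI)
  fix q assume "q dvd y" "q dvd int (N * d)"
  then have "q dvd u * y + int N * int d * z" by simp
  then show "is_unit q" by (simp add: uy)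
qed

lemma coprime_a_N: "coprime (int a) (int N)"
proof (rule coprimeI)
  fix q assume "q dvd int a" "q dvd int N"
  then have "q dvd int a * x * y - int N * w" by simp
  then show "is_unit q" by (simp add: axy)
qed

lemma coprime_y_odd_part_d: "coprime y (int (odd_part d))"
  using coprime_y coprime_divisors[of y y "int (odd_part d)" "int d"] odd_part_dvd[of d] by simp

lemma odd_if_even_N:
  assumes "even N"
  shows "odd a" "odd x" "odd y"
proof -
  have "odd (int a * x * y)" unfolding axy using assms by simp
  then show "odd a" "odd x" "odd y" by auto
qed

context
  fixes m n :: nat
  assumes mn: "m * n = N"
begin

lemma m_pos: "0 < m"
  using N_pos mn by (auto intro: Nat.gr0I)

lemma int_mn: "int N = int m * int n"
  using mn by auto

lemma det_first: "u * y - (- (z * int n)) * int (m * d) = 1"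
  using uy by (simp add: int_mn algebra_simps)

lemma det_second: "(int a * y) * x - (w * int n) * int m = 1"
  using axy by (simp add: int_mn algebra_simps)

lemma Psi_diff_cong_3:
  "[Psi_diff m n = int m * ((u + y) * int d - int a * y - x + (z * y * int d ^ 2 + w * x) * int N)
     - int n * (z * y + w * x)] (mod 3)"
proof -
  obtain i where i: "Psi_int u (- (z * int n)) (int (m * d)) y
      = (u + y) * int (m * d) - (- (z * int n)) * y * (int (m * d) ^ 2 - 1) + 3 * i"
    using Psi_int_cong_3[OF _ det_first] m_pos d_pos by (auto elim: cong_intE)
  obtain j where j: "Psi_int (int a * y) (w * int n) (int m) x
      = (int a * y + x) * int m - (w * int n) * x * (int m ^ 2 - 1) + 3 * j"
    using Psi_int_cong_3[OF _ det_second] m_pos by (auto elim: cong_intE)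
  show ?thesis
    unfolding Psi_diff_def i j int_mn
    by (rule cong_add_multI[of _ _ _ "i - j"]) (simp add: algebra_simps power2_eq_square)
qed

lemma three_dvd_cofactor_defect:
  assumes "3 dvd int a * int d - 1"
  shows "3 dvd (int m ^ 2 - 1) * (z * y + w * x - b * int d)"
proof (cases "3 dvd int m")
  case True
  have "int d * (int a * x * y) = int d + int m * int n * int d * w"
    unfolding axy int_mn by (simp add: algebra_simps)
  then have "x * y - int d = int m * (int n * int d * w) - (int a * int d - 1) * (x * y)"
    by (simp add: algebra_simps)
  then have xy: "3 dvd x * y - int d" using True assms by simp
  have "\<not> 3 dvd x"
  proof
    assume "3 dvd x"
    then have "3 dvd x * y - (x * y - int d)" by (rule dvd_diff[OF dvd_mult2 xy])
    then have "3 dvd int a * int d - (int a * int d - 1)" by (intro dvd_diff assms) simp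
    then show False by simp
  qed
  then have "3 dvd x ^ 2 - 1" using square_cong_1_mod_3[of x] by (simp add: cong_iff_dvd_diff)
  moreover have "y - int d * x = x * (x * y - int d) - (x ^ 2 - 1) * y"
    by (simp add: algebra_simps power2_eq_square)
  ultimately have "3 dvd y - int d * x" using xy by simp
  moreover have "z * y + w * x - b * int d = z * (y - int d * x) + b * (x * y - int d)"
    by (simp add: w_def algebra_simps)
  ultimately show ?thesis using xy by simp
qed (use square_cong_1_mod_3[of "int m"] in \<open>simp add: cong_iff_dvd_diff\<close>)

lemma Psi_diff_cong_3_unit:
  assumes "3 dvd int a * int d - 1"
  shows "[Psi_diff m n = - (b * int d * int n)] (mod 3)"
proof -
  have "\<not> 3 dvd int a * int d" using assms by presburger
  then have "\<not> 3 dvd int a" "\<not> 3 dvd int d" by auto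
  then have squares: "3 dvd int a ^ 2 - 1" "3 dvd int d ^ 2 - 1"
    using square_cong_1_mod_3[of "int a"] square_cong_1_mod_3[of "int d"]
    by (auto simp: cong_iff_dvd_diff)
  have "int d - int a = int a * (int a * int d - 1) - (int a ^ 2 - 1) * int d"
    by (simp add: algebra_simps power2_eq_square)
  then have "3 dvd int d - int a" using assms squares by simp
  then have "3 dvd int m * (x * (int a * int d - 1) + y * (int d - int a)
      + int N * z * y * (int d ^ 2 - 1))"
    using assms squares by (intro dvd_mult dvd_add) auto
  moreover have "3 dvd int n * ((int m ^ 2 - 1) * (z * y + w * x - b * int d))"
    by (intro dvd_mult three_dvd_cofactor_defect assms)
  moreover have "int m * ((u + y) * int d - int a * y - x + (z * y * int d ^ 2 + w * x) * int N)
      - int n * (z * y + w * x) - (- (b * int d * int n))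
      = int m * (x * (int a * int d - 1) + y * (int d - int a) + int N * z * y * (int d ^ 2 - 1))
      + int n * ((int m ^ 2 - 1) * (z * y + w * x - b * int d))"
    unfolding u_def int_mn by (simp add: algebra_simps power2_eq_square)
  ultimately show ?thesis
    by (intro cong_trans[OF Psi_diff_cong_3]) (simp only: cong_iff_dvd_diff dvd_add)
qed

lemma kron_log_quotient:
  "[kron_log y (odd_part m * odd_part d) - kron_log x (odd_part m)
    = kron_log (int a) m + kron_log y (odd_part d)
        - int (multiplicity 2 m) * chi8_log (int a)] (mod 8)"
proof -
  have odd_part_m: "odd_part m dvd N" using odd_part_dvd[of m] mn by (metis dvd_mult2)
  have "int a * x * y = 1 + int (odd_part m) * (2 ^ multiplicity 2 m * int n * w)"
    unfolding axy int_mn by (simp add: int_odd_part_decompose[of m, symmetric] mult_ac)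
  then have inverse: "[int a * x * y = 1] (mod int (odd_part m))"
    by (rule cong_add_multI)
  have "coprime y (int (odd_part m * odd_part d))"
    using coprime_y odd_part_m odd_part_dvd[of d]
      coprime_divisors[of y y "int (odd_part m * odd_part d)" "int (N * d)"]
    by (simp add: mult_dvd_mono)
  then have "[kron_log y (odd_part m * odd_part d) - kron_log x (odd_part m)
      = kron_log y (odd_part m) + kron_log y (odd_part d) - kron_log x (odd_part m)] (mod 8)"
    using m_pos d_pos by (intro cong_diff cong_refl kron_log_mult_right odd_part_pos)
  also have "kron_log y (odd_part m) + kron_log y (odd_part d) - kron_log x (odd_part m)
      = kron_log y (odd_part m) - kron_log x (odd_part m) + kron_log y (odd_part d)" by simp
  also have "[kron_log y (odd_part m) - kron_log x (odd_part m) + kron_log y (odd_part d)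
      = kron_log (int a) (odd_part m) + kron_log y (odd_part d)] (mod 8)"
    using m_pos inverse by (intro cong_add cong_refl kron_log_diff_eq odd_odd_part)
  also have "[kron_log (int a) (odd_part m) + kron_log y (odd_part d)
      = kron_log (int a) m - int (multiplicity 2 m) * chi8_log (int a)
          + kron_log y (odd_part d)] (mod 8)"
  proof -
    have "coprime (int a) (int m)"
      using coprime_a_N mn coprime_divisors[of "int a" "int a" "int m" "int N"]
      by (auto simp: int_mn)
    from kron_log_odd_part[OF m_pos this]
    have "[kron_log (int a) m - int (multiplicity 2 m) * chi8_log (int a)
        = int (multiplicity 2 m) * chi8_log (int a) + kron_log (int a) (odd_part m)
          - int (multiplicity 2 m) * chi8_log (int a)] (mod 8)"
      by (intro cong_diff cong_refl)
    then show ?thesis by (intro cong_add cong_refl) (simp add: cong_sym)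
  qed
  finally show ?thesis by (simp add: algebra_simps)
qed

lemma Psi_diff_cong_8_odd_odd:
  assumes "odd m" "odd d"
  shows "[Psi_diff m n = kron_log (int a) m + kron_log y (odd_part d)
    + int m * ((u + y - 3) * int d - (int a * y + x - 3))] (mod 8)"
proof -
  note [simp] = odd_part_odd multiplicity_2_odd
  obtain i where i: "Psi_int u (- (z * int n)) (int (m * d)) y
      = (u + y - 3) * int (m * d) + kron_log y (m * d) + 8 * i"
    using Psi_int_cong_8_odd[OF _ det_first] assms by (auto elim: cong_intE)
  obtain j where j: "Psi_int (int a * y) (w * int n) (int m) x
      = (int a * y + x - 3) * int m + kron_log x m + 8 * j"
    using Psi_int_cong_8_odd[OF _ det_second] assms by (auto elim: cong_intE)
  obtain k where k: "kron_log y (m * d) - kron_log x m = kron_log (int a) m + kron_log y d + 8 * k"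
    using kron_log_quotient assms by (auto elim: cong_intE)
  have "Psi_diff m n = int m * ((u + y - 3) * int d - (int a * y + x - 3))
      + (kron_log y (m * d) - kron_log x m) + 8 * (i - j)"
    unfolding Psi_diff_def i j by (simp add: algebra_simps)
  then show ?thesis
    unfolding k using assms by (intro cong_add_multI[of _ _ _ "i - j + k"]) simp
qed

lemma Psi_diff_cong_8_odd_even:
  assumes "odd m" "even d"
  shows "[Psi_diff m n = kron_log (int a) m + kron_log y (odd_part d)
    - (z * int n + int m * int d) * y + (int m * int (odd_part d) - 2) * (y - 1)
    + int (multiplicity 2 d) * chi8_log y - (int a * y + x - 3) * int m] (mod 8)"
proof -
  note [simp] = odd_part_odd multiplicity_2_odd
  have md: "0 < m * d" "even (m * d)" "odd_part (m * d) = m * odd_part d"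
    "multiplicity 2 (m * d) = multiplicity 2 d"
    using m_pos d_pos assms by (simp_all add: odd_part_mult multiplicity_2_mult)
  obtain i where i: "Psi_int u (- (z * int n)) (int (m * d)) y
      = (- (z * int n) - int (m * d)) * y + (int (m * odd_part d) - 2) * (y - 1)
        + int (multiplicity 2 d) * chi8_log y + kron_log y (m * odd_part d) + 8 * i"
    using Psi_int_cong_8_even[OF md(1,2) det_first] unfolding md(3,4) by (rule cong_intE)
  obtain j where j: "Psi_int (int a * y) (w * int n) (int m) x
      = (int a * y + x - 3) * int m + kron_log x m + 8 * j"
    using Psi_int_cong_8_odd[OF _ det_second] assms by (auto elim: cong_intE)
  obtain k where k: "kron_log y (m * odd_part d) - kron_log x m
      = kron_log (int a) m + kron_log y (odd_part d) + 8 * k"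
    using kron_log_quotient assms by (auto elim: cong_intE)
  have "Psi_diff m n = - (z * int n + int m * int d) * y + (int m * int (odd_part d) - 2) * (y - 1)
      + int (multiplicity 2 d) * chi8_log y - (int a * y + x - 3) * int m
      + (kron_log y (m * odd_part d) - kron_log x m) + 8 * (i - j)"
    unfolding Psi_diff_def i j by (simp add: algebra_simps)
  then show ?thesis
    unfolding k by (intro cong_add_multI[of _ _ _ "i - j + k"]) (simp add: algebra_simps)
qed

lemma Psi_diff_cong_8_even:
  assumes "even m"
  shows "[Psi_diff m n = kron_log (int a) m + kron_log y (odd_part d)
    - (z * int n + int m * int d) * y + (int (odd_part m) * int (odd_part d) - 2) * (y - 1)
    + int (multiplicity 2 d) * chi8_log y
    - (w * int n - int m) * x - (int (odd_part m) - 2) * (x - 1)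
    + int (multiplicity 2 m) * (chi8_log y - chi8_log x - chi8_log (int a))] (mod 8)"
proof -
  have md: "0 < m * d" "even (m * d)" "odd_part (m * d) = odd_part m * odd_part d"
    "multiplicity 2 (m * d) = multiplicity 2 m + multiplicity 2 d"
    using m_pos d_pos assms by (simp_all add: odd_part_mult multiplicity_2_mult)
  obtain i where i: "Psi_int u (- (z * int n)) (int (m * d)) y
      = (- (z * int n) - int (m * d)) * y + (int (odd_part m * odd_part d) - 2) * (y - 1)
        + int (multiplicity 2 m + multiplicity 2 d) * chi8_log y
        + kron_log y (odd_part m * odd_part d) + 8 * i"
    using Psi_int_cong_8_even[OF md(1,2) det_first] unfolding md(3,4) by (rule cong_intE)
  obtain j where j: "Psi_int (int a * y) (w * int n) (int m) x
      = (w * int n - int m) * x + (int (odd_part m) - 2) * (x - 1)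
        + int (multiplicity 2 m) * chi8_log x + kron_log x (odd_part m) + 8 * j"
    using Psi_int_cong_8_even[OF m_pos assms det_second] by (rule cong_intE)
  obtain k where k: "kron_log y (odd_part m * odd_part d) - kron_log x (odd_part m)
      = kron_log (int a) m + kron_log y (odd_part d) - int (multiplicity 2 m) * chi8_log (int a)
          + 8 * k"
    using kron_log_quotient by (rule cong_intE)
  have "Psi_diff m n = - (z * int n + int m * int d) * y
      + (int (odd_part m) * int (odd_part d) - 2) * (y - 1)
      + (int (multiplicity 2 m) + int (multiplicity 2 d)) * chi8_log y
      - (w * int n - int m) * x - (int (odd_part m) - 2) * (x - 1)
      - int (multiplicity 2 m) * chi8_log x
      + (kron_log y (odd_part m * odd_part d) - kron_log x (odd_part m)) + 8 * (i - j)"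
    unfolding Psi_diff_def i j by (simp add: algebra_simps)
  then show ?thesis
    unfolding k by (intro cong_add_multI[of _ _ _ "i - j + k"]) (simp add: algebra_simps)
qed

lemma odd_cofactor_cong:
  assumes "odd m" "even n"
  shows "[int n * int a * (b - int d * y * z) = int m * (x - int a * y)] (mod 8)"
proof -
  have "odd a" "odd x" "odd y" using odd_if_even_N assms(2) mn by auto
  then have sq: "[y ^ 2 = 1] (mod 8)" "[int m ^ 2 = 1] (mod 8)" "[(int a * y) ^ 2 = 1] (mod 8)"
    using assms(1) by (simp_all add: odd_square_cong_1)
  have "[1 * (int n * int a * (1 * b - int d * y * z))
      = int m ^ 2 * (int n * int a * (y ^ 2 * b - int d * y * z))] (mod 8)"
    by (intro cong_mult cong_diff cong_refl sq[THEN cong_sym])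
  also have "int m ^ 2 * (int n * int a * (y ^ 2 * b - int d * y * z))
      = int m * (int a * y * (int N * w))"
    by (simp add: int_mn w_def power2_eq_square algebra_simps)
  also have "int N * w = int a * x * y - 1" using axy by simp
  also have "int m * (int a * y * (int a * x * y - 1)) = int m * ((int a * y) ^ 2 * x - int a * y)"
    by (simp add: power2_eq_square algebra_simps)
  also have "[int m * ((int a * y) ^ 2 * x - int a * y) = int m * (1 * x - int a * y)] (mod 8)"
    by (intro cong_mult cong_diff cong_refl sq)
  finally show ?thesis by simp
qed

lemma odd_cofactor_odd_cong:
  assumes "odd m" "even n" "odd d"
  shows "[int n * (y * z - b * int d) = int m * int d * (y - int a * x)] (mod 8)"
proof -
  have "odd y" using odd_if_even_N assms(2) mn by auto
  then have sq: "[y ^ 2 = 1] (mod 8)" "[int d ^ 2 = 1] (mod 8)" "[int (m * d) ^ 2 = 1] (mod 8)"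
    using assms(1,3) by (simp_all add: odd_square_cong_1)
  have "[1 * (int n * (y * z - b * int d))
      = int (m * d) ^ 2 * (int n * (y * z - b * int d))] (mod 8)"
    by (intro cong_mult cong_refl cong_sym[OF sq(3)])
  also have "int (m * d) ^ 2 * (int n * (y * z - b * int d))
      = int m * int d * (y * (int N * int d * z) - int N * b * int d ^ 2)"
    by (simp add: int_mn power2_eq_square algebra_simps)
  also have "int N * int d * z = 1 - u * y" using uy by simp
  also have "y * (1 - u * y) - int N * b * int d ^ 2 = y - u * y ^ 2 - (int a * x - u) * int d ^ 2"
    by (simp add: u_def power2_eq_square algebra_simps)
  also have "[int m * int d * (y - u * y ^ 2 - (int a * x - u) * int d ^ 2)
      = int m * int d * (y - u * 1 - (int a * x - u) * 1)] (mod 8)"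
    by (intro cong_mult cong_diff cong_refl sq)
  finally show ?thesis by simp
qed

text \<open>One expression for all parities of \<open>m\<close> and \<open>d\<close>; its terms with a factor \<open>a d - 1\<close> or \<open>d - a\<close>
  vanish modulo 8 after summation over \<open>n\<close>.\<close>

definition even_level_value :: int where
  "even_level_value = kron_log (int a) m + kron_log y (odd_part d)
      - 3 * int (odd_part m) * (int a - 1)
    + int (multiplicity 2 d) * chi8_log y + (int (odd_part d) - int a) * (y - 1)
    - int n * (int a * b - (int a * int d - 1) * y * z) - int m * y * (int d - int a)"

lemma Psi_diff_even_level_odd_odd:
  assumes "odd m" "even n" "odd d"
  shows "[Psi_diff m n = even_level_value] (mod 8)"
proof -
  have "odd a" "odd y" using odd_if_even_N assms(2) mn by auto
  then have "8 dvd (int d - int a) * (y - 1) * (3 * int m - 1)"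
    using assms by (intro eight_dvd_mult_even) auto
  then obtain h where h: "(int d - int a) * (y - 1) * (3 * int m - 1) = 8 * h" by blast
  obtain g where g: "int m ^ 2 = 1 + 8 * g"
    using odd_square_cong_1[of "int m"] assms(1) by (auto elim: cong_intE)
  obtain i where i: "Psi_diff m n = kron_log (int a) m + kron_log y (odd_part d)
      + int m * ((u + y - 3) * int d - (int a * y + x - 3)) + 8 * i"
    using Psi_diff_cong_8_odd_odd[OF assms(1,3)] by (rule cong_intE)
  obtain j where j: "int n * int a * (b - int d * y * z) = int m * (x - int a * y) + 8 * j"
    using odd_cofactor_cong[OF assms(1,2)] by (rule cong_intE)
  obtain k where k: "int n * (y * z - b * int d) = int m * int d * (y - int a * x) + 8 * k"
    using odd_cofactor_odd_cong[OF assms] by (rule cong_intE)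
  have "Psi_diff m n - even_level_value
      = 8 * i + int n * int a * (b - int d * y * z) + int n * (y * z - b * int d)
      - (int m ^ 2 - 1) * int n * b * int d
      + int m * (int d * int a * x - x + (y - 3) * int d - int a * y + 3)
      + 3 * int m * (int a - 1) - (int d - int a) * (y - 1) + int m * y * (int d - int a)"
    using assms unfolding i even_level_value_def u_def int_mn
    by (simp add: odd_part_odd multiplicity_2_odd algebra_simps power2_eq_square)
  also have "\<dots> = (int d - int a) * (y - 1) * (3 * int m - 1)
      + 8 * (i + j + k - g * int n * b * int d)"
    unfolding j k g by (simp add: algebra_simps)
  finally show ?thesis unfolding h by (simp add: cong_iff_dvd_diff)
qed

lemma Psi_diff_even_level_odd_even:
  assumes "odd m" "even n" "even d"
  shows "[Psi_diff m n = even_level_value] (mod 8)"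
proof -
  let ?d' = "int (odd_part d)"
  have "odd a" "odd y" using odd_if_even_N assms(2) mn by auto
  have "4 dvd (int m - 1) * (?d' - 1)" "4 dvd (int a - 1) * (3 * int m - 1)" "4 dvd 2 * (int m + 1)"
    using assms(1) \<open>odd a\<close> d_pos by (intro four_dvd_mult_even; simp add: odd_odd_part)+
  then have "4 dvd (int m - 1) * (?d' - 1) - (int a - 1) * (3 * int m - 1) - 2 * (int m + 1)"
    by (intro dvd_diff)
  then obtain h
    where h: "(int m - 1) * (?d' - 1) - (int a - 1) * (3 * int m - 1) - 2 * (int m + 1) = 4 * h"
    by blast
  obtain y' where y': "y = 2 * y' + 1" using \<open>odd y\<close> by (elim oddE)
  obtain i where i: "Psi_diff m n = kron_log (int a) m + kron_log y (odd_part d)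
      - (z * int n + int m * int d) * y + (int m * ?d' - 2) * (y - 1)
      + int (multiplicity 2 d) * chi8_log y - (int a * y + x - 3) * int m + 8 * i"
    using Psi_diff_cong_8_odd_even[OF assms(1,3)] by (rule cong_intE)
  obtain j where j: "int n * int a * (b - int d * y * z) = int m * (x - int a * y) + 8 * j"
    using odd_cofactor_cong[OF assms(1,2)] by (rule cong_intE)
  have "Psi_diff m n - even_level_value = 8 * i + int n * int a * (b - int d * y * z)
      + (int m * ?d' - 2 - (?d' - int a)) * (y - 1) - int m * (int a * y + x - 3)
      + 3 * int m * (int a - 1) - int m * int a * y"
    using assms unfolding i even_level_value_def by (simp add: odd_part_odd algebra_simps)
  also have "\<dots> = ((int m - 1) * (?d' - 1) - (int a - 1) * (3 * int m - 1) - 2 * (int m + 1))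
      * (y - 1) + 8 * (i + j)"
    unfolding j by (simp add: algebra_simps)
  also have "\<dots> = 8 * (h * y' + i + j)"
    unfolding h by (simp add: y')
  finally show ?thesis by (simp add: cong_iff_dvd_diff)
qed

lemma chi8_log_even_cofactor:
  assumes "even N" "int N * w = 2 * t"
  shows "[chi8_log y - chi8_log x - chi8_log (int a) = 2 * t * (t + 1)] (mod 8)"
proof -
  have odd: "odd (int a)" "odd x" "odd y" using odd_if_even_N[OF assms(1)] by simp_all
  obtain i j where ij: "chi8_log (int a) = 4 * i" "chi8_log x = 4 * j"
    using odd four_dvd_chi8_log by (meson dvdE)
  have "odd (int a * x * y)" using odd by simp
  from two_chi8_log[OF this] have chi8_axy: "chi8_log (int a * x * y) = 2 * t * (t + 1)"
    unfolding axy assms(2) by (simp add: algebra_simps power2_eq_square)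
  have "[chi8_log (int a * x * y) = chi8_log (int a * x) + chi8_log y] (mod 8)"
    using odd by (intro chi8_log_mult) auto
  also have "[chi8_log (int a * x) + chi8_log y
      = chi8_log (int a) + chi8_log x + chi8_log y] (mod 8)"
    using odd by (intro cong_add cong_refl chi8_log_mult)
  also have "[chi8_log (int a) + chi8_log x + chi8_log y
      = chi8_log y - chi8_log x - chi8_log (int a)] (mod 8)"
    by (rule cong_add_multI[of _ _ _ "i + j"]) (simp add: ij)
  finally show ?thesis unfolding chi8_axy by (rule cong_sym)
qed

lemma a_y_minus_x_cong:
  assumes "even N"
  shows "[int a * y - x = int N * w * x] (mod 8)"
proof -
  obtain p where p: "x ^ 2 = 1 + 8 * p"
    using odd_square_cong_1[OF odd_if_even_N(2)[OF assms]] by (rule cong_intE)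
  have "int a * y - x = x * (int a * x * y - x ^ 2) - (x ^ 2 - 1) * (int a * y - x)"
    by (simp add: algebra_simps power2_eq_square)
  also have "\<dots> = int N * w * x + 8 * (- p * x - p * (int a * y - x))"
    unfolding axy p by (simp add: algebra_simps)
  finally show ?thesis by (rule cong_add_multI)
qed

lemma Psi_diff_even_level_even:
  assumes "even m"
  shows "[Psi_diff m n = even_level_value] (mod 8)"
proof -
  let ?m' = "int (odd_part m)" and ?d' = "int (odd_part d)" and ?\<alpha> = "multiplicity 2 m"
  define H where "H = chi8_log y - chi8_log x - chi8_log (int a)"
  define t where "t = 2 ^ (?\<alpha> - 1) * ?m' * (int n * w)"
  have "even N" using assms mn by auto
  then have odd: "odd a" "odd x" "odd y" by (simp_all add: odd_if_even_N)
  have odd': "odd ?m'" "odd ?d'" using m_pos d_pos by (simp_all add: odd_odd_part)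
  have \<alpha>: "0 < ?\<alpha>" using assms m_pos by (simp add: prime_multiplicity_gt_zero_iff)
  then have m: "int m = 2 * (2 ^ (?\<alpha> - 1) * ?m')"
    by (simp add: int_odd_part_decompose[of m, symmetric] power_eq_if)
  then have Nw: "int N * w = 2 * t" by (simp add: int_mn t_def)
  obtain f where f: "t * (x * (int n * w - int m + ?m' - 2) + int ?\<alpha> * (t + 1)) = 4 * f"
    using even_cofactor_obstruction[OF \<alpha> odd'(1) odd(2) t_def] int_odd_part_decompose[of m] by auto
  obtain h where h: "H = 2 * t * (t + 1) + 8 * h"
    using chi8_log_even_cofactor[OF \<open>even N\<close> Nw] unfolding H_def by (rule cong_intE)
  obtain g where g: "int a * y - x = 2 * t * x + 8 * g"
    using a_y_minus_x_cong[OF \<open>even N\<close>] unfolding Nw by (rule cong_intE)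
  obtain q where q: "y * w = b - int d * y * z + 8 * q"
    using odd_square_cong_1[OF odd(3)] unfolding w_def
    by (auto simp: algebra_simps power2_eq_square elim!: cong_intE)
  obtain k where k: "(?m' - 1) * (?d' - 1) * (y - 1) + (int a - 1) * (?m' - 3) * (3 - y) = 8 * k"
    using dvd_add[OF eight_dvd_mult_even[of "?m' - 1" "?d' - 1" "y - 1"]
        eight_dvd_mult_even[of "int a - 1" "?m' - 3" "3 - y"]]
      odd odd' by auto
  obtain i where i: "Psi_diff m n = kron_log (int a) m + kron_log y (odd_part d)
      - (z * int n + int m * int d) * y + (?m' * ?d' - 2) * (y - 1)
      + int (multiplicity 2 d) * chi8_log y
      - (w * int n - int m) * x - (?m' - 2) * (x - 1) + int ?\<alpha> * H + 8 * i"
    using Psi_diff_cong_8_even[OF assms] unfolding H_def by (rule cong_intE)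
  have "Psi_diff m n - even_level_value
      = (int a * y - x) * (int n * w - int m + ?m' - 2) + int ?\<alpha> * H
      + ((?m' - 1) * (?d' - 1) * (y - 1) + (int a - 1) * (?m' - 3) * (3 - y))
      - int n * int a * (y * w - (b - int d * y * z)) + 8 * (i + int a - 1)"
    unfolding i even_level_value_def by (simp add: algebra_simps)
  also have "\<dots> = 2 * (t * (x * (int n * w - int m + ?m' - 2) + int ?\<alpha> * (t + 1)))
      + 8 * (g * (int n * w - int m + ?m' - 2) + int ?\<alpha> * h + k - int n * int a * q
        + i + int a - 1)"
    unfolding g h k q by (simp add: algebra_simps)
  finally show ?thesis unfolding f by (simp add: cong_iff_dvd_diff)
qed

end

lemma Psi_diff_even_level:
  assumes "m * n = N" "even N"
  shows "[Psi_diff m n = even_level_value m n] (mod 8)"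
  using Psi_diff_even_level_even[OF assms(1)] Psi_diff_even_level_odd_even[OF assms(1)]
    Psi_diff_even_level_odd_odd[OF assms(1)] assms by (metis even_mult_iff)

end

subsection \<open>Sums over the divisors of the level\<close>

lemma abs_mult_two_torsion_cong:
  fixes c q t :: int
  assumes "[2 * t = 0] (mod q)"
  shows "[int (nat \<bar>c\<bar>) * t = c * t] (mod q)"
proof (cases "0 \<le> c")
  case False
  have "[c * (2 * t) = c * 0] (mod q)" by (intro cong_mult cong_refl assms)
  then have "[c * (2 * t) - c * t = c * 0 - c * t] (mod q)" by (intro cong_diff cong_refl)
  with False show ?thesis by (simp add: cong_sym)
qed simp

locale additive_mod =
  fixes P :: "nat \<Rightarrow> bool" and F :: "nat \<Rightarrow> int" and q :: int
  assumes one: "P 1"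
    and mult: "P x \<Longrightarrow> P y \<Longrightarrow> P (x * y)"
    and additive: "P x \<Longrightarrow> P y \<Longrightarrow> [F (x * y) = F x + F y] (mod q)"
    and two_torsion: "P x \<Longrightarrow> [2 * F x = 0] (mod q)"
begin

lemma F_1: "[F 1 = 0] (mod q)"
  using additive[OF one one] by (simp add: cong_iff_dvd_diff)

lemma closed_power: "P x \<Longrightarrow> P (x ^ k)"
  by (induction k) (use one mult in simp_all)

lemma power_cong: "P x \<Longrightarrow> [F (x ^ k) = int k * F x] (mod q)"
proof (induction k)
  case (Suc k)
  have "[F (x * x ^ k) = F x + F (x ^ k)] (mod q)"
    using Suc.prems by (intro additive closed_power)
  also have "[F x + F (x ^ k) = F x + int k * F x] (mod q)"
    using Suc by (intro cong_add cong_refl)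
  finally show ?case by (simp add: algebra_simps)
qed (use F_1 in simp)

lemma closed_prod: "(\<And>i. i \<in> I \<Longrightarrow> P (f i)) \<Longrightarrow> P (\<Prod>i\<in>I. f i)"
  by (induction I rule: infinite_finite_induct) (use one mult in simp_all)

lemma prod_power_cong:
  assumes "finite I" "\<And>i. i \<in> I \<Longrightarrow> P (f i)"
  shows "[F (\<Prod>i\<in>I. f i ^ nat \<bar>r i\<bar>) = (\<Sum>i\<in>I. r i * F (f i))] (mod q)"
  using assms
proof (induction I rule: finite_induct)
  case (insert i I)
  have P: "P (f i)" "P (\<Prod>i\<in>I. f i ^ nat \<bar>r i\<bar>)"
    using insert.prems by (auto intro: closed_prod closed_power)
  have "[F (f i ^ nat \<bar>r i\<bar> * (\<Prod>i\<in>I. f i ^ nat \<bar>r i\<bar>))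
      = F (f i ^ nat \<bar>r i\<bar>) + F (\<Prod>i\<in>I. f i ^ nat \<bar>r i\<bar>)] (mod q)"
    using P by (intro additive closed_power)
  also have "[F (f i ^ nat \<bar>r i\<bar>) + F (\<Prod>i\<in>I. f i ^ nat \<bar>r i\<bar>)
      = r i * F (f i) + (\<Sum>i\<in>I. r i * F (f i))] (mod q)"
    using cong_trans[OF power_cong[OF P(1)] abs_mult_two_torsion_cong[OF two_torsion[OF P(1)]]]
      insert.IH insert.prems by (intro cong_add) auto
  finally show ?case using insert.hyps by simp
qed (use F_1 in simp)

end

locale eta_quotient =
  fixes N :: nat and r :: "nat \<Rightarrow> int"
  assumes N_pos: "0 < N"
begin

definition divisor_sum :: "(nat \<Rightarrow> nat \<Rightarrow> int) \<Rightarrow> int" where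
  "divisor_sum g = (\<Sum>n\<in>divs N. r n * g (N div n) n)"

definition exponent_sum where "exponent_sum = divisor_sum (\<lambda>m n. 1)"
definition cofactor_sum where "cofactor_sum = divisor_sum (\<lambda>m n. int m)"
definition odd_cofactor_sum where "odd_cofactor_sum = divisor_sum (\<lambda>m n. int (odd_part m))"

lemma finite_divs: "finite (divs N)"
  using N_pos by (simp add: divs_def)

lemma divs_cofactor:
  assumes "n \<in> divs N"
  shows "(N div n) * n = N" "0 < n" "0 < N div n"
proof -
  show cofactor: "(N div n) * n = N" using assms by (simp add: divs_def)
  show "0 < n" "0 < N div n" using N_pos cofactor by (metis gr0I mult_0_right, metis gr0I mult_0)
qed

lemma divisor_sum_add: "divisor_sum (\<lambda>m n. g m n + h m n) = divisor_sum g + divisor_sum h"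
  by (simp add: divisor_sum_def sum.distrib distrib_left)

lemma divisor_sum_diff: "divisor_sum (\<lambda>m n. g m n - h m n) = divisor_sum g - divisor_sum h"
  by (simp add: divisor_sum_def sum_subtractf right_diff_distrib)

lemma divisor_sum_mult_right: "divisor_sum (\<lambda>m n. g m n * c) = divisor_sum g * c"
  by (simp add: divisor_sum_def sum_distrib_right mult.assoc)

lemma divisor_sum_const: "divisor_sum (\<lambda>m n. c) = exponent_sum * c"
  using divisor_sum_mult_right[of "\<lambda>m n. 1" c] by (simp add: exponent_sum_def)

lemma divisor_sum_divisors: "divisor_sum (\<lambda>m n. int n) = x_N N r"
  by (simp add: divisor_sum_def x_N_def mult.commute)

lemmas divisor_sum_linear =
  divisor_sum_add divisor_sum_diff divisor_sum_mult_right divisor_sum_const divisor_sum_divisors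
  cofactor_sum_def[symmetric] odd_cofactor_sum_def[symmetric]

lemma divisor_sum_cong:
  "(\<And>m n. m * n = N \<Longrightarrow> [g m n = h m n] (mod q)) \<Longrightarrow> [divisor_sum g = divisor_sum h] (mod q)"
  unfolding divisor_sum_def by (intro cong_sum cong_mult cong_refl) (simp add: divs_cofactor)

lemma divisor_sum_eq:
  "(\<And>m n. m * n = N \<Longrightarrow> g m n = h m n) \<Longrightarrow> divisor_sum g = divisor_sum h"
  unfolding divisor_sum_def by (intro sum.cong refl) (simp add: divs_cofactor)

lemma kprime_eq: "kprime N r = of_int exponent_sum / 2"
  by (simp add: kprime_def exponent_sum_def divisor_sum_def)

lemma varpi_cong:
  assumes "additive_mod P F q" "\<And>m. m dvd N \<Longrightarrow> P m"
  shows "[F (varpi N r) = divisor_sum (\<lambda>m n. F m)] (mod q)"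
proof -
  interpret additive_mod P F q by fact
  have "P (N div n)" if "n \<in> divs N" for n
    using divs_cofactor(1)[OF that] by (intro assms(2)) (metis dvd_triv_left)
  then show ?thesis
    unfolding varpi_def divisor_sum_def by (rule prod_power_cong[OF finite_divs])
qed

lemma varpi_pos: "0 < varpi N r"
  unfolding varpi_def by (intro prod_pos) (simp add: divs_cofactor)

lemma coprime_varpi:
  assumes "coprime a (int N)"
  shows "coprime a (int (varpi N r))"
proof -
  have "coprime a (int (N div n))" if "n \<in> divs N" for n
    using assms divs_cofactor(1)[OF that] by (metis coprime_mult_right_iff of_nat_mult)
  then show ?thesis by (auto simp: varpi_def of_nat_prod intro!: prod_coprime_right)
qed

lemma kron_log_varpi:
  assumes "coprime a (int N)"
  shows "[kron_log a (varpi N r) = divisor_sum (\<lambda>m n. kron_log a m)] (mod 8)"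
proof (rule varpi_cong)
  show "additive_mod (\<lambda>m. 0 < m \<and> coprime a (int m)) (kron_log a) 8"
  proof
    show "[2 * kron_log a m = 0] (mod 8)" if "0 < m \<and> coprime a (int m)" for m
      using kron_log_parity[of m a 2 0] that by (simp add: cong_def)
  qed (auto intro: kron_log_mult_right)
  show "0 < m \<and> coprime a (int m)" if "m dvd N" for m
    using that N_pos assms coprime_divisors[of a a "int m" "int N"] by (auto intro: dvd_pos_nat)
qed

lemma odd_part_varpi: "[int (odd_part (varpi N r)) - 1 = odd_cofactor_sum - exponent_sum] (mod 4)"
proof -
  have "[int (odd_part (varpi N r)) - 1 = divisor_sum (\<lambda>m n. int (odd_part m) - 1)] (mod 4)"
  proof (rule varpi_cong)
    show "additive_mod (\<lambda>m. 0 < m) (\<lambda>m. int (odd_part m) - 1) 4"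
    proof
      fix x y :: nat
      assume "0 < x" "0 < y"
      then have "4 dvd (int (odd_part x) - 1) * (int (odd_part y) - 1)"
        by (intro four_dvd_mult_even) (simp_all add: odd_odd_part)
      then show "[int (odd_part (x * y)) - 1
          = int (odd_part x) - 1 + (int (odd_part y) - 1)] (mod 4)"
        using \<open>0 < x\<close> \<open>0 < y\<close> by (simp add: odd_part_mult cong_iff_dvd_diff algebra_simps)
    next
      fix x :: nat
      assume "0 < x"
      then have "4 dvd 2 * (int (odd_part x) - 1)"
        by (intro four_dvd_mult_even) (simp_all add: odd_odd_part)
      then show "[2 * (int (odd_part x) - 1) = 0] (mod 4)" by (simp only: cong_0_iff)
    qed simp_all
  qed (use N_pos in \<open>auto intro: dvd_pos_nat\<close>)
  then show ?thesis by (simp only: divisor_sum_linear mult_1_right)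
qed

lemma multiplicity_2_varpi:
  "[int (multiplicity 2 (varpi N r)) = divisor_sum (\<lambda>m n. int (multiplicity 2 m))] (mod 2)"
proof (rule varpi_cong)
  show "additive_mod (\<lambda>m. 0 < m) (\<lambda>m. int (multiplicity 2 m)) 2"
    by unfold_locales (simp_all add: multiplicity_2_mult cong_0_iff)
qed (use N_pos in \<open>auto intro: dvd_pos_nat\<close>)

lemma odd_cofactor_sum_parity: "[odd_cofactor_sum = exponent_sum] (mod 2)"
  unfolding odd_cofactor_sum_def exponent_sum_def
proof (rule divisor_sum_cong)
  fix m n assume "m * n = N"
  then have "odd (odd_part m)" using N_pos by (intro odd_odd_part) (auto intro: Nat.gr0I)
  then show "[int (odd_part m) = 1] (mod 2)" by (simp add: cong_iff_dvd_diff)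
qed

lemma odd_cofactor_sum_odd_level: "odd N \<Longrightarrow> odd_cofactor_sum = cofactor_sum"
  unfolding odd_cofactor_sum_def cofactor_sum_def by (rule divisor_sum_eq) (auto simp: odd_part_odd)

lemma x_N_cong_odd_level:
  assumes "odd N"
  shows "[x_N N r = cofactor_sum * int N] (mod 8)"
proof -
  have "[int n = int m * int N] (mod 8)" if mn: "m * n = N" for m n
  proof -
    have "odd (int m)" using assms mn by auto
    then have "[1 * int n = int m ^ 2 * int n] (mod 8)"
      by (intro cong_mult cong_refl cong_sym[OF odd_square_cong_1])
    then show ?thesis by (simp add: mn[symmetric] power2_eq_square mult.assoc)
  qed
  then have "[divisor_sum (\<lambda>m n. int n) = divisor_sum (\<lambda>m n. int m * int N)] (mod 8)"
    by (rule divisor_sum_cong)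
  then show ?thesis by (simp only: divisor_sum_linear)
qed

lemma odd_cofactor_sum_cong_two_exact:
  assumes "int N = 2 * N'" "odd N'"
  shows "[odd_cofactor_sum = cofactor_sum + x_N N r * N' + exponent_sum * 2] (mod 4)"
proof -
  have "[int (odd_part m) = int m + int n * N' + 2] (mod 4)" if mn: "m * n = N" for m n
  proof (cases "even m")
    case True
    then obtain m' where m: "m = 2 * m'" by (elim evenE)
    then have N': "N' = int m' * int n" using assms(1) mn by (auto simp: mn[symmetric])
    then have odd: "odd m'" "odd n" using assms(2) by simp_all
    then have "odd_part m = m'"
      by (simp add: m odd_part_mult odd_pos odd_part_odd) (simp add: odd_part_def)
    moreover obtain i where "int n ^ 2 = 1 + 8 * i"
      using odd_square_cong_1[of "int n"] odd(2) by (auto elim: cong_intE)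
    then have "int n * N' = int m' * (1 + 8 * i)"
      by (simp add: N' power2_eq_square mult.left_commute)
    moreover obtain j where "int m' = 2 * j + 1" using odd(1) by (metis even_of_nat_iff oddE)
    ultimately show ?thesis
      by (intro cong_add_multI[of _ _ _ "- j - 1 - 2 * int m' * i"]) (simp add: m algebra_simps)
  next
    case False
    then have "even n" using assms(1) mn by (metis dvd_triv_left even_mult_iff even_of_nat_iff)
    then obtain n' where n: "n = 2 * n'" by (elim evenE)
    then have "N' = int m * int n'" using assms(1) mn by (auto simp: mn[symmetric])
    then have "odd (int n' * N')" using assms(2) by simp
    then obtain j where "int n' * N' = 2 * j + 1" by (elim oddE)
    then have "int n * N' = 4 * j + 2" by (simp add: n mult.assoc)
    then show ?thesis
      by (intro cong_add_multI[of _ _ _ "- j - 1"]) (simp add: False odd_part_odd)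
  qed
  then have "[divisor_sum (\<lambda>m n. int (odd_part m))
      = divisor_sum (\<lambda>m n. int m + int n * N' + 2)] (mod 4)"
    by (rule divisor_sum_cong)
  then show ?thesis by (simp only: divisor_sum_linear)
qed

lemma multiplicity_sum_cong_four_exact:
  assumes "int N = 4 * N'" "odd N'"
  shows "[divisor_sum (\<lambda>m n. int (multiplicity 2 m))
      = exponent_sum + cofactor_sum + x_N N r] (mod 2)"
proof -
  define N'' where "N'' = nat N'"
  have N'': "N = 2 ^ 2 * N''" "odd N''" using assms N_pos by (auto simp: N''_def even_nat_iff)
  have "multiplicity 2 N = 2"
    unfolding N''(1) using N''(2) odd_pos[OF N''(2)] multiplicity_2_power[of 2 2]
    by (subst multiplicity_2_mult) (auto simp: multiplicity_2_odd)
  have "[int (multiplicity 2 m) = 1 + int m + int n] (mod 2)" if mn: "m * n = N" for m n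
  proof -
    have pos: "0 < m" "0 < n" using N_pos mn by (auto intro: Nat.gr0I)
    then have "multiplicity 2 m + multiplicity 2 n = 2"
      using multiplicity_2_mult[OF pos] \<open>multiplicity 2 N = 2\<close> mn by simp
    then consider "multiplicity 2 m = 0" "multiplicity 2 n = 2"
      | "multiplicity 2 m = 1" "multiplicity 2 n = 1"
      | "multiplicity 2 m = 2" "multiplicity 2 n = 0" by linarith
    moreover have "even m \<longleftrightarrow> multiplicity 2 m \<noteq> 0" "even n \<longleftrightarrow> multiplicity 2 n \<noteq> 0"
      using pos by (simp_all add: prime_elem_multiplicity_eq_zero_iff)
    ultimately show ?thesis by cases (simp_all add: cong_iff_dvd_diff)
  qed
  then have "[divisor_sum (\<lambda>m n. int (multiplicity 2 m))
      = divisor_sum (\<lambda>m n. 1 + int m + int n)] (mod 2)"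
    by (rule divisor_sum_cong)
  then show ?thesis by (simp only: divisor_sum_linear mult_1_right)
qed

definition delta_int :: int where
  "delta_int = (if odd_part (varpi N r) mod 4 = 1 then 0 else 1)"

lemma delta0_eq: "delta0 N r = of_int delta_int"
  unfolding delta0_def delta_int_def odd_part_mod_4_iff by simp

lemma delta_int_cong: "[2 * delta_int = odd_cofactor_sum - exponent_sum] (mod 4)"
proof -
  let ?p = "odd_part (varpi N r)"
  have "n mod 4 = 1 \<and> (\<exists>i. n = 4 * i + 1) \<or> n mod 4 \<noteq> 1 \<and> (\<exists>i. n = 4 * i + 3)"
    if "odd n" for n :: nat
    using that by presburger
  then consider (one) i where "?p mod 4 = 1" "?p = 4 * i + 1"
    | (three) i where "?p mod 4 \<noteq> 1" "?p = 4 * i + 3"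
    using odd_odd_part[OF varpi_pos] by blast
  then have "[2 * delta_int = int ?p - 1] (mod 4)"
  proof cases
    case (one i)
    then show ?thesis unfolding delta_int_def if_P[OF one(1)]
      by (intro cong_add_multI[of _ _ _ "- int i"]) simp
  next
    case (three i)
    then show ?thesis unfolding delta_int_def if_not_P[OF three(1)]
      by (intro cong_add_multI[of _ _ _ "- int i"]) simp
  qed
  then show ?thesis using odd_part_varpi by (rule cong_trans)
qed

end

subsection \<open>The condition \<open>l \<in> L\<^sub>r\<close>\<close>

lemma dvd_24I: "8 dvd x \<Longrightarrow> 3 dvd x \<Longrightarrow> 24 dvd x" for x :: int
  by presburger

lemma half_in_half_integers_iff:
  "real_of_int i / 2 \<in> {x + 1/2 | x. x \<in> \<int>} \<longleftrightarrow> odd i"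
proof
  assume "real_of_int i / 2 \<in> {x + 1/2 | x. x \<in> \<int>}"
  then obtain j where "real_of_int i / 2 = of_int j + 1/2" by (auto elim: Ints_cases)
  then have "real_of_int i = of_int (2 * j + 1)" by simp
  then have "i = 2 * j + 1" by (simp only: of_int_eq_iff)
  then show "odd i" by simp
next
  assume "odd i"
  then obtain j where "i = 2 * j + 1" by (elim oddE)
  then have "real_of_int i / 2 = of_int j + 1/2" by (simp add: add_divide_distrib)
  then show "real_of_int i / 2 \<in> {x + 1/2 | x. x \<in> \<int>}" by auto
qed

lemma eight_dvd_diff_inverse:
  fixes a d q :: int
  assumes "odd a" "8 dvd (a * d - 1) * q"
  shows "8 dvd (d - a) * q"
proof -
  have "(d - a) * q = a * ((a * d - 1) * q) - (a ^ 2 - 1) * (d * q)"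
    by (simp add: algebra_simps power2_eq_square)
  moreover have "8 dvd a ^ 2 - 1"
    using odd_square_cong_1[OF assms(1)] by (simp add: cong_iff_dvd_diff)
  ultimately show ?thesis using assms(2) by simp
qed

lemma square_mult_odd:
  assumes "a * d = t ^ 2" "0 < d" "odd a"
  shows "even (multiplicity 2 d)" "8 dvd int (odd_part d) - int a"
proof -
  have pos: "0 < a" "0 < t" using assms odd_pos by (auto intro: Nat.gr0I)
  have "multiplicity 2 d = 2 * multiplicity 2 t"
    using arg_cong[OF assms(1), of "multiplicity 2"] pos assms(2,3)
    by (simp add: multiplicity_2_mult multiplicity_2_power multiplicity_2_odd)
  then show "even (multiplicity 2 d)" by simp
  have "a * odd_part d = odd_part t ^ 2"
    using arg_cong[OF assms(1), of odd_part] pos assms(2,3)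
    by (simp add: odd_part_mult odd_part_power odd_part_odd)
  then have "int a * int (odd_part d) = int (odd_part t) ^ 2" by (metis of_nat_mult of_nat_power)
  then have "8 dvd int a * int (odd_part d) - 1"
    using odd_square_cong_1[of "int (odd_part t)"] odd_odd_part[OF pos(2)]
    by (simp add: cong_iff_dvd_diff)
  then show "8 dvd int (odd_part d) - int a"
    using eight_dvd_diff_inverse[of "int a" "int (odd_part d)" 1] assms(3) by simp
qed

locale hecke_level = eta_quotient N r for N r +
  fixes l :: nat
  assumes l_mem: "l \<in> L_r N r"
begin

lemma l_pos: "0 < l"
  using l_mem by (simp add: L_r_def)

lemma l_square:
  assumes "odd exponent_sum"
  shows "\<exists>t. l = t ^ 2"
proof -
  have "kprime N r \<in> {x + 1/2 | x. x \<in> \<int>}"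
    unfolding kprime_eq half_in_half_integers_iff by (rule assms)
  then show ?thesis using l_mem unfolding L_r_def by blast
qed

lemma dvd_24_if_gcd_dvd:
  assumes "gcd (gcd 24 (\<Sum>n\<in>divs N. int (N div n) * r n)) (\<Sum>n\<in>divs N. int n * r n) dvd q"
  shows "24 dvd (int l - 1) * q"
proof -
  let ?g = "gcd (gcd 24 (\<Sum>n\<in>divs N. int (N div n) * r n)) (\<Sum>n\<in>divs N. int n * r n)"
  have "?g dvd 24" by (meson dvd_trans gcd_dvd1)
  then have "m_r N r * ?g = 24" by (simp add: m_r_def)
  moreover have "m_r N r dvd int l - 1"
    using l_mem by (simp add: L_r_def cong_iff_dvd_diff)
  then have "m_r N r * ?g dvd (int l - 1) * q" using assms by (rule mult_dvd_mono)
  ultimately show ?thesis by simp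
qed

lemma dvd_24_cofactor_sum: "24 dvd (int l - 1) * cofactor_sum"
  unfolding cofactor_sum_def divisor_sum_def
  by (rule dvd_24_if_gcd_dvd) (simp add: mult.commute[of "r _"], meson dvd_trans gcd_dvd1 gcd_dvd2)

lemma dvd_24_x_N: "24 dvd (int l - 1) * x_N N r"
  unfolding x_N_def by (rule dvd_24_if_gcd_dvd) simp

lemma eight_dvd_sums: "8 dvd (int l - 1) * cofactor_sum" "8 dvd (int l - 1) * x_N N r"
  using dvd_24_cofactor_sum dvd_24_x_N by (auto intro: dvd_trans[of 8 24])

lemma three_dvd_sums: "3 dvd int l - 1 \<or> 3 dvd cofactor_sum" "3 dvd int l - 1 \<or> 3 dvd x_N N r"
proof -
  have "3 dvd (int l - 1) * cofactor_sum" "3 dvd (int l - 1) * x_N N r"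
    using dvd_24_cofactor_sum dvd_24_x_N by (auto intro: dvd_trans[of 3 24])
  then show "3 dvd int l - 1 \<or> 3 dvd cofactor_sum" "3 dvd int l - 1 \<or> 3 dvd x_N N r"
    by (simp_all add: prime_dvd_mult_iff)
qed

lemma eight_dvd_sums_even:
  assumes "even l"
  shows "8 dvd cofactor_sum" "8 dvd x_N N r"
  using assms eight_dvd_cancel_odd[OF _ eight_dvd_sums(1)]
    eight_dvd_cancel_odd[OF _ eight_dvd_sums(2)]
  by simp_all

lemma even_exponent_sum_even:
  assumes "even l" "odd N"
  shows "even exponent_sum"
proof -
  have "8 dvd odd_cofactor_sum"
    using eight_dvd_sums_even(1)[OF assms(1)] odd_cofactor_sum_odd_level[OF assms(2)] by simp
  then have "even odd_cofactor_sum" by (rule dvd_trans[rotated]) simp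
  then show ?thesis using odd_cofactor_sum_parity by (simp add: cong_dvd_iff)
qed

lemma odd_divisor_if_odd_exponent_sum:
  assumes "odd exponent_sum" "a dvd l" "coprime N a"
  shows "odd a"
proof
  assume "even a"
  then have "even l" "odd N"
    using assms(2,3) coprime_common_divisor[of N a 2] by (auto intro: dvd_trans)
  then show False using even_exponent_sum_even assms(1) by blast
qed

lemma eight_dvd_exponent_sum_odd:
  assumes "odd l" "even t" "[q = exponent_sum] (mod 2)"
  shows "8 dvd (int l - 1) * q * t"
proof (cases "even exponent_sum")
  case True
  then have "even q" using assms(3) by (simp add: cong_dvd_iff)
  then show ?thesis using assms(1,2) by (intro eight_dvd_mult_even) auto
next
  case False
  then obtain t where "l = t ^ 2" using l_square by blast
  then show ?thesis
    using assms(1) odd_square_cong_1[of "int t"] by (simp add: cong_iff_dvd_diff)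
qed

lemma dvd_24_square_x_N:
  assumes "d dvd l"
  shows "24 dvd (int d ^ 2 - 1) * x_N N r"
proof -
  have "3 dvd (int d ^ 2 - 1) * x_N N r"
  proof (cases "3 dvd int d")
    case True
    then have "3 dvd int l" using assms by (meson dvd_trans of_nat_dvd_iff)
    then have "\<not> 3 dvd int l - 1" by presburger
    then show ?thesis using three_dvd_sums(2) by simp
  qed (use square_cong_1_mod_3[of "int d"] in \<open>simp add: cong_iff_dvd_diff\<close>)
  moreover have "8 dvd (int d ^ 2 - 1) * x_N N r"
  proof (cases "even d")
    case True
    then show ?thesis using eight_dvd_sums_even(2) assms by (auto intro: dvd_trans)
  qed (use odd_square_cong_1[of "int d"] in \<open>simp add: cong_iff_dvd_diff\<close>)
  ultimately show ?thesis by (intro dvd_24I)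
qed

end

subsection \<open>The exponent of the product of the two character values\<close>

locale hecke_term = hecke_level N r l + hecke_matrices N a d b x y z
  for N r l a d b x y z +
  assumes l_eq: "l = a * d"
begin

lemma a_pos: "0 < a"
  using l_pos l_eq by (auto intro: Nat.gr0I)

lemma sum_Psi_diff_cong_3: "[divisor_sum Psi_diff = - (b * int d * x_N N r)] (mod 3)"
proof (cases "3 dvd int l - 1")
  case True
  then have "[divisor_sum Psi_diff = divisor_sum (\<lambda>m n. int n * - (b * int d))] (mod 3)"
    using Psi_diff_cong_3_unit by (intro divisor_sum_cong) (auto simp: l_eq mult.commute)
  then show ?thesis by (simp only: divisor_sum_linear) (simp add: mult.commute)
next
  case False
  then have dvd: "3 dvd cofactor_sum" "3 dvd x_N N r" using three_dvd_sums by auto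
  have "[divisor_sum Psi_diff = divisor_sum (\<lambda>m n.
      int m * ((u + y) * int d - int a * y - x + (z * y * int d ^ 2 + w * x) * int N)
          - int n * (z * y + w * x))] (mod 3)"
    by (intro divisor_sum_cong Psi_diff_cong_3)
  also have "[divisor_sum (\<lambda>m n.
      int m * ((u + y) * int d - int a * y - x + (z * y * int d ^ 2 + w * x) * int N)
          - int n * (z * y + w * x))
      = - (b * int d * x_N N r)] (mod 3)"
    unfolding divisor_sum_linear using dvd by (simp add: cong_iff_dvd_diff)
  finally show ?thesis .
qed

definition kron_sum :: int where
  "kron_sum = divisor_sum (\<lambda>m n. kron_log (int a) m) + exponent_sum * kron_log y (odd_part d)"

definition exponent_8 :: int where
  "exponent_8 = kron_sum - b * int d * x_N N r - 3 * odd_cofactor_sum * (int a - 1)"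

lemma exponent_sum_mult_cong:
  assumes "odd a" "odd y"
  shows "8 dvd exponent_sum
      * (int (multiplicity 2 d) * chi8_log y + (int (odd_part d) - int a) * (y - 1))"
proof (cases "even exponent_sum")
  case True
  have "odd (odd_part d)" using d_pos by (rule odd_odd_part)
  then have "4 dvd (int (odd_part d) - int a) * (y - 1)"
    using assms by (intro four_dvd_mult_even) auto
  then have "4 dvd int (multiplicity 2 d) * chi8_log y + (int (odd_part d) - int a) * (y - 1)"
    using four_dvd_chi8_log[OF assms(2)] by simp
  with True show ?thesis by (rule eight_dvd_even_mult_four)
next
  case False
  then obtain t where "l = t ^ 2" using l_square by blast
  then have "a * d = t ^ 2" by (simp add: l_eq)
  from square_mult_odd[OF this d_pos assms(1)]
  have "8 dvd int (multiplicity 2 d) * chi8_log y" "8 dvd int (odd_part d) - int a"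
    using four_dvd_chi8_log[OF assms(2)] by (simp_all add: eight_dvd_even_mult_four)
  then show ?thesis by simp
qed

lemma sum_Psi_diff_cong_8_even_level:
  assumes "even N"
  shows "[divisor_sum Psi_diff = exponent_8] (mod 8)"
proof -
  have odd: "odd a" "odd y" using odd_if_even_N[OF assms] by simp_all
  define c where "c = int (multiplicity 2 d) * chi8_log y + (int (odd_part d) - int a) * (y - 1)"
  have "[divisor_sum Psi_diff = divisor_sum (\<lambda>m n. kron_log (int a) m + kron_log y (odd_part d)
      - int (odd_part m) * (3 * (int a - 1)) + c - int n * (int a * b - (int l - 1) * (y * z))
      - int m * (y * (int d - int a)))] (mod 8)"
    using Psi_diff_even_level[OF _ assms]
    by (intro divisor_sum_cong) (simp add: even_level_value_def l_eq c_def algebra_simps)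
  also have "divisor_sum (\<lambda>m n. kron_log (int a) m + kron_log y (odd_part d)
      - int (odd_part m) * (3 * (int a - 1)) + c - int n * (int a * b - (int l - 1) * (y * z))
      - int m * (y * (int d - int a)))
      = exponent_8 + (exponent_sum * c + b * ((int d - int a) * x_N N r)
          + (int l - 1) * x_N N r * (y * z)
        - (int d - int a) * cofactor_sum * y)"
    unfolding divisor_sum_linear exponent_8_def kron_sum_def by (simp add: algebra_simps)
  also have "[exponent_8
      + (exponent_sum * c + b * ((int d - int a) * x_N N r) + (int l - 1) * x_N N r * (y * z)
        - (int d - int a) * cofactor_sum * y) = exponent_8 + 0] (mod 8)"
    using exponent_sum_mult_cong[OF odd] odd(1) eight_dvd_sums
      eight_dvd_diff_inverse[of "int a" "int d"]
    unfolding l_eq of_nat_mult c_def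
    by (intro cong_add cong_refl, unfold cong_0_iff, intro dvd_diff dvd_add) simp_all
  finally show ?thesis by simp
qed

lemma sum_Psi_diff_cong_8_odd_level_odd:
  assumes "odd N" "odd d"
  shows "[divisor_sum Psi_diff = exponent_8] (mod 8)"
proof -
  have "[divisor_sum Psi_diff = divisor_sum (\<lambda>m n. kron_log (int a) m + kron_log y (odd_part d)
      + int m * ((u + y - 3) * int d - (int a * y + x - 3)))] (mod 8)"
    using assms by (intro divisor_sum_cong Psi_diff_cong_8_odd_odd) auto
  also have "divisor_sum (\<lambda>m n. kron_log (int a) m + kron_log y (odd_part d)
      + int m * ((u + y - 3) * int d - (int a * y + x - 3)))
      = kron_sum + cofactor_sum * ((u + y - 3) * int d - (int a * y + x - 3))"
    unfolding divisor_sum_linear kron_sum_def ..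
  also have "[kron_sum + cofactor_sum * ((u + y - 3) * int d - (int a * y + x - 3))
      = exponent_8] (mod 8)"
  proof (cases "even l")
    case True
    then show ?thesis
      using eight_dvd_sums_even odd_cofactor_sum_odd_level[OF assms(1)]
      by (simp add: exponent_8_def cong_iff_dvd_diff)
  next
    case False
    then have "odd (int a)" by (simp add: l_eq)
    moreover have "8 dvd x_N N r - cofactor_sum * int N"
      using x_N_cong_odd_level[OF assms(1)] by (simp add: cong_iff_dvd_diff)
    ultimately have "8 dvd (int l - 1) * cofactor_sum * x + (int d - int a) * cofactor_sum * (y - 3)
        + (x_N N r - cofactor_sum * int N) * (b * int d)"
      using eight_dvd_sums(1) eight_dvd_diff_inverse[of "int a" "int d" cofactor_sum]
      unfolding l_eq of_nat_mult by (intro dvd_add) simp_all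
    moreover have "kron_sum + cofactor_sum * ((u + y - 3) * int d - (int a * y + x - 3))
        - exponent_8
        = (int l - 1) * cofactor_sum * x + (int d - int a) * cofactor_sum * (y - 3)
        + (x_N N r - cofactor_sum * int N) * (b * int d)"
      unfolding exponent_8_def u_def odd_cofactor_sum_odd_level[OF assms(1)] l_eq
      by (simp add: algebra_simps)
    ultimately show ?thesis by (simp only: cong_iff_dvd_diff)
  qed
  finally show ?thesis .
qed

lemma sum_Psi_diff_cong_8_odd_level_even:
  assumes "odd N" "even d"
  shows "[divisor_sum Psi_diff = exponent_8] (mod 8)"
proof -
  have "even l" using assms(2) by (simp add: l_eq)
  note sums = eight_dvd_sums_even[OF this]
  have "odd y"
    using coprime_common_divisor[OF coprime_y, of 2] assms(2) by auto
  define c where "c = int (multiplicity 2 d) * chi8_log y - 2 * (y - 1)"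
  define c' where "c' = int (odd_part d) * (y - 1) - int d * y - (int a * y + x - 3)"
  have "[divisor_sum Psi_diff = divisor_sum (\<lambda>m n. kron_log (int a) m
      + kron_log y (odd_part d) + c - int n * (z * y) + int m * c')] (mod 8)"
  proof (rule divisor_sum_cong)
    fix m n assume "m * n = N"
    then show "[Psi_diff m n
        = kron_log (int a) m + kron_log y (odd_part d) + c - int n * (z * y) + int m * c'] (mod 8)"
      using Psi_diff_cong_8_odd_even[of m n] assms by (auto simp: c_def c'_def algebra_simps)
  qed
  also have "divisor_sum (\<lambda>m n. kron_log (int a) m
      + kron_log y (odd_part d) + c - int n * (z * y) + int m * c')
      = kron_sum + exponent_sum * c - x_N N r * (z * y) + cofactor_sum * c'"
    unfolding divisor_sum_linear kron_sum_def ..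
  also have "[kron_sum + exponent_sum * c - x_N N r * (z * y) + cofactor_sum * c'
      = exponent_8 + 0 - 0 + 0] (mod 8)"
  proof (intro cong_add cong_diff)
    show "[kron_sum = exponent_8] (mod 8)"
      using sums odd_cofactor_sum_odd_level[OF assms(1)]
      by (simp add: exponent_8_def cong_iff_dvd_diff)
    have "4 dvd c"
      unfolding c_def using four_dvd_chi8_log[OF \<open>odd y\<close>] four_dvd_mult_even[of 2 "y - 1"] \<open>odd y\<close>
      by (intro dvd_diff) auto
    then show "[exponent_sum * c = 0] (mod 8)"
      using even_exponent_sum_even[OF \<open>even l\<close> assms(1)]
      by (simp only: cong_0_iff eight_dvd_even_mult_four)
  qed (use sums in \<open>simp_all add: cong_0_iff\<close>)
  finally show ?thesis by simp
qed

lemma sum_Psi_diff_cong_8: "[divisor_sum Psi_diff = exponent_8] (mod 8)"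
  using sum_Psi_diff_cong_8_even_level sum_Psi_diff_cong_8_odd_level_odd
    sum_Psi_diff_cong_8_odd_level_even
  by blast

end

subsection \<open>Characters as roots of unity\<close>

lemma e_add: "e (x + y) = e x * e y"
  by (simp add: e_def distrib_left exp_add)

lemma e_minus: "e (- x) = inverse (e x)"
  by (simp add: e_def exp_minus)

lemma e_of_real_eq_1_iff: "e (of_real q) = 1 \<longleftrightarrow> q \<in> \<int>"
proof
  assume "e (of_real q) = 1"
  then obtain n :: int where "2 * pi * q = of_int (2 * n) * pi"
    unfolding e_def exp_eq_1 by auto
  then show "q \<in> \<int>" by simp
next
  assume "q \<in> \<int>"
  then obtain n where "q = of_int n" by (elim Ints_cases)
  then show "e (of_real q) = 1"
    unfolding e_def exp_eq_1 by (intro conjI exI[of _ n]) simp_all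
qed

lemma e_0 [simp]: "e 0 = 1"
  by (simp add: e_def)

definition e24 :: "int \<Rightarrow> complex" where
  "e24 i = e (of_real (of_int i / 24))"

lemma e24_add: "e24 (i + j) = e24 i * e24 j"
  by (simp add: e24_def add_divide_distrib e_add)

lemma e24_minus: "e24 (- i) = inverse (e24 i)"
  by (simp add: e24_def e_minus)

lemma e24_cong:
  assumes "[i = j] (mod 24)"
  shows "e24 i = e24 j"
proof -
  obtain t where "i = j + 24 * t" using assms by (rule cong_intE)
  moreover have "e24 (24 * t) = 1"
    unfolding e24_def e_of_real_eq_1_iff by simp
  ultimately show ?thesis by (simp add: e24_add)
qed

lemma e24_sign_log:
  assumes "\<bar>s\<bar> = 1"
  shows "e24 (3 * sign_log s) = of_int s"
proof -
  have "s = 1 \<or> s = -1" using assms by linarith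
  moreover have "e24 12 = -1" by (simp add: e24_def e_def exp_pi_i')
  ultimately show ?thesis by (auto simp: sign_log_def e24_def)
qed

lemma of_int_sign_powr:
  assumes "\<bar>s\<bar> = 1"
  shows "of_int s powr of_int i = (of_int (if even i then 1 else s) :: complex)"
proof -
  have "s = 1 \<or> s = -1" using assms by linarith
  moreover have "(-1 :: complex) powi i = (if even i then 1 else -1)"
    by (auto simp: power_int_def even_nat_iff minus_one_power_iff)
  ultimately show ?thesis by (auto simp: complex_powr_of_int)
qed

lemma (in eta_quotient) chi_r_eq_e24:
  assumes "\<And>m n. m * n = N \<Longrightarrow> Psi (A, B * int n, C div int n, D) = of_int (g m n)"
  shows "chi_r N r (A, B, C, D) 1 = e24 (divisor_sum g)"
proof -
  have "(\<Sum>n\<in>divs N. of_int (r n) * Psi (A, B * int n, C div int n, D)) = of_int (divisor_sum g)"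
    unfolding divisor_sum_def of_int_sum of_int_mult
    by (intro sum.cong refl arg_cong2[of _ _ _ _ "(*)"] assms divs_cofactor)
  then show ?thesis unfolding chi_r_def e24_def by (simp only: prod.case) simp
qed

context hecke_term
begin

lemma chi_r_first:
  "chi_r N r (- int N * b + int a * x, z, - int N * int d, y) 1
    = e24 (- divisor_sum (\<lambda>m n. Psi_int u (- (z * int n)) (int (m * d)) y))"
proof -
  have "chi_r N r (- int N * b + int a * x, z, - int N * int d, y) 1
      = e24 (divisor_sum (\<lambda>m n. - Psi_int u (- (z * int n)) (int (m * d)) y))"
  proof (rule chi_r_eq_e24)
    fix m n assume mn: "m * n = N"
    then have pos: "0 < m" "0 < n" using N_pos by (auto intro: Nat.gr0I)
    have "- int N * int d = int n * - int (m * d)" by (simp add: mn[symmetric])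
    then have "(- int N * int d) div int n = - int (m * d)"
      using pos(2) by (metis nonzero_mult_div_cancel_left of_nat_0_less_iff less_irrefl)
    then show "Psi (- int N * b + int a * x, z * int n, (- int N * int d) div int n, y)
        = of_int (- Psi_int u (- (z * int n)) (int (m * d)) y)"
      using Psi_minus_c[of "int (m * d)" u "z * int n" y "- (z * int n)"]
        of_int_Psi_int[OF _ det_first[OF mn]]
        pos d_pos by (simp add: u_def)
  qed
  then show ?thesis by (simp add: divisor_sum_def sum_negf)
qed

lemma chi_r_second:
  "chi_r N r (int a * y, b * y - int d * z, int N, x) 1
    = e24 (divisor_sum (\<lambda>m n. Psi_int (int a * y) (w * int n) (int m) x))"
proof (rule chi_r_eq_e24)
  fix m n assume mn: "m * n = N"
  then have pos: "0 < m" "0 < n" using N_pos by (auto intro: Nat.gr0I)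
  have "int N div int n = int m" using mn pos by auto
  then show "Psi (int a * y, (b * y - int d * z) * int n, int N div int n, x)
      = of_int (Psi_int (int a * y) (w * int n) (int m) x)"
    using of_int_Psi_int[OF _ det_second[OF mn]] pos by (simp add: w_def)
qed

lemma chi_r_product_eq_e24:
  "inverse (chi_r N r (- int N * b + int a * x, z, - int N * int d, y) 1) *
    inverse (chi_r N r (int a * y, b * y - int d * z, int N, x) 1) = e24 (divisor_sum Psi_diff)"
  unfolding chi_r_first chi_r_second e24_minus[symmetric] e24_add[symmetric] Psi_diff_def[abs_def]
    divisor_sum_diff by simp

end

subsection \<open>The signs\<close>

definition root_sign :: "nat \<Rightarrow> (nat \<Rightarrow> int) \<Rightarrow> nat \<Rightarrow> nat \<Rightarrow> int \<Rightarrow> int" where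
  "root_sign N r a d b = (if even (\<Sum>n\<in>divs N. r n) then 1
    else kronecker (- int N * b) (int (gcd a d)))"

lemma kronecker_mult_square_right:
  assumes "0 < g" "0 < p" "coprime y (int p)"
  shows "kronecker y (int (g * p ^ 2)) = kronecker y (int g)"
proof -
  have "\<bar>kronecker y (int p)\<bar> = 1" using assms(2,3) by (rule abs_kronecker)
  then have "kronecker y (int p) ^ 2 = 1" by (simp add: power2_eq_1_iff abs_if split: if_splits)
  then show ?thesis
    using kronecker_mult_right[of g "p ^ 2" y] kronecker_power_right[of p y 2] assms by simp
qed

lemma square_mult_eq_gcd_mult_square:
  fixes a d t :: nat
  assumes "a * d = t ^ 2" "0 < a" "0 < d"
  obtains p where "d = gcd a d * p ^ 2"
proof -
  define g where "g = gcd a d"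
  obtain a' d' where ad: "a = g * a'" "d = g * d'" "coprime a' d'" "0 < g"
    unfolding g_def using gcd_coprime_exists[of a d] assms
    by (metis gcd_pos_nat mult.commute neq0_conv)
  have eq: "g ^ 2 * (a' * d') = t ^ 2" using assms(1) ad by (simp add: power2_eq_square mult_ac)
  then have "g dvd t" by (metis dvd_triv_left pow_divides_pow_iff zero_less_numeral)
  then obtain q where "t = g * q" by blast
  then have "a' * d' = q ^ 2" using eq ad(4) by (simp add: power_mult_distrib)
  then have "is_nth_power 2 (a' * d')" by simp
  then have "is_nth_power 2 d'"
    using is_nth_power_mult_coprime_natD(2)[of a' d' 2] ad assms by simp
  then show thesis using ad(2) that by (auto simp: is_nth_power_def g_def)
qed

context hecke_term
begin

lemma coprime_Nb_gcd: "coprime (- int N * b) (int (gcd a d))"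
proof (rule coprimeI)
  fix q assume q: "q dvd - int N * b" "q dvd int (gcd a d)"
  then have "q dvd int a" "q dvd int d" by (auto intro: dvd_trans)
  with q(1) have "q dvd u * y + int N * int d * z" by (simp add: u_def)
  then show "is_unit q" by (simp add: uy)
qed

lemma kronecker_Nb_common_divisor:
  assumes "odd g" "g dvd a" "g dvd d"
  shows "kronecker (- int N * b) (int g) = kronecker y (int g)"
proof -
  have "0 < g" using assms(1) by (rule odd_pos)
  obtain a' d' where a': "a = g * a'" and d': "d = g * d'" using assms(2,3) by blast
  have "[- int N * b = u] (mod int g)"
    by (rule cong_add_multI[of _ _ _ "- (int a' * x)"]) (unfold u_def, simp add: a')
  then have "kronecker (- int N * b) (int g) * kronecker y (int g) = kronecker (u * y) (int g)"
    using kronecker_cong[OF assms(1)] kronecker_mult_left[OF \<open>0 < g\<close>] by simp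
  also have "kronecker (u * y) (int g) = kronecker 1 (int g)"
  proof (rule kronecker_cong[OF assms(1)])
    have "u * y = 1 + int g * - (int N * int d' * z)" using uy by (simp add: d' algebra_simps)
    then show "[u * y = 1] (mod int g)" by (rule cong_add_multI)
  qed
  finally have "kronecker (- int N * b) (int g) * kronecker y (int g) = 1"
    using \<open>0 < g\<close> by simp
  then show ?thesis by (auto simp: zmult_eq_1_iff)
qed

lemma kronecker_y_odd_part:
  assumes "odd exponent_sum"
  shows "kronecker y (int (odd_part d)) = kronecker (- int N * b) (int (gcd a d))"
proof -
  have "odd a"
    using odd_divisor_if_odd_exponent_sum[OF assms, of a] l_eq coprime_a_N
    by (simp add: coprime_commute)
  then have g: "odd (gcd a d)" "0 < gcd a d" using a_pos by simp_all
  obtain t where "a * d = t ^ 2" using l_square[OF assms] l_eq by auto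
  then obtain p where p: "d = gcd a d * p ^ 2"
    using square_mult_eq_gcd_mult_square a_pos d_pos by blast
  then have "0 < p" using d_pos by (metis gr0I mult_0_right zero_power2)
  have "odd_part d = gcd a d * odd_part p ^ 2"
    using arg_cong[OF p, of odd_part] g \<open>0 < p\<close>
    by (simp add: odd_part_mult odd_part_power odd_part_odd)
  moreover have "coprime y (int (odd_part p))"
    using coprime_y_odd_part_d calculation by simp
  ultimately show ?thesis
    using kronecker_mult_square_right[OF g(2) odd_part_pos[OF \<open>0 < p\<close>]]
      kronecker_Nb_common_divisor[OF g(1)]
    by simp
qed

lemma abs_root_sign: "\<bar>root_sign N r a d b\<bar> = 1"
  using abs_kronecker[OF _ coprime_Nb_gcd] a_pos by (simp add: root_sign_def)

lemma kron_sum_cong: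
  "[kron_sum = kron_log (int a) (varpi N r) + sign_log (root_sign N r a d b)] (mod 8)"
  unfolding kron_sum_def
proof (rule cong_add)
  show "[divisor_sum (\<lambda>m n. kron_log (int a) m) = kron_log (int a) (varpi N r)] (mod 8)"
    by (rule cong_sym[OF kron_log_varpi[OF coprime_a_N]])
  have parity: "[exponent_sum * kron_log y (odd_part d) = i * kron_log y (odd_part d)] (mod 8)"
    if "[exponent_sum = i] (mod 2)" for i
    by (rule kron_log_parity[OF odd_part_pos[OF d_pos] coprime_y_odd_part_d that])
  show "[exponent_sum * kron_log y (odd_part d) = sign_log (root_sign N r a d b)] (mod 8)"
  proof (cases "even exponent_sum")
    case True
    then show ?thesis
      using parity[of 0] by (simp add: root_sign_def exponent_sum_def divisor_sum_def cong_0_iff)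
  next
    case False
    then have "root_sign N r a d b = kronecker y (int (odd_part d))"
      using kronecker_y_odd_part by (simp add: root_sign_def exponent_sum_def divisor_sum_def)
    then show ?thesis
      using False parity[of 1] by (simp add: kron_log_def cong_iff_dvd_diff)
  qed
qed

lemma sum_Psi_diff_cong_24:
  "[divisor_sum Psi_diff = 3 * kron_log (int a) (varpi N r) + 3 * sign_log (root_sign N r a d b)
    + - (b * int d * x_N N r) + - (3 * odd_cofactor_sum * (int a - 1))] (mod 24)"
    (is "[_ = ?E] (mod 24)")
proof -
  let ?K = "kron_log (int a) (varpi N r)" and ?S = "sign_log (root_sign N r a d b)"
  have "[?K + ?S = 3 * ?K + 3 * ?S] (mod 8)"
    using kron_log_parity[OF varpi_pos coprime_varpi[OF coprime_a_N], of 1 3]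
      sign_log_parity[OF abs_root_sign, of 1 3]
    by (intro cong_add) (simp_all add: cong_def)
  from cong_trans[OF kron_sum_cong this] have "[exponent_8 = ?E] (mod 8)"
    unfolding exponent_8_def diff_conv_add_uminus by (intro cong_add cong_refl)
  with sum_Psi_diff_cong_8 have "[divisor_sum Psi_diff = ?E] (mod 8)" by (rule cong_trans)
  moreover have "[- (b * int d * x_N N r) = ?E] (mod 3)"
    by (rule cong_add_multI[of _ _ _ "odd_cofactor_sum * (int a - 1) - ?K - ?S"])
      (simp add: algebra_simps)
  with sum_Psi_diff_cong_3 have "[divisor_sum Psi_diff = ?E] (mod 3)" by (rule cong_trans)
  ultimately show ?thesis unfolding cong_iff_dvd_diff by (rule dvd_24I)
qed

theorem chi_r_product:
  "inverse (chi_r N r (- int N * b + int a * x, z, - int N * int d, y) 1) *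
    inverse (chi_r N r (int a * y, b * y - int d * z, int N, x) 1)
    = of_int (kronecker (int a) (int (varpi N r))) * of_int (root_sign N r a d b)
      * e24 (- (b * int d * x_N N r)) * e24 (- (3 * odd_cofactor_sum * (int a - 1)))"
proof -
  have "\<bar>kronecker (int a) (int (varpi N r))\<bar> = 1"
    by (intro abs_kronecker varpi_pos coprime_varpi coprime_a_N)
  then show ?thesis
    unfolding chi_r_product_eq_e24 e24_cong[OF sum_Psi_diff_cong_24] e24_add
    by (simp add: kron_log_def e24_sign_log abs_root_sign)
qed

end

subsection \<open>The factor \<open>\<psi>\<close>\<close>

lemma mult_even_cong_8:
  fixes p q t :: int
  assumes "[p = q] (mod 4)" "even t"
  shows "[p * t = q * t] (mod 8)"
proof -
  have "8 dvd t * (p - q)" using assms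
    by (intro eight_dvd_even_mult_four) (simp_all add: cong_iff_dvd_diff)
  then show ?thesis by (simp add: cong_iff_dvd_diff algebra_simps)
qed

lemma e24_3_cong:
  assumes "[i = j] (mod 8)"
  shows "e24 (3 * i) = e24 (3 * j)"
proof (rule e24_cong)
  obtain t where "i = j + 8 * t" using assms by (rule cong_intE)
  then show "[3 * i = 3 * j] (mod 24)" by (intro cong_add_multI[of _ _ _ t]) simp
qed

context hecke_level
begin

lemma four_dvd_odd_cofactor_sum:
  assumes "even l" "int N = 2 * N'" "odd N'"
  shows "4 dvd odd_cofactor_sum"
proof -
  have "4 dvd cofactor_sum" "4 dvd x_N N r"
    using eight_dvd_sums_even[OF assms(1)] by (auto intro: dvd_trans[of 4 8])
  moreover obtain i where i: "odd_cofactor_sum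
      = cofactor_sum + x_N N r * N' + exponent_sum * 2 + 4 * i"
    using odd_cofactor_sum_cong_two_exact[OF assms(2,3)] by (rule cong_intE)
  ultimately have "even odd_cofactor_sum" by (auto intro: dvd_trans[of 2 4])
  then have "even exponent_sum" using odd_cofactor_sum_parity by (simp add: cong_dvd_iff)
  then have "4 dvd exponent_sum * 2" by (rule four_dvd_mult_even) simp
  then show ?thesis unfolding i using \<open>4 dvd cofactor_sum\<close> \<open>4 dvd x_N N r\<close> by simp
qed

lemma odd_multiplicity_2_varpi:
  assumes "even l" "int N = 4 * N'" "odd N'" "odd exponent_sum"
  shows "odd (multiplicity 2 (varpi N r))"
proof -
  have "[int (multiplicity 2 (varpi N r)) = exponent_sum + cofactor_sum + x_N N r] (mod 2)"
    using multiplicity_2_varpi multiplicity_sum_cong_four_exact[OF assms(2,3)] by (rule cong_trans)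
  moreover have "even cofactor_sum" "even (x_N N r)"
    using eight_dvd_sums_even[OF assms(1)] by (auto intro: dvd_trans[of 2 8])
  ultimately show ?thesis using assms(4) cong_dvd_iff by fastforce
qed

definition delta1_int :: int where
  "delta1_int =
    (if even l \<and> 4 dvd N \<and> odd exponent_sum \<and> odd (multiplicity 2 (varpi N r)) then 1 else 0)"

lemma eight_dvd_N_odd_cofactor_sum:
  assumes "even l" "even N"
  shows "8 dvd odd_cofactor_sum * (int N * (1 + delta1_int))"
proof -
  obtain N' where N': "int N = 2 * N'" using assms(2) by (metis even_of_nat_iff evenE)
  then have "odd N' \<or> (\<exists>N''. int N = 4 * N'' \<and> odd N'') \<or> 8 dvd int N" by presburger
  then consider (two) "odd N'" | (four) N'' where "int N = 4 * N''" "odd N''"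
    | (eight) "8 dvd int N"
    by blast
  then show ?thesis
  proof cases
    case two
    have "8 dvd int N * odd_cofactor_sum"
      using four_dvd_odd_cofactor_sum[OF assms(1) N' two] assms(2)
      by (simp add: eight_dvd_even_mult_four)
    then have "8 dvd (int N * odd_cofactor_sum) * (1 + delta1_int)" by (rule dvd_mult2)
    then show ?thesis by (simp only: mult_ac)
  next
    case (four N'')
    have "even (odd_cofactor_sum * (1 + delta1_int))"
    proof (cases "even exponent_sum")
      case True
      then show ?thesis using odd_cofactor_sum_parity by (simp add: cong_dvd_iff)
    next
      case False
      moreover have "4 dvd N" using four(1) by presburger
      ultimately have "delta1_int = 1"
        using odd_multiplicity_2_varpi[OF assms(1) four] assms(1) by (simp add: delta1_int_def)
      then show ?thesis by simp
    qed
    then have "8 dvd (odd_cofactor_sum * (1 + delta1_int)) * int N"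
      by (rule eight_dvd_even_mult_four) (simp add: four(1))
    then show ?thesis by (simp only: mult_ac)
  qed simp
qed

lemma odd_cofactor_sum_cong_odd:
  assumes "l = a * d" "odd l"
  shows "[odd_cofactor_sum * ((int l - 1) * (int N - 1)) - odd_cofactor_sum * (int d - 1)
    = - (odd_cofactor_sum * (int a - 1))] (mod 8)"
proof -
  have "odd a" using assms by simp
  have "8 dvd (int l - 1) * odd_cofactor_sum * (int N - 1 - int a)"
  proof (cases "even N")
    case True
    then show ?thesis
      using assms(2) \<open>odd a\<close> odd_cofactor_sum_parity by (intro eight_dvd_exponent_sum_odd) auto
  next
    case False
    then show ?thesis using eight_dvd_sums(1) odd_cofactor_sum_odd_level by simp
  qed
  moreover have "8 dvd int a ^ 2 - 1"
    using odd_square_cong_1[of "int a"] \<open>odd a\<close> by (simp add: cong_iff_dvd_diff)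
  ultimately have "8 dvd (int l - 1) * odd_cofactor_sum * (int N - 1 - int a)
      + (int a ^ 2 - 1) * (odd_cofactor_sum * int d)" by simp
  then show ?thesis by (simp add: cong_iff_dvd_diff assms(1) algebra_simps power2_eq_square)
qed

lemma psi_lr_odd:
  assumes "k = of_int \<kappa> / 2" "l = a * d" "odd l"
  shows "psi_lr N r k l a b
    = e24 (3 * ((\<kappa> + 2 * delta_int) * ((int l - 1) * (int N - 1))
        - (\<kappa> + 2 * delta_int) * (int d - 1)))"
proof -
  have "l div a = d" using assms(2) l_pos by simp
  then show ?thesis
    using assms(3) unfolding psi_lr_def Let_def delta0_eq assms(1) e24_def
    by (auto simp: field_simps intro!: arg_cong[of _ _ e])
qed

lemma psi_lr_even:
  assumes "k = of_int \<kappa> / 2" "odd \<kappa> \<longleftrightarrow> odd exponent_sum" "even l" "even N"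
  shows "psi_lr N r k l a b = e24 (3 * (- ((\<kappa> + 2 * delta_int) * (int a - 1))
    - (\<kappa> + 2 * delta_int) * (int N * (1 + delta1_int)) * int b))"
proof -
  have "delta1 N r k l = of_int delta1_int"
    unfolding delta1_def delta1_int_def assms(1) half_in_half_integers_iff using assms(2) by simp
  then show ?thesis
    using assms(3,4) unfolding psi_lr_def Let_def delta0_eq unfolding assms(1) e24_def
    by (auto simp: field_simps intro!: arg_cong[of _ _ e])
qed

lemma psi_exponent_cong_even:
  assumes "even l" "even N" "odd a" "[c = odd_cofactor_sum] (mod 4)"
  shows "[- (c * (int a - 1)) - c * (int N * (1 + delta1_int)) * b
    = - (odd_cofactor_sum * (int a - 1))] (mod 8)"
proof -
  have even: "even (int a - 1)" "even (int N * (1 + delta1_int))" using assms by auto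
  have "[- (c * (int a - 1)) - c * (int N * (1 + delta1_int)) * b
      = - (odd_cofactor_sum * (int a - 1))
        - odd_cofactor_sum * (int N * (1 + delta1_int)) * b] (mod 8)"
    by (intro cong_diff cong_minus_minus_iff[THEN iffD2] cong_mult[OF _ cong_refl[of b]]
        mult_even_cong_8 assms(4) even)
  also have "[- (odd_cofactor_sum * (int a - 1))
      - odd_cofactor_sum * (int N * (1 + delta1_int)) * b
      = - (odd_cofactor_sum * (int a - 1))] (mod 8)"
    using eight_dvd_N_odd_cofactor_sum[OF assms(1,2)] by (simp add: cong_iff_dvd_diff)
  finally show ?thesis .
qed

theorem psi_lr_eq_e24:
  assumes l: "l = a * d" and "coprime a N" and k: "k = kprime N r + 2 * of_int j"
  shows "psi_lr N r k l a b = e24 (- (3 * odd_cofactor_sum * (int a - 1)))"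
proof -
  define \<kappa> where "\<kappa> = exponent_sum + 4 * j"
  have k_eq: "k = of_int \<kappa> / 2" by (simp add: k kprime_eq \<kappa>_def add_divide_distrib)
  have parity: "odd \<kappa> \<longleftrightarrow> odd exponent_sum" by (simp add: \<kappa>_def)
  have "[exponent_sum + 2 * delta_int + 4 * j
      = exponent_sum + (odd_cofactor_sum - exponent_sum) + 0] (mod 4)"
    by (intro cong_add cong_refl delta_int_cong) (simp add: cong_0_iff)
  then have cong: "[\<kappa> + 2 * delta_int = odd_cofactor_sum] (mod 4)"
    by (simp add: \<kappa>_def algebra_simps)
  consider (odd) "odd l" | (even_even) "even l" "even N" | (even_odd) "even l" "odd N" by blast
  then have "psi_lr N r k l a b = e24 (3 * - (odd_cofactor_sum * (int a - 1)))"
  proof cases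
    case odd
    then have even: "even (int d - 1)" "even ((int l - 1) * (int N - 1))" using l by auto
    show ?thesis
      unfolding psi_lr_odd[OF k_eq l odd] using odd_cofactor_sum_cong_odd[OF l odd]
      by (intro e24_3_cong) (blast intro: cong_trans cong_diff mult_even_cong_8 cong even)
  next
    case even_even
    then have "odd a" using assms(2) coprime_common_divisor[of a N 2] by auto
    then show ?thesis
      unfolding psi_lr_even[OF k_eq parity even_even]
      by (intro e24_3_cong psi_exponent_cong_even even_even cong)
  next
    case even_odd
    then have "8 dvd odd_cofactor_sum"
      using eight_dvd_sums_even(1) odd_cofactor_sum_odd_level by simp
    then have "[0 = - (odd_cofactor_sum * (int a - 1))] (mod 8)" by (simp add: cong_iff_dvd_diff)
    from e24_3_cong[OF this] show ?thesis
      using even_odd by (simp add: psi_lr_def Let_def e24_def)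
  qed
  then show ?thesis by (simp add: mult.assoc)
qed

end

subsection \<open>Uniqueness of trigonometric series\<close>

lemma e_nonzero [simp]: "e x \<noteq> 0"
  by (simp add: e_def)

lemma e_power: "e x ^ n = e (of_nat n * x)"
  by (induction n) (simp_all add: e_add distrib_right)

lemma sum_e_multiples:
  assumes "0 < K"
  shows "(\<Sum>j<K. e (of_int i * of_nat j / of_nat K)) = (if int K dvd i then of_nat K else 0)"
proof -
  define \<omega> where "\<omega> = e (of_real (of_int i / of_nat K))"
  have powers: "e (of_int i * of_nat j / of_nat K) = \<omega> ^ j" for j
    by (simp add: \<omega>_def e_power mult.commute)
  have "of_int i / real K \<in> \<int> \<longleftrightarrow> int K dvd i"
    using of_int_div_of_int_in_Ints_iff[of i "int K", where 'a = real] assms by simp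
  then have \<omega>_eq_1: "\<omega> = 1 \<longleftrightarrow> int K dvd i" unfolding \<omega>_def e_of_real_eq_1_iff .
  have "\<omega> ^ K = 1"
    unfolding \<omega>_def e_power using assms e_of_real_eq_1_iff[of "of_int i"] by simp
  then show ?thesis using \<omega>_eq_1 by (cases "\<omega> = 1") (simp_all add: powers geometric_sum)
qed

lemma has_sum_sum:
  fixes f :: "'i \<Rightarrow> 'a \<Rightarrow> 'b :: topological_comm_monoid_add"
  assumes "finite I" "\<And>i. i \<in> I \<Longrightarrow> (f i has_sum s i) A"
  shows "((\<lambda>x. \<Sum>i\<in>I. f i x) has_sum (\<Sum>i\<in>I. s i)) A"
  using assms
proof (induction I rule: finite_induct)
  case (insert i I)
  then show ?case by (simp add: has_sum_add)
qed (simp add: has_sum_0)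

lemma abs_summable_tail:
  fixes f :: "'a \<Rightarrow> 'b :: banach"
  assumes "(\<lambda>x. norm (f x)) summable_on A" "0 < \<epsilon>"
  obtains F where "finite F" "F \<subseteq> A" "(\<Sum>\<^sub>\<infinity>x\<in>A - F. norm (f x)) < \<epsilon>"
proof -
  obtain F where F: "finite F" "F \<subseteq> A" "dist (\<Sum>x\<in>F. norm (f x)) (\<Sum>\<^sub>\<infinity>x\<in>A. norm (f x)) \<le> \<epsilon> / 2"
    using infsum_finite_approximation[OF assms(1), of "\<epsilon> / 2"] assms(2) by auto
  have "(\<Sum>\<^sub>\<infinity>x\<in>A - F. norm (f x)) = (\<Sum>\<^sub>\<infinity>x\<in>A. norm (f x)) - (\<Sum>x\<in>F. norm (f x))"
    using F(1,2) assms(1) by (subst infsum_Diff) simp_all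
  then have "(\<Sum>\<^sub>\<infinity>x\<in>A - F. norm (f x)) < \<epsilon>"
    using F(3) assms(2) unfolding dist_real_def by linarith
  with F(1,2) show thesis by (rule that)
qed

text \<open>Averaging over the translates by \<open>j / K\<close>, \<open>j < K\<close>, extracts the terms of a residue class
  modulo \<open>K\<close>.\<close>

lemma has_sum_residue_class_zero:
  fixes g :: "int \<Rightarrow> complex"
  assumes "\<And>\<theta>::real. ((\<lambda>m. g m * e (of_int m * of_real \<theta>)) has_sum 0) UNIV" "0 < K"
  shows "((\<lambda>m. if int K dvd m - m0 then g m else 0) has_sum 0) UNIV"
proof -
  have "((\<lambda>m. g m * e (of_int (m - m0) * of_nat j / of_nat K)) has_sum 0) UNIV" for j
  proof -
    have twist: "g m * e (of_int (m - m0) * of_nat j / of_nat K)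
        = e (- (of_int m0 * of_nat j / of_nat K))
            * (g m * e (of_int m * of_real (real j / real K)))" for m
    proof -
      have "of_int (m - m0) * of_nat j / of_nat K
          = - (of_int m0 * of_nat j / of_nat K) + of_int m * complex_of_real (real j / real K)"
        by (simp add: diff_divide_distrib left_diff_distrib)
      then show ?thesis by (simp only: e_add mult.left_commute)
    qed
    show ?thesis
      unfolding twist using has_sum_cmult_right[OF assms(1)] by (simp only: mult_zero_right)
  qed
  then have "((\<lambda>m. \<Sum>j<K. g m * e (of_int (m - m0) * of_nat j / of_nat K)) has_sum (\<Sum>j<K. 0)) UNIV"
    by (intro has_sum_sum) auto
  moreover have "(\<Sum>j<K. g m * e (of_int (m - m0) * of_nat j / of_nat K))
      = of_nat K * (if int K dvd m - m0 then g m else 0)" for m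
    unfolding sum_distrib_left[symmetric] sum_e_multiples[OF assms(2)] by simp
  ultimately have "((\<lambda>m. of_nat K * (if int K dvd m - m0 then g m else 0)) has_sum 0) UNIV"
    by simp
  from has_sum_cmult_right[OF this, of "1 / of_nat K"] show ?thesis
    using assms(2) by simp
qed

lemma trigonometric_series_zero:
  fixes g :: "int \<Rightarrow> complex"
  assumes "\<And>\<theta>::real. ((\<lambda>m. g m * e (of_int m * of_real \<theta>)) has_sum 0) UNIV"
  shows "g m0 = 0"
proof (rule ccontr)
  assume "g m0 \<noteq> 0"
  have "(g has_sum 0) UNIV" using assms[of 0] by simp
  then have abs: "(\<lambda>m. norm (g m)) summable_on UNIV"
    using summable_on_iff_abs_summable_on_complex has_sum_imp_summable by blast
  then obtain F where F: "finite F" "(\<Sum>\<^sub>\<infinity>m\<in>UNIV - F. norm (g m)) < norm (g m0)"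
    using abs_summable_tail[OF abs, of "norm (g m0)"] \<open>g m0 \<noteq> 0\<close> by auto
  have "finite ((\<lambda>m. m - m0) ` F)" using F(1) by simp
  then obtain k where k: "abs ` (\<lambda>m. m - m0) ` F \<subseteq> {..<k}"
    unfolding finite_int_iff_bounded by blast
  define K where "K = nat (max k 1)"
  have far: "m \<notin> F" if "m \<noteq> m0" "int K dvd m - m0" for m
  proof
    assume "m \<in> F"
    then have "\<bar>m - m0\<bar> < k" using k by auto
    moreover have "int K \<le> \<bar>m - m0\<bar>"
      using that dvd_imp_le_int[of "m - m0" "int K"] by simp
    moreover have "k \<le> int K" by (auto simp: K_def max_def)
    ultimately show False by linarith
  qed
  have "((\<lambda>m. if int K dvd m - m0 then g m else 0) has_sum 0) UNIV"
    by (rule has_sum_residue_class_zero[OF assms]) (simp add: K_def)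
  moreover have "((\<lambda>m. if int K dvd m - m0 then g m else 0) has_sum g m0) {m0}"
    by (rule has_sum_finiteI) simp_all
  ultimately have "((\<lambda>m. if int K dvd m - m0 then g m else 0) has_sum (0 - g m0)) (UNIV - {m0})"
    by (rule has_sum_Diff) simp
  then have "((\<lambda>m. if m \<noteq> m0 \<and> int K dvd m - m0 then g m else 0) has_sum (0 - g m0)) (UNIV - F)"
    by (rule has_sum_cong_neutral[THEN iffD1, rotated -1]) (use far in auto)
  moreover have "((\<lambda>m. norm (g m)) has_sum (\<Sum>\<^sub>\<infinity>m\<in>UNIV - F. norm (g m))) (UNIV - F)"
    using summable_on_subset_banach[OF abs, of "UNIV - F"] by (intro has_sum_infsum) simp
  ultimately have "norm (0 - g m0) \<le> (\<Sum>\<^sub>\<infinity>m\<in>UNIV - F. norm (g m))"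
    by (rule norm_infsum_le) simp
  then show False using F(2) by simp
qed

subsection \<open>Expansions in rational powers of \<open>q\<close>\<close>

abbreviation (input) e_rat :: "rat \<Rightarrow> complex" where
  "e_rat q \<equiv> e (of_real (of_rat q))"

abbreviation (input) q_power :: "rat \<Rightarrow> complex \<Rightarrow> complex" where
  "q_power n \<tau> \<equiv> e (of_real (of_rat n) * \<tau>)"

abbreviation (input) zero_extension :: "rat set \<Rightarrow> (rat \<Rightarrow> complex) \<Rightarrow> rat \<Rightarrow> complex" where
  "zero_extension X c n \<equiv> if n \<in> X then c n else 0"

definition has_q_expansion :: "(complex \<Rightarrow> complex) \<Rightarrow> rat set \<Rightarrow> (rat \<Rightarrow> complex) \<Rightarrow> real \<Rightarrow> bool" where
  "has_q_expansion F X c Y \<longleftrightarrow> (\<forall>\<tau>. Im \<tau> > Y \<longrightarrow> ((\<lambda>n. c n * q_power n \<tau>) has_sum F \<tau>) X)"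

lemma has_q_expansionI:
  "(\<And>\<tau>. Im \<tau> > Y \<Longrightarrow> ((\<lambda>n. c n * q_power n \<tau>) has_sum F \<tau>) X) \<Longrightarrow> has_q_expansion F X c Y"
  by (simp add: has_q_expansion_def)

lemma has_q_expansionD:
  "has_q_expansion F X c Y \<Longrightarrow> Im \<tau> > Y \<Longrightarrow> ((\<lambda>n. c n * q_power n \<tau>) has_sum F \<tau>) X"
  by (simp add: has_q_expansion_def)

lemma has_q_expansion_mono: "has_q_expansion F X c Y \<Longrightarrow> Y \<le> Y' \<Longrightarrow> has_q_expansion F X c Y'"
  by (simp add: has_q_expansion_def)

lemma has_q_expansion_cong:
  assumes "\<And>\<tau>. Im \<tau> > Y \<Longrightarrow> F \<tau> = G \<tau>" "\<And>n. n \<in> X \<Longrightarrow> c n = c' n"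
  shows "has_q_expansion F X c Y \<longleftrightarrow> has_q_expansion G X c' Y"
proof -
  have "((\<lambda>n. c n * q_power n \<tau>) has_sum F \<tau>) X \<longleftrightarrow> ((\<lambda>n. c' n * q_power n \<tau>) has_sum G \<tau>) X"
    if "Im \<tau> > Y" for \<tau>
    unfolding assms(1)[OF that] by (rule has_sum_cong) (simp add: assms(2))
  then show ?thesis by (auto simp: has_q_expansion_def)
qed

lemma has_q_expansion_change_support:
  assumes "\<And>n. n \<in> X - X' \<Longrightarrow> c n = 0" "\<And>n. n \<in> X' - X \<Longrightarrow> c' n = 0" "\<And>n. n \<in> X \<inter> X' \<Longrightarrow> c n = c' n"
  shows "has_q_expansion F X c Y \<longleftrightarrow> has_q_expansion F X' c' Y"
proof -
  have "((\<lambda>n. c n * q_power n \<tau>) has_sum F \<tau>) X \<longleftrightarrow> ((\<lambda>n. c' n * q_power n \<tau>) has_sum F \<tau>) X'" for \<tau>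
    by (rule has_sum_cong_neutral) (simp_all add: assms)
  then show ?thesis by (simp add: has_q_expansion_def)
qed

lemma has_q_expansion_cmult:
  "has_q_expansion F X c Y \<Longrightarrow> has_q_expansion (\<lambda>\<tau>. t * F \<tau>) X (\<lambda>n. t * c n) Y"
  by (auto simp: has_q_expansion_def mult.assoc intro: has_sum_cmult_right)

lemma has_q_expansion_sum:
  assumes "finite I" "\<And>i. i \<in> I \<Longrightarrow> has_q_expansion (F i) X (c i) Y"
  shows "has_q_expansion (\<lambda>\<tau>. \<Sum>i\<in>I. F i \<tau>) X (\<lambda>n. \<Sum>i\<in>I. c i n) Y"
  using assms by (auto simp: has_q_expansion_def sum_distrib_right intro: has_sum_sum)

lemma has_q_expansion_shift:
  assumes "has_q_expansion F X c Y"
  shows "has_q_expansion (\<lambda>\<tau>. F (\<tau> + of_nat b)) X (\<lambda>n. c n * e_rat (of_nat b * n)) Y"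
proof (rule has_q_expansionI)
  fix \<tau> assume "Im \<tau> > Y"
  then have "((\<lambda>n. c n * q_power n (\<tau> + of_nat b)) has_sum F (\<tau> + of_nat b)) X"
    by (intro has_q_expansionD[OF assms]) simp
  moreover have "q_power n (\<tau> + of_nat b) = e_rat (of_nat b * n) * q_power n \<tau>" for n
    unfolding e_add[symmetric] by (simp add: of_rat_mult algebra_simps)
  ultimately show "((\<lambda>n. c n * e_rat (of_nat b * n) * q_power n \<tau>) has_sum F (\<tau> + of_nat b)) X"
    by (simp add: mult.assoc)
qed

lemma has_q_expansion_scale:
  assumes "has_q_expansion F UNIV c Y" "0 < s"
  shows "has_q_expansion (\<lambda>\<tau>. F (of_real (of_rat s) * \<tau>)) UNIV (\<lambda>n. c (n / s)) (Y / of_rat s)"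
proof (rule has_q_expansionI)
  fix \<tau> assume "Im \<tau> > Y / of_rat s"
  then have "Im (of_real (of_rat s) * \<tau>) > Y"
    using assms(2) by (simp add: field_simps)
  then have "((\<lambda>n. c n * q_power n (of_real (of_rat s) * \<tau>)) has_sum
      F (of_real (of_rat s) * \<tau>)) UNIV"
    by (rule has_q_expansionD[OF assms(1)])
  moreover have bij: "bij (\<lambda>n. n / s)"
    by (rule bij_betw_byWitness[where f' = "\<lambda>n. n * s"]) (use assms(2) in auto)
  ultimately have "((\<lambda>n. c (n / s) * q_power (n / s) (of_real (of_rat s) * \<tau>)) has_sum
      F (of_real (of_rat s) * \<tau>)) UNIV"
    by (subst has_sum_reindex_bij_betw[OF bij, of "\<lambda>n. c n * q_power n (of_real (of_rat s) * \<tau>)"])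
  moreover have "q_power (n / s) (of_real (of_rat s) * \<tau>) = q_power n \<tau>" for n
    using assms(2) by (simp add: of_rat_divide)
  ultimately show "((\<lambda>n. c (n / s) * q_power n \<tau>) has_sum F (of_real (of_rat s) * \<tau>)) UNIV"
    by simp
qed

lemma has_q_expansion_moebius:
  fixes a b d :: nat
  assumes "has_q_expansion F UNIV c Y" "0 < a" "0 < d"
  shows "has_q_expansion (\<lambda>\<tau>. F ((of_nat a * \<tau> + of_nat b) / of_nat d)) UNIV
    (\<lambda>n. c (of_nat d * n / of_nat a) * e_rat (of_nat b * n / of_nat a)) (real d * Y / real a)"
proof -
  have "has_q_expansion (\<lambda>\<tau>. F (of_real (of_rat (1 / of_nat d)) * \<tau>)) UNIV
      (\<lambda>n. c (n / (1 / of_nat d))) (Y / of_rat (1 / of_nat d))"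
    by (rule has_q_expansion_scale[OF assms(1)]) (use assms in simp)
  from has_q_expansion_scale[OF has_q_expansion_shift[OF this, of b], of "of_nat a"] show ?thesis
    using assms(2,3) by (simp add: of_rat_divide mult.commute)
qed

lemma has_q_expansion_unique:
  fixes H :: nat
  assumes "0 < H" "X \<subseteq> range (\<lambda>m::int. of_int m / of_nat H)"
    and "has_q_expansion F X c Y" "has_q_expansion F X c' Y'" "n \<in> X"
  shows "c n = c' n"
proof -
  define \<phi> where "\<phi> m = (of_int m / of_nat H :: rat)" for m :: int
  have inj: "inj \<phi>" using assms(1) by (auto simp: inj_def \<phi>_def)
  define t where "t = max Y Y' + 1"
  define g where "g m = (if \<phi> m \<in> X then (c (\<phi> m) - c' (\<phi> m))
      * q_power (\<phi> m) (\<i> * of_real t) else 0)" for m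
  have zero: "((\<lambda>m. g m * e (of_int m * of_real \<theta>)) has_sum 0) UNIV" for \<theta>
  proof -
    define \<tau> where "\<tau> = \<i> * of_real t + of_real (real H * \<theta>)"
    have "((\<lambda>n. c n * q_power n \<tau> + (-1) * (c' n * q_power n \<tau>)) has_sum F \<tau> + (-1) * F \<tau>) X"
      by (intro has_sum_add has_sum_cmult_right has_q_expansionD[OF assms(3)]
          has_q_expansionD[OF assms(4)])
        (simp_all add: \<tau>_def t_def)
    then have "((\<lambda>n. (c n - c' n) * q_power n \<tau>) has_sum 0) X"
      by (simp add: left_diff_distrib)
    then have "((\<lambda>n. if n \<in> X then (c n - c' n) * q_power n \<tau> else 0) has_sum 0) (range \<phi>)"
      by (rule has_sum_cong_neutral[THEN iffD1, rotated -1])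
        (use assms(2) in \<open>auto simp: \<phi>_def\<close>)
    moreover have "q_power (\<phi> m) \<tau> = q_power (\<phi> m) (\<i> * of_real t) * e (of_int m * of_real \<theta>)" for m
      unfolding e_add[symmetric] using assms(1)
      by (simp add: \<tau>_def \<phi>_def of_rat_divide distrib_left)
    ultimately show ?thesis
      unfolding has_sum_reindex[OF inj]
      by (simp add: o_def g_def mult.assoc if_distrib[of "\<lambda>x. x * _"] cong: if_cong)
  qed
  obtain m where m: "n = \<phi> m" using assms(2,5) by (auto simp: \<phi>_def)
  have "g m = 0" by (rule trigonometric_series_zero[OF zero])
  then show ?thesis using assms(5) by (simp add: g_def m e_def)
qed

subsection \<open>Expansions of modular forms\<close>

lemma e_rat_eq_1_iff: "e_rat q = 1 \<longleftrightarrow> q \<in> \<int>"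
proof -
  have "real_of_rat q \<in> \<int> \<longleftrightarrow> q \<in> \<int>"
    by (auto elim!: Ints_cases) (metis Ints_of_int of_rat_eq_iff of_rat_of_int_eq)
  then show ?thesis unfolding e_of_real_eq_1_iff .
qed

lemma mem_exps_iff: "q \<in> exps N r \<longleftrightarrow> q - of_int (x_N N r) / 24 \<in> \<int>"
  by (auto simp: exps_def Ints_def field_simps)

lemma exps_subset_range: "exps N r \<subseteq> range (\<lambda>m::int. of_int m / of_nat 24)"
proof
  fix q assume "q \<in> exps N r"
  then obtain m where "q = of_int (x_N N r) / 24 + of_int m" by (auto simp: exps_def)
  then have "q = of_int (x_N N r + 24 * m) / of_nat 24" by (simp add: field_simps)
  then show "q \<in> range (\<lambda>m::int. of_int m / of_nat 24)" by blast
qed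

lemma modular_form_translate:
  assumes "meromorphic_modular_form N k (chi_r N r) f" "Im \<tau> > 0"
  shows "f (\<tau> + 1) = e_rat (of_int (x_N N r) / 24) * f \<tau>"
proof -
  have "in_Gamma0 N (1, 1, 0, 1)" by (simp add: in_Gamma0_def in_SL2Z_def)
  then have "slash k f (1, 1, 0, 1) 1 \<tau> = chi_r N r (1, 1, 0, 1) 1 * f \<tau>"
    using assms unfolding meromorphic_modular_form_def upper_half_def by blast
  moreover have "chi_r N r (1, 1, 0, 1) 1 = e (of_real (of_int (x_N N r) / 24))"
    by (simp add: chi_r_def Psi_def x_N_def mult.commute)
  ultimately show ?thesis by (simp add: slash_def mobius_def of_rat_divide)
qed

lemma modular_form_expansion_at_infinity:
  assumes "meromorphic_modular_form N k chi f"
  obtains h :: nat and c Y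
    where "0 < h" "has_q_expansion f (range (\<lambda>m::int. of_int m / of_nat h)) c Y"
proof -
  have "in_SL2Z (1, 0, 0, 1)" by (simp add: in_SL2Z_def)
  then obtain h :: nat and Y c where h: "0 < h"
    and expansion: "\<And>\<tau>. Im \<tau> > Y \<Longrightarrow>
      ((\<lambda>m. c m * e (of_int m / of_nat h * \<tau>)) has_sum slash k f (1, 0, 0, 1) 1 \<tau>) UNIV"
    using assms unfolding meromorphic_modular_form_def by blast
  define \<phi> where "\<phi> m = (of_int m / of_nat h :: rat)" for m :: int
  have inj: "inj \<phi>" using h by (auto simp: inj_def \<phi>_def)
  have "has_q_expansion f (range \<phi>) (c \<circ> inv_into UNIV \<phi>) Y"
  proof (rule has_q_expansionI)
    fix \<tau> assume "Im \<tau> > Y"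
    from expansion[OF this] have "((\<lambda>m. c m * q_power (\<phi> m) \<tau>) has_sum f \<tau>) UNIV"
      by (simp add: slash_def mobius_def \<phi>_def of_rat_divide)
    then show "((\<lambda>n. (c \<circ> inv_into UNIV \<phi>) n * q_power n \<tau>) has_sum f \<tau>) (range \<phi>)"
      unfolding has_sum_reindex[OF inj] by (simp add: o_def inv_f_f[OF inj])
  qed
  then show thesis using h that unfolding \<phi>_def by blast
qed

lemma modular_form_q_expansion:
  assumes "meromorphic_modular_form N k (chi_r N r) f"
  obtains c Y where "0 \<le> Y" "has_q_expansion f (exps N r) c Y"
proof -
  obtain h :: nat and c Y where h: "0 < h"
    and expansion: "has_q_expansion f (range (\<lambda>m::int. of_int m / of_nat h)) c Y"
      (is "has_q_expansion f ?X c Y")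
    using modular_form_expansion_at_infinity[OF assms] by blast
  define Y0 where "Y0 = max Y 0"
  have expansion: "has_q_expansion f ?X c Y0"
    using expansion by (rule has_q_expansion_mono) (simp add: Y0_def)
  let ?\<zeta> = "e_rat (of_int (x_N N r) / 24)"
  have "has_q_expansion (\<lambda>\<tau>. f (\<tau> + of_nat 1)) ?X (\<lambda>n. ?\<zeta> * c n) Y0"
    using has_q_expansion_cmult[OF expansion, of ?\<zeta>]
    by (rule has_q_expansion_cong[THEN iffD1, rotated -1])
      (simp_all add: modular_form_translate[OF assms] Y0_def)
  from has_q_expansion_unique[OF h order.refl this has_q_expansion_shift[OF expansion]]
  have twisted: "?\<zeta> * c n = c n * e_rat n" if "n \<in> ?X" for n
    using that by simp
  have vanish: "c n = 0" if "n \<in> ?X - exps N r" for n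
  proof -
    have "n - of_int (x_N N r) / 24 \<notin> \<int>" using that by (simp add: mem_exps_iff)
    then have "e_rat (n - of_int (x_N N r) / 24) \<noteq> 1" by (simp add: e_rat_eq_1_iff)
    moreover have "e_rat (n - of_int (x_N N r) / 24) = e_rat n * inverse ?\<zeta>"
      unfolding e_minus[symmetric] e_add[symmetric] by (simp add: of_rat_diff)
    ultimately have "e_rat n \<noteq> ?\<zeta>" by auto
    then show ?thesis using twisted[of n] that by auto
  qed
  have "has_q_expansion f (exps N r) (zero_extension ?X c) Y0"
    using expansion by (rule has_q_expansion_change_support[THEN iffD1, rotated -1])
      (auto intro: vanish)
  then show thesis using that[of Y0] by (simp add: Y0_def)
qed

subsection \<open>The Hecke operator on expansions\<close>

lemma exists_coprime_affine:
  fixes a c n :: int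
  assumes "n \<noteq> 0" "coprime (gcd a c) n"
  shows "\<exists>x. coprime (a * x + c) n"
proof -
  define P where "P = {p \<in> prime_factors n. \<not> p dvd c}"
  have "finite P" by (simp add: P_def)
  have no_prime: "\<not> p dvd a * \<Prod>P + c" if p: "prime p" "p dvd n" for p
  proof (cases "p dvd c")
    case True
    then have "\<not> p dvd a"
      using coprime_common_divisor[OF assms(2), of p] p by auto
    moreover have "\<not> p dvd \<Prod>P"
      using p(1) True \<open>finite P\<close> by (auto simp: P_def prime_dvd_prod_iff dest: primes_dvd_imp_eq)
    ultimately show ?thesis using True p(1) by (simp add: dvd_add_left_iff prime_dvd_mult_iff)
  next
    case False
    then have "p \<in> P" using p assms(1) by (simp add: P_def in_prime_factors_iff)
    then have "p dvd \<Prod>P" using \<open>finite P\<close> by (intro dvd_prodI[of P p "\<lambda>p. p", simplified])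
    then show ?thesis using False by (simp add: dvd_add_right_iff)
  qed
  have "coprime (a * \<Prod>P + c) n"
  proof (rule ccontr)
    assume "\<not> coprime (a * \<Prod>P + c) n"
    then have "\<not> is_unit (gcd (a * \<Prod>P + c) n)" by (simp add: coprime_iff_gcd_eq_1)
    then obtain p where "prime p" "p dvd gcd (a * \<Prod>P + c) n"
      using prime_divisor_exists assms(1) by (metis gcd_eq_0_iff)
    then show False using no_prime[of p] by auto
  qed
  then show ?thesis ..
qed

lemma exists_hecke_matrices:
  fixes a d N :: nat and b :: int
  assumes "0 < N" "0 < d" "coprime N a" "gcd (gcd (int a) b) (int d) = 1"
  shows "\<exists>x y z. (- int N * b + int a * x) * y + int N * int d * z = 1"
proof -
  have "coprime (int a) (int N)" using assms(3) by (simp add: coprime_commute)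
  have "gcd (int a) (- int N * b) = gcd (int a) b"
    by (rule gcd_mult_right_left_cancel) (use \<open>coprime (int a) (int N)\<close> in simp)
  moreover have "coprime (gcd (int a) b) (int N)"
    by (rule coprime_divisors[OF gcd_dvd1 dvd_refl \<open>coprime (int a) (int N)\<close>])
  moreover have "coprime (gcd (int a) b) (int d)"
    using assms(4) by (simp only: coprime_iff_gcd_eq_1)
  ultimately have "coprime (gcd (int a) (- int N * b)) (int N * int d)" by simp
  then obtain x where "coprime (int a * x + - int N * b) (int N * int d)"
    using exists_coprime_affine[of "int N * int d" "int a" "- int N * b"] assms(1,2) by auto
  then obtain y z where "y * (int a * x + - int N * b) + z * (int N * int d) = 1"
    using bezout_int[of "int a * x + - int N * b" "int N * int d"] by auto
  then have "(- int N * b + int a * x) * y + int N * int d * z = 1" by (simp add: algebra_simps)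
  then show ?thesis by blast
qed

lemma sum_shift_periodic:
  fixes G :: "nat \<Rightarrow> 'a :: cancel_comm_monoid_add"
  assumes "\<And>b. G (b + d) = G b"
  shows "(\<Sum>b<d. G (b + a)) = (\<Sum>b<d. G b)"
proof (induction a)
  case (Suc a)
  have "G a + (\<Sum>b<d. G (b + Suc a)) = (\<Sum>b<Suc d. G (b + a))"
    using sum.lessThan_Suc_shift[of "\<lambda>b. G (b + a)" d] by simp
  also have "\<dots> = G a + (\<Sum>b<d. G (b + a))"
    using assms[of a] by (simp add: add.commute)
  finally show ?case using Suc.IH by simp
qed simp

lemma sum_twisted_periodic_zero:
  fixes G :: "nat \<Rightarrow> 'a :: idom"
  assumes "\<And>b. G (b + d) = G b" "\<And>b. G (b + a) = \<omega> * G b" "\<omega> \<noteq> 1"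
  shows "(\<Sum>b<d. G b) = 0"
proof -
  have "(\<Sum>b<d. G b) = (\<Sum>b<d. G (b + a))"
    by (rule sum_shift_periodic[of G d a, symmetric]) (rule assms(1))
  also have "\<dots> = \<omega> * (\<Sum>b<d. G b)"
    by (simp add: assms(2) sum_distrib_left)
  finally have "(\<Sum>b<d. G b) = \<omega> * (\<Sum>b<d. G b)" .
  then have "(1 - \<omega>) * (\<Sum>b<d. G b) = 0" by (simp add: left_diff_distrib)
  then show ?thesis using assms(3) by simp
qed

definition hecke_shifts :: "nat \<Rightarrow> nat \<Rightarrow> nat set" where
  "hecke_shifts a d = {b. b < d \<and> gcd (gcd a b) d = 1}"

definition hecke_weight :: "nat \<Rightarrow> (nat \<Rightarrow> int) \<Rightarrow> real \<Rightarrow> nat \<Rightarrow> nat \<Rightarrow> nat \<Rightarrow> complex" where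
  "hecke_weight N r k l a b =
     of_int (kronecker (int a) (int (varpi N r))) * of_int (root_sign N r a (l div a) (int b)) *
     e24 (- (int b * int (l div a) * x_N N r)) * psi_lr N r k l a b"

definition hecke_coeff :: "nat \<Rightarrow> (nat \<Rightarrow> int) \<Rightarrow> real \<Rightarrow> nat \<Rightarrow> (rat \<Rightarrow> complex) \<Rightarrow> rat \<Rightarrow> complex" where
  "hecke_coeff N r k l c n = of_real (real l powr (- k / 2)) *
     (\<Sum>a\<in>{a. a dvd l \<and> coprime N a}. of_real (real a powr k) *
        (\<Sum>b\<in>hecke_shifts a (l div a). hecke_weight N r k l a b *
           (zero_extension (exps N r) c (of_nat (l div a) * n / of_nat a) *
            e_rat (of_nat b * n / of_nat a))))"

context hecke_level
begin

lemma root_sign_periodic: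
  assumes "a dvd l" "coprime N a"
  shows "root_sign N r a d (b + int a) = root_sign N r a d b"
    and "root_sign N r a d (b + int d) = root_sign N r a d b"
proof -
  have "kronecker (- int N * (b + c)) (int (gcd a d)) = kronecker (- int N * b) (int (gcd a d))"
    if "odd exponent_sum" "int (gcd a d) dvd c" for c
  proof (rule kronecker_cong)
    show "odd (gcd a d)" using odd_divisor_if_odd_exponent_sum[OF that(1) assms] by simp
    have "int (gcd a d) dvd - int N * c" using that(2) by (rule dvd_mult)
    then show "[- int N * (b + c) = - int N * b] (mod int (gcd a d))"
      by (simp add: cong_iff_dvd_diff algebra_simps)
  qed
  then show "root_sign N r a d (b + int a) = root_sign N r a d b"
    "root_sign N r a d (b + int d) = root_sign N r a d b"
    by (auto simp: root_sign_def exponent_sum_def divisor_sum_def)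
qed

lemma hecke_eq:
  assumes k: "k = kprime N r + 2 * of_int j"
  shows "hecke N k (chi_r N r) l f \<tau> = of_real (real l powr (- k / 2)) *
     (\<Sum>a\<in>{a. a dvd l \<and> coprime N a}. of_real (real a powr k) *
        (\<Sum>b\<in>hecke_shifts a (l div a).
           hecke_weight N r k l a b * f ((of_nat a * \<tau> + of_nat b) / of_nat (l div a))))"
  unfolding hecke_def Let_def hecke_shifts_def
proof (intro arg_cong2[of _ _ _ _ "(*)"] sum.cong refl)
  fix a b
  assume a: "a \<in> {a. a dvd l \<and> coprime N a}"
    and b: "b \<in> {b. b < l div a \<and> gcd (gcd a b) (l div a) = 1}"
  define d where "d = l div a"
  have l: "l = a * d" using a by (simp add: d_def)
  then have "0 < d" using l_pos by (auto intro: Nat.gr0I)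
  have "gcd (gcd (int a) (int b)) (int d) = int (gcd (gcd a b) d)" by simp
  then have coprime: "gcd (gcd (int a) (int b)) (int d) = 1" using b by (simp add: d_def)
  define solves where
    "solves = (\<lambda>(x, y, z). (- int N * int b + int a * x) * y + int N * int d * z = (1::int))"
  obtain x y z where xyz: "(SOME t. solves t) = (x, y, z)" by (cases "SOME t. solves t")
  have "\<exists>t. solves t"
    using exists_hecke_matrices[OF N_pos \<open>0 < d\<close> _ coprime] a by (auto simp: solves_def)
  then have "solves (x, y, z)" unfolding xyz[symmetric] by (rule someI_ex)
  then interpret hecke_term N r l a d "int b" x y z
    using N_pos l_mem \<open>0 < d\<close> l by unfold_locales (auto simp: solves_def)
  have "coprime a N" using a by (simp add: coprime_commute)
  have weight: "inverse (chi_r N r (- int N * int b + int a * x, z, - int N * int d, y) 1) *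
      inverse (chi_r N r (int a * y, int b * y - int d * z, int N, x) 1) = hecke_weight N r k l a b"
    unfolding chi_r_product hecke_weight_def d_def[symmetric] psi_lr_eq_e24[OF l \<open>coprime a N\<close> k] ..
  show "(case SOME (x, y, z). (- int N * int b + int a * x) * y + int N * int (l div a) * z = 1 of
      (x, y, z) \<Rightarrow> inverse (chi_r N r (- int N * int b + int a * x, z,
          - int N * int (l div a), y) 1) *
        inverse (chi_r N r (int a * y, int b * y - int (l div a) * z, int N, x) 1) *
        f ((of_nat a * \<tau> + of_nat b) / of_nat (l div a)))
    = hecke_weight N r k l a b * f ((of_nat a * \<tau> + of_nat b) / of_nat (l div a))"
    unfolding d_def[symmetric] solves_def[symmetric] xyz prod.case weight ..
qed

lemma hecke_q_expansion_UNIV: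
  assumes k: "k = kprime N r + 2 * of_int j" and f: "has_q_expansion f (exps N r) c Y" and "0 \<le> Y"
  shows "has_q_expansion (hecke N k (chi_r N r) l f) UNIV (hecke_coeff N r k l c) (real l * Y)"
proof -
  define c' where "c' n = zero_extension (exps N r) c n" for n
  have f': "has_q_expansion f UNIV c' Y"
    using f by (rule has_q_expansion_change_support[THEN iffD1, rotated -1]) (auto simp: c'_def)
  have "has_q_expansion (\<lambda>\<tau>. f ((of_nat a * \<tau> + of_nat b) / of_nat (l div a))) UNIV
      (\<lambda>n. c' (of_nat (l div a) * n / of_nat a) * e_rat (of_nat b * n / of_nat a)) (real l * Y)"
    if "a dvd l" for a b
  proof (rule has_q_expansion_mono[OF has_q_expansion_moebius[OF f']])
    show "0 < a" "0 < l div a" using that l_pos by (auto elim!: dvdE)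
    then have "real (l div a) / real a \<le> real (l div a)" by (simp add: field_simps)
    also have "\<dots> \<le> real l" by simp
    finally show "real (l div a) * Y / real a \<le> real l * Y"
      using mult_right_mono[of "real (l div a) / real a" "real l" Y] assms(3) by simp
  qed
  then show ?thesis
    unfolding hecke_coeff_def[abs_def] c'_def[symmetric]
    using l_pos
    by (subst has_q_expansion_cong[OF hecke_eq[OF k] refl])
      (intro has_q_expansion_cmult has_q_expansion_sum; simp add: hecke_shifts_def)
qed

definition hecke_phase :: "nat \<Rightarrow> nat \<Rightarrow> rat \<Rightarrow> rat" where
  "hecke_phase a d n = n / of_nat a - of_int (int d * x_N N r) / 24"

lemma e24_mult_e_rat:
  "e24 (- (int b * int d * x_N N r)) * e_rat (of_nat b * n / of_nat a)
      = e_rat (of_nat b * hecke_phase a d n)"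
  unfolding e24_def e_add[symmetric]
  by (rule arg_cong[of _ _ e])
    (simp add: hecke_phase_def of_rat_diff of_rat_mult of_rat_divide algebra_simps)

lemma e_rat_mult_hecke_phase_eq_1:
  assumes "d dvd l" "of_nat d * n / of_nat a \<in> exps N r"
  shows "e_rat (of_nat d * hecke_phase a d n) = 1"
proof -
  obtain i where i: "(int d ^ 2 - 1) * x_N N r = 24 * i"
    using dvd_24_square_x_N[OF assms(1)] by blast
  have "of_nat d * hecke_phase a d n
      = (of_nat d * n / of_nat a - of_int (x_N N r) / 24) - of_int ((int d ^ 2 - 1) * x_N N r) / 24"
    by (simp add: hecke_phase_def field_simps power2_eq_square)
  then show ?thesis
    using assms(2) unfolding e_rat_eq_1_iff i by (simp add: mem_exps_iff)
qed

lemma e_rat_mult_hecke_phase_neq_1: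
  assumes l: "l = a * d" and "n \<notin> exps N r"
  shows "e_rat (of_nat a * hecke_phase a d n) \<noteq> 1"
proof
  have "0 < a" using l l_pos by (auto intro: Nat.gr0I)
  obtain i where i: "(int l - 1) * x_N N r = 24 * i" using dvd_24_x_N by blast
  assume "e_rat (of_nat a * hecke_phase a d n) = 1"
  moreover have "n - of_int (x_N N r) / 24
      = of_nat a * hecke_phase a d n + of_int ((int l - 1) * x_N N r) / 24"
    using \<open>0 < a\<close> by (simp add: hecke_phase_def l field_simps)
  ultimately have "n - of_int (x_N N r) / 24 \<in> \<int>"
    unfolding e_rat_eq_1_iff i by simp
  then show False using assms(2) by (simp add: mem_exps_iff)
qed

lemma sum_root_sign_zero:
  assumes l: "l = a * d" and "coprime N a"
    and "n \<notin> exps N r" "of_nat d * n / of_nat a \<in> exps N r"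
  shows "(\<Sum>b\<in>hecke_shifts a d. of_int (root_sign N r a d (int b)) *
    (e24 (- (int b * int d * x_N N r)) * e_rat (of_nat b * n / of_nat a))) = 0"
proof -
  define p where "p = hecke_phase a d n"
  define G where "G b = (if gcd (gcd a b) d = 1
    then of_int (root_sign N r a d (int b)) * e_rat (of_nat b * p) else 0)" for b
  have e_shift: "e_rat ((of_nat b + of_nat c) * p)
      = e_rat (of_nat c * p) * e_rat (of_nat b * p)" for b c
    unfolding e_add[symmetric] by (simp add: distrib_right of_rat_add add.commute)
  have dvd: "a dvd l" "d dvd l" using l by simp_all
  have "e_rat (of_nat d * p) = 1"
    unfolding p_def by (rule e_rat_mult_hecke_phase_eq_1[OF dvd(2) assms(4)])
  moreover have "gcd (gcd a (b + d)) d = gcd (gcd a b) d" for b by (simp add: gcd.assoc)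
  ultimately have period_d: "G (b + d) = G b" for b
    using root_sign_periodic(2)[OF dvd(1) assms(2), of d "int b"] by (simp add: G_def e_shift)
  have "gcd (gcd a (b + a)) d = gcd (gcd a b) d" for b by (simp add: add.commute[of b])
  then have twist_a: "G (b + a) = e_rat (of_nat a * p) * G b" for b
    using root_sign_periodic(1)[OF dvd(1) assms(2), of d "int b"] by (simp add: G_def e_shift)
  have "e_rat (of_nat a * p) \<noteq> 1"
    unfolding p_def by (rule e_rat_mult_hecke_phase_neq_1[OF l assms(3)])
  from sum_twisted_periodic_zero[of G d a, OF period_d twist_a this]
  have "(\<Sum>b\<in>{b \<in> {..<d}. gcd (gcd a b) d = 1}. of_int (root_sign N r a d (int b))
      * e_rat (of_nat b * p)) = 0"
    unfolding G_def by (subst sum.inter_filter) simp_all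
  moreover have "{b \<in> {..<d}. gcd (gcd a b) d = 1} = hecke_shifts a d"
    by (auto simp: hecke_shifts_def)
  ultimately show ?thesis unfolding e24_mult_e_rat p_def by simp
qed

lemma hecke_coeff_zero:
  assumes k: "k = kprime N r + 2 * of_int j" and "n \<notin> exps N r"
  shows "hecke_coeff N r k l c n = 0"
proof -
  have "(\<Sum>b\<in>hecke_shifts a (l div a). hecke_weight N r k l a b *
      ((if of_nat (l div a) * n / of_nat a \<in> exps N r then t else 0) *
       e_rat (of_nat b * n / of_nat a))) = 0"
    if a: "a dvd l" "coprime N a" for a t
  proof (cases "of_nat (l div a) * n / of_nat a \<in> exps N r")
    case True
    define d where "d = l div a"
    have l: "l = a * d" using a by (simp add: d_def)
    have "psi_lr N r k l a b = e24 (- (3 * odd_cofactor_sum * (int a - 1)))" for b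
      using psi_lr_eq_e24[OF l _ k] a by (simp add: coprime_commute)
    then have "(\<Sum>b\<in>hecke_shifts a d. hecke_weight N r k l a b
        * (t * e_rat (of_nat b * n / of_nat a)))
        = of_int (kronecker (int a) (int (varpi N r)))
            * e24 (- (3 * odd_cofactor_sum * (int a - 1))) * t *
          (\<Sum>b\<in>hecke_shifts a d. of_int (root_sign N r a d (int b)) *
            (e24 (- (int b * int d * x_N N r)) * e_rat (of_nat b * n / of_nat a)))"
      by (simp add: hecke_weight_def d_def sum_distrib_left mult_ac)
    also have "\<dots> = 0"
      using sum_root_sign_zero[OF l a(2) assms(2)] True by (simp add: d_def)
    finally show ?thesis using True by (simp add: d_def)
  qed simp
  then show ?thesis by (simp add: hecke_coeff_def)
qed

theorem hecke_q_expansion: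
  assumes "k = kprime N r + 2 * of_int j" "has_q_expansion f (exps N r) c Y" "0 \<le> Y"
  shows "has_q_expansion (hecke N k (chi_r N r) l f) (exps N r) (hecke_coeff N r k l c)
    (real l * Y)"
  using hecke_q_expansion_UNIV[OF assms]
  by (rule has_q_expansion_change_support[THEN iffD1, rotated -1])
    (simp_all add: hecke_coeff_zero[OF assms(1)])

lemma kronecker_powr_eq_root_sign:
  assumes k: "k = kprime N r + 2 * of_int j" and "0 < a" "coprime N a" "b \<in> hecke_shifts a d"
  shows "of_int (kronecker (- int N * int b) (int (gcd a d))) powr of_real (2 * k)
    = (of_int (root_sign N r a d (int b)) :: complex)"
proof -
  have "coprime N (gcd a d)"
    by (rule coprime_divisors[OF dvd_refl gcd_dvd1 assms(3)])
  then have "coprime (int N) (int (gcd a d))" by (simp only: coprime_int_iff)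
  moreover have "gcd b (gcd a d) = gcd (gcd a b) d" by (simp only: gcd.assoc gcd.left_commute)
  then have "coprime b (gcd a d)"
    using assms(4) by (simp only: hecke_shifts_def coprime_iff_gcd_eq_1) simp
  then have "coprime (int b) (int (gcd a d))" by (simp only: coprime_int_iff)
  ultimately have "coprime (- int N * int b) (int (gcd a d))"
    by (simp only: coprime_mult_left_iff coprime_minus_left_iff)
  then have "\<bar>kronecker (- int N * int b) (int (gcd a d))\<bar> = 1"
    using assms(2) by (intro abs_kronecker) simp_all
  moreover have "of_real (2 * k) = (of_int (exponent_sum + 4 * j) :: complex)"
    by (simp add: k kprime_eq)
  ultimately show ?thesis
    by (simp only: of_int_sign_powr) (simp add: root_sign_def exponent_sum_def divisor_sum_def)
qed

lemma hecke_weight_mult_e: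
  assumes k: "k = kprime N r + 2 * of_int j" and l: "l = a * d"
    and "coprime N a" "b \<in> hecke_shifts a d"
  shows "hecke_weight N r k l a b * e_rat (of_nat b * n / of_nat a)
    = of_int (kronecker (int a) (int (varpi N r))) *
      (of_int (kronecker (- int N * int b) (int (gcd a d))) powr (of_real (2 * k)) *
       e_rat (of_nat (b * d) * (n / of_nat l - of_int (x_N N r) / 24)) * psi_lr N r k l a b)"
proof -
  have pos: "0 < a" "0 < d" using l l_pos by (auto intro: Nat.gr0I)
  have phase: "of_nat (b * d) * (n / of_nat l - of_int (x_N N r) / 24)
      = of_nat b * hecke_phase a d n"
    using pos by (simp add: hecke_phase_def l field_simps)
  have "l div a = d" using l pos by simp
  then show ?thesis
    unfolding phase e24_mult_e_rat[symmetric] hecke_weight_def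
      kronecker_powr_eq_root_sign[OF k pos(1) assms(3,4)]
    by (simp add: mult_ac)
qed

lemma hecke_coeff_summand:
  assumes k: "k = kprime N r + 2 * of_int j" and l: "l = a * d" and "coprime N a"
  shows "of_real (real a powr k) * (\<Sum>b\<in>hecke_shifts a d. hecke_weight N r k l a b *
      (zero_extension (exps N r) c (of_nat d * n / of_nat a) * e_rat (of_nat b * n / of_nat a)))
    = of_int (kronecker (int a) (int (varpi N r))) * of_real (real a powr k) *
      zero_extension (exps N r) c (of_nat l * n / of_nat (a ^ 2)) *
      (\<Sum>b\<in>hecke_shifts a d.
        of_int (kronecker (- int N * int b) (int (gcd a d))) powr (of_real (2 * k)) *
        e_rat (of_nat (b * d) * (n / of_nat l - of_int (x_N N r) / 24)) * psi_lr N r k l a b)"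
proof -
  define t where "t = zero_extension (exps N r) c (of_nat d * n / of_nat a)"
  have "0 < a" using l l_pos by (auto intro: Nat.gr0I)
  then have ratio: "of_nat l * n / of_nat (a ^ 2) = of_nat d * n / (of_nat a :: rat)"
    by (simp add: l power2_eq_square)
  have "(\<Sum>b\<in>hecke_shifts a d. hecke_weight N r k l a b * (t * e_rat (of_nat b * n / of_nat a)))
      = t * (\<Sum>b\<in>hecke_shifts a d. hecke_weight N r k l a b * e_rat (of_nat b * n / of_nat a))"
    by (simp only: sum_distrib_left mult_ac)
  also have "(\<Sum>b\<in>hecke_shifts a d. hecke_weight N r k l a b * e_rat (of_nat b * n / of_nat a))
      = of_int (kronecker (int a) (int (varpi N r))) *
        (\<Sum>b\<in>hecke_shifts a d.
          of_int (kronecker (- int N * int b) (int (gcd a d))) powr (of_real (2 * k)) *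
          e_rat (of_nat (b * d) * (n / of_nat l - of_int (x_N N r) / 24)) * psi_lr N r k l a b)"
    unfolding sum_distrib_left by (intro sum.cong refl hecke_weight_mult_e[OF k l assms(3)])
  finally show ?thesis
    unfolding ratio t_def[symmetric] by (simp only: mult_ac)
qed

lemma hecke_coeff_eq:
  assumes k: "k = kprime N r + 2 * of_int j"
  shows "hecke_coeff N r k l c n = of_real (real l powr (- k / 2)) *
    (\<Sum>a\<in>{a. a dvd l \<and> coprime a N}.
       let d = l div a in
       of_int (kronecker (int a) (int (varpi N r))) * of_real (real a powr k) *
       zero_extension (exps N r) c (of_nat l * n / of_nat (a ^ 2)) *
       (\<Sum>b\<in>{b. b < d \<and> gcd (gcd a b) d = 1}.
          (of_int (kronecker (- int N * int b) (int (gcd a d)))) powr (of_real (2 * k)) *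
          e_rat (of_nat (b * d) * (n / of_nat l - of_int (x_N N r) / 24)) *
          psi_lr N r k l a b))"
  unfolding hecke_coeff_def Let_def hecke_shifts_def[symmetric] coprime_commute[of _ N]
  by (intro arg_cong2[of _ _ _ _ "(*)"] refl sum.cong hecke_coeff_summand[OF k]) simp_all

end

theorem theorem9p15:
  fixes N :: nat and r :: "nat \<Rightarrow> int" and k :: real and l :: nat
    and f :: "complex \<Rightarrow> complex"
  assumes hN: "N \<ge> 1"
    and hk: "\<exists>j::int. k = kprime N r + 2 * of_int j"
    and hf: "meromorphic_modular_form N k (chi_r N r) f"
    and hl: "l \<in> L_r N r"
  shows "\<exists>Y0::real. Y0 \<ge> 0 \<and> (\<exists>cf cT :: rat \<Rightarrow> complex.
     (\<forall>\<tau>. Im \<tau> > Y0 \<longrightarrow>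
        ((\<lambda>n. cf n * e (of_real (of_rat n) * \<tau>)) has_sum f \<tau>) (exps N r) \<and>
        ((\<lambda>n. cT n * e (of_real (of_rat n) * \<tau>)) has_sum hecke N k (chi_r N r) l f \<tau>) (exps N r)) \<and>
     (\<forall>Y1 c'. (\<forall>\<tau>. Im \<tau> > Y1 \<longrightarrow>
        ((\<lambda>n. c' n * e (of_real (of_rat n) * \<tau>)) has_sum f \<tau>) (exps N r)) \<longrightarrow>
        (\<forall>n\<in>exps N r. c' n = cf n)) \<and>
     (\<forall>Y1 c'. (\<forall>\<tau>. Im \<tau> > Y1 \<longrightarrow>
        ((\<lambda>n. c' n * e (of_real (of_rat n) * \<tau>)) has_sum hecke N k (chi_r N r) l f \<tau>) (exps N r)) \<longrightarrow>
        (\<forall>n\<in>exps N r. c' n = cT n)) \<and>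
     (\<forall>n\<in>exps N r.
        cT n = of_real (real l powr (- k / 2)) *
          (\<Sum>a\<in>{a. a dvd l \<and> coprime a N}.
             let d = l div a in
             of_int (kronecker (int a) (int (varpi N r))) * of_real (real a powr k) *
             (if of_nat l * n / of_nat (a ^ 2) \<in> exps N r then cf (of_nat l * n / of_nat (a ^ 2)) else 0) *
             (\<Sum>b\<in>{b. b < d \<and> gcd (gcd a b) d = 1}.
                (of_int (kronecker (- int N * int b) (int (gcd a d)))) powr (of_real (2 * k)) *
                e (of_real (of_rat (of_nat (b * d) * (n / of_nat l - of_int (x_N N r) / 24)))) *
                psi_lr N r k l a b))))"
proof -
  interpret hecke_level N r l using hN hl by unfold_locales simp
  obtain j where k: "k = kprime N r + 2 * of_int j" using hk by blast
  obtain cf Y where Y: "0 \<le> Y" and f: "has_q_expansion f (exps N r) cf Y"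
    using modular_form_q_expansion[OF hf] by blast
  define cT where "cT = hecke_coeff N r k l cf"
  have Tf: "has_q_expansion (hecke N k (chi_r N r) l f) (exps N r) cT (real l * Y)"
    unfolding cT_def by (rule hecke_q_expansion[OF k f Y])
  have "Y \<le> real l * Y" "0 \<le> real l * Y"
    using mult_right_mono[of 1 "real l" Y] l_pos Y by simp_all
  have unique: "c' n = c n"
    if "has_q_expansion F (exps N r) c Y1" "\<forall>\<tau>. Im \<tau> > Y2 \<longrightarrow>
      ((\<lambda>n. c' n * q_power n \<tau>) has_sum F \<tau>) (exps N r)" "n \<in> exps N r" for F c c' Y1 Y2 n
    using has_q_expansion_unique[OF _ exps_subset_range that(1) _ that(3)] that(2)
    by (simp add: has_q_expansion_def)
  show ?thesis
  proof (rule exI[of _ "real l * Y"], rule conjI[OF \<open>0 \<le> real l * Y\<close>],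
      rule exI[of _ cf], rule exI[of _ cT], intro conjI allI impI ballI)
    fix \<tau> assume "Im \<tau> > real l * Y"
    then show "((\<lambda>n. cf n * q_power n \<tau>) has_sum f \<tau>) (exps N r)"
      "((\<lambda>n. cT n * q_power n \<tau>) has_sum hecke N k (chi_r N r) l f \<tau>) (exps N r)"
      using has_q_expansionD[OF has_q_expansion_mono[OF f \<open>Y \<le> real l * Y\<close>]] has_q_expansionD[OF Tf]
      by auto
  qed (rule unique[OF f] unique[OF Tf] hecke_coeff_eq[OF k, of cf, folded cT_def]; assumption)+
qed

end
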